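(* Let $\Gamma$ be a $\mathfrak{t}$ moment graph with vertex set $\mathcal{V}$ and edge set $\mathcal{E}$. The association sending a $\Gamma$-sheaf $\mathcal{M}$ to the sheaf $O\mapsto\mathcal{M}(O)$ on the topological space $S(\Gamma)=\mathcal{V}\cup\mathcal{E}$ gives a bijection between $\Gamma$-sheaves and sheaves of modules over the sheaf of rings $\mathcal{A}$ on $S(\Gamma)$.
   Context: Let $\mathfrak{t}$ be a complex vector space. A $\mathfrak{t}$ moment graph $\Gamma$ is a finite graph with, for each edge $L$, a one-dimensional subspace $V_L\subset\mathfrak{t}^*$ of the dual space (its direction), and a partial order on the vertices such that if an edge joins $x$ and $y$ then $x\ne y$ and either $x\le y$ or $y\le x$. $A=\mathrm{Sym}(\mathfrak{t}^* )$ is the graded ring of polynomial functions on $\mathfrak{t}$, and $A_L=A/V_LA$. "Module" over $A$ or $A_L$ always means finitely generated graded module. A $\Gamma$-sheaf is a triple $\mathcal{M}=(\{M_x\},\{M_L\},\{\rho_{x,L}\})$ with $M_x$ an $A$-module for each vertex $x$, $M_L$ an $A_L$-module (hence also an $A$-module) for each edge $L$, and $\rho_{x,L}\colon M_x\to M_L$ a homomorphism of $A$-modules whenever $x$ lies on $L$. For $Z\subset S(\Gamma)$, $\mathcal{M}(Z)$ is the set of tuples $(s_a)_{a\in Z}\in\bigoplus_{a\in Z}M_a$ with $\rho_{x,L}(s_x)=s_L$ whenever $x,L\in Z$ and $x$ lies on $L$. The sheaf of rings $\mathcal{A}$ is given by $A_x=A$ for each vertex $x$, $A_L=A/V_LA$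 for each edge $L$, and the quotient maps $A_x\to A_L$; rings of sections $\mathcal{A}(Z)$ are defined in the same way, and $\mathcal{M}(Z)$ is an $\mathcal{A}(Z)$-module. Topology on $S(\Gamma)$: a subset $O$ is open if whenever a vertex $x$ is in $O$, all edges adjacent to $x$ are in $O$. With the obvious restriction maps, $O\mapsto\mathcal{A}(O)$ is a sheaf of rings on $S(\Gamma)$ and $O\mapsto\mathcal{M}(O)$ is a sheaf of modules over it. The convention that modules are finitely generated and graded also applies to sheaves of modules over $\mathcal{A}$. *)

theory Defs
  imports "HOL-Algebra.Module" "HOL-Algebra.QuotRing" "HOL-Analysis.Abstract_Topology"
begin

section \<open>Polynomial functions on a complex vector space\<close>

text \<open>
  The vector space \<open>\<tt>\<close> is the whole type \<open>'t\<close> with scalar multiplication \<open>scale\<close>. Over the complex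
  numbers the symmetric algebra of the dual space is the algebra of functions on \<open>\<tt>\<close> generated
  by the linear functionals, and its degree-\<open>d\<close> part consists of the members homogeneous of
  degree \<open>d\<close>.
\<close>

definition dual :: "(complex \<Rightarrow> 't::ab_group_add \<Rightarrow> 't) \<Rightarrow> ('t \<Rightarrow> complex) set" where
  "dual scale = {f. Vector_Spaces.linear scale (*) f}"

inductive_set polyfun :: "(complex \<Rightarrow> 't::ab_group_add \<Rightarrow> 't) \<Rightarrow> ('t \<Rightarrow> complex) set"
  for scale where
  const: "(\<lambda>_. c) \<in> polyfun scale"
| linear: "f \<in> dual scale \<Longrightarrow> f \<in> polyfun scale"
| add: "p \<in> polyfun scale \<Longrightarrow> q \<in> polyfun scale \<Longrightarrow> (\<lambda>v. p v + q v) \<in> polyfun scale"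
| mult: "p \<in> polyfun scale \<Longrightarrow> q \<in> polyfun scale \<Longrightarrow> (\<lambda>v. p v * q v) \<in> polyfun scale"

definition polyring :: "(complex \<Rightarrow> 't::ab_group_add \<Rightarrow> 't) \<Rightarrow> ('t \<Rightarrow> complex) ring" where
  "polyring scale =
    \<lparr>carrier = polyfun scale, mult = (\<lambda>p q v. p v * q v), one = (\<lambda>_. 1),
     zero = (\<lambda>_. 0), add = (\<lambda>p q v. p v + q v)\<rparr>"

definition polydeg :: "(complex \<Rightarrow> 't::ab_group_add \<Rightarrow> 't) \<Rightarrow> nat \<Rightarrow> ('t \<Rightarrow> complex) set" where
  "polydeg scale d = {p \<in> polyfun scale. \<forall>c v. p (scale c v) = c ^ d * p v}"


section \<open>Graded modules\<close>

text \<open>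
  Rings are graded by the natural numbers and modules by the integers; gradings are kept as
  separate families of subsets.
\<close>

definition graded_module ::
  "('a, 'z) ring_scheme \<Rightarrow> (nat \<Rightarrow> 'a set) \<Rightarrow> ('a, 'b) module \<Rightarrow> (int \<Rightarrow> 'b set) \<Rightarrow> bool" where
  "graded_module R Rd M Md \<longleftrightarrow>
     Module.module R M \<and>
     (\<forall>d. additive_subgroup (Md d) M) \<and>
     (\<forall>m\<in>carrier M. \<exists>!f. (\<forall>d. f d \<in> Md d) \<and> finite {d. f d \<noteq> \<zero>\<^bsub>M\<^esub>} \<and>
        m = (\<Oplus>\<^bsub>M\<^esub> d\<in>{d. f d \<noteq> \<zero>\<^bsub>M\<^esub>}. f d)) \<and>
     (\<forall>i d. \<forall>a\<in>Rd i. \<forall>m\<in>Md d. a \<odot>\<^bsub>M\<^esub> m \<in> Md (int i + d))"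

definition finitely_generated :: "('a, 'z) ring_scheme \<Rightarrow> ('a, 'b) module \<Rightarrow> bool" where
  "finitely_generated R M \<longleftrightarrow>
     (\<exists>X. finite X \<and> X \<subseteq> carrier M \<and>
        (\<forall>m\<in>carrier M. \<exists>c. c \<in> X \<rightarrow> carrier R \<and> m = (\<Oplus>\<^bsub>M\<^esub> x\<in>X. c x \<odot>\<^bsub>M\<^esub> x)))"

text \<open>
  Degree-preserving maps that are semilinear along a map \<open>\<phi>\<close> of scalars; for module
  homomorphisms over a single ring \<open>\<phi>\<close> is the identity.
\<close>

definition graded_hom ::
  "('a, 'z) ring_scheme \<Rightarrow> ('a \<Rightarrow> 'c) \<Rightarrow> ('a, 'b) module \<Rightarrow> (int \<Rightarrow> 'b set) \<Rightarrow>
   ('c, 'd) module \<Rightarrow> (int \<Rightarrow> 'd set) \<Rightarrow> ('b \<Rightarrow> 'd) \<Rightarrow> bool" where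
  "graded_hom R \<phi> M Md N Nd h \<longleftrightarrow>
     h \<in> carrier M \<rightarrow> carrier N \<and>
     (\<forall>m\<in>carrier M. \<forall>n\<in>carrier M. h (m \<oplus>\<^bsub>M\<^esub> n) = h m \<oplus>\<^bsub>N\<^esub> h n) \<and>
     (\<forall>a\<in>carrier R. \<forall>m\<in>carrier M. h (a \<odot>\<^bsub>M\<^esub> m) = \<phi> a \<odot>\<^bsub>N\<^esub> h m) \<and>
     (\<forall>d. h ` Md d \<subseteq> Nd d)"

definition graded_iso ::
  "('a, 'z) ring_scheme \<Rightarrow> ('a, 'b) module \<Rightarrow> (int \<Rightarrow> 'b set) \<Rightarrow>
   ('a, 'd) module \<Rightarrow> (int \<Rightarrow> 'd set) \<Rightarrow> ('b \<Rightarrow> 'd) \<Rightarrow> bool" where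
  "graded_iso R M Md N Nd h \<longleftrightarrow>
     graded_hom R (\<lambda>a. a) M Md N Nd h \<and> bij_betw h (carrier M) (carrier N)"


section \<open>Moment graphs\<close>

text \<open>Edges are abstract objects with a set of endpoints, so parallel edges are allowed.\<close>

record ('t, 'v, 'e) moment_graph =
  vertices :: "'v set"
  edges :: "'e set"
  ends :: "'e \<Rightarrow> 'v set"
  direction :: "'e \<Rightarrow> ('t \<Rightarrow> complex) set"
  vertex_order :: "'v rel"

definition is_moment_graph ::
  "(complex \<Rightarrow> 't::ab_group_add \<Rightarrow> 't) \<Rightarrow> ('t, 'v, 'e) moment_graph \<Rightarrow> bool" where
  "is_moment_graph scale G \<longleftrightarrow>
     finite (vertices G) \<and> finite (edges G) \<and>
     partial_order_on (vertices G) (vertex_order G) \<and>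
     (\<forall>L\<in>edges G.
        (\<exists>x\<in>vertices G. \<exists>y\<in>vertices G. ends G L = {x, y} \<and> x \<noteq> y \<and>
           ((x, y) \<in> vertex_order G \<or> (y, x) \<in> vertex_order G)) \<and>
        (\<exists>\<phi>\<in>dual scale. \<phi> \<noteq> (\<lambda>_. 0) \<and> direction G L = {(\<lambda>v. c * \<phi> v) | c. True}))"

type_synonym ('v, 'e) pts = "('v + 'e) set"

definition graph_points :: "('t, 'v, 'e) moment_graph \<Rightarrow> ('v, 'e) pts" where
  "graph_points G = vertices G <+> edges G"

definition graph_top :: "('t, 'v, 'e) moment_graph \<Rightarrow> ('v + 'e) topology" where
  "graph_top G = topology (\<lambda>U. U \<subseteq> graph_points G \<and>
     (\<forall>x\<in>vertices G. \<forall>L\<in>edges G. Inl x \<in> U \<longrightarrow> x \<in> ends G L \<longrightarrow> Inr L \<in> U))"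

lemma openin_graph_top:
  "openin (graph_top G) U \<longleftrightarrow> U \<subseteq> graph_points G \<and>
     (\<forall>x\<in>vertices G. \<forall>L\<in>edges G. Inl x \<in> U \<longrightarrow> x \<in> ends G L \<longrightarrow> Inr L \<in> U)"
proof -
  have "istopology (\<lambda>U. U \<subseteq> graph_points G \<and>
     (\<forall>x\<in>vertices G. \<forall>L\<in>edges G. Inl x \<in> U \<longrightarrow> x \<in> ends G L \<longrightarrow> Inr L \<in> U))"
    unfolding istopology_def by blast
  then show ?thesis by (simp add: graph_top_def)
qed

definition least_nbhd :: "('t, 'v, 'e) moment_graph \<Rightarrow> 'v + 'e \<Rightarrow> ('v, 'e) pts" where
  "least_nbhd G p = \<Inter>{U. openin (graph_top G) U \<and> p \<in> U}"

definition edge_ideal ::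
  "(complex \<Rightarrow> 't::ab_group_add \<Rightarrow> 't) \<Rightarrow> ('t, 'v, 'e) moment_graph \<Rightarrow> 'e \<Rightarrow> ('t \<Rightarrow> complex) set"
  where "edge_ideal scale G L = Idl\<^bsub>polyring scale\<^esub> (direction G L)"

definition edge_ring ::
  "(complex \<Rightarrow> 't::ab_group_add \<Rightarrow> 't) \<Rightarrow> ('t, 'v, 'e) moment_graph \<Rightarrow> 'e \<Rightarrow>
   (('t \<Rightarrow> complex) set) ring"
  where "edge_ring scale G L = polyring scale Quot edge_ideal scale G L"

definition edge_proj ::
  "(complex \<Rightarrow> 't::ab_group_add \<Rightarrow> 't) \<Rightarrow> ('t, 'v, 'e) moment_graph \<Rightarrow> 'e \<Rightarrow>
   ('t \<Rightarrow> complex) \<Rightarrow> ('t \<Rightarrow> complex) set"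
  where "edge_proj scale G L p = edge_ideal scale G L +>\<^bsub>polyring scale\<^esub> p"

definition edge_deg ::
  "(complex \<Rightarrow> 't::ab_group_add \<Rightarrow> 't) \<Rightarrow> ('t, 'v, 'e) moment_graph \<Rightarrow> 'e \<Rightarrow> nat \<Rightarrow>
   (('t \<Rightarrow> complex) set) set"
  where "edge_deg scale G L d = edge_proj scale G L ` polydeg scale d"


section \<open>Sections\<close>

text \<open>
  A tuple indexed by a set \<open>Z\<close> of points is a pair of functions, one on the vertices and one on
  the edges of \<open>Z\<close>, both \<open>undefined\<close> elsewhere.
\<close>

type_synonym ('v, 'e, 'm, 'n) tuple = "('v \<Rightarrow> 'm) \<times> ('e \<Rightarrow> 'n)"

definition sections ::
  "('t, 'v, 'e) moment_graph \<Rightarrow> ('v, 'e) pts \<Rightarrow> ('v \<Rightarrow> 'm set) \<Rightarrow> ('e \<Rightarrow> 'n set) \<Rightarrow>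
   ('v \<Rightarrow> 'e \<Rightarrow> 'm \<Rightarrow> 'n) \<Rightarrow> ('v, 'e, 'm, 'n) tuple set" where
  "sections G Z C D \<rho> =
     {(s, t). s \<in> (\<Pi>\<^sub>E x\<in>Inl -` Z. C x) \<and> t \<in> (\<Pi>\<^sub>E L\<in>Inr -` Z. D L) \<and>
        (\<forall>x L. Inl x \<in> Z \<longrightarrow> Inr L \<in> Z \<longrightarrow> x \<in> ends G L \<longrightarrow> \<rho> x L (s x) = t L)}"

definition tuple_map2 ::
  "('v, 'e) pts \<Rightarrow> ('v \<Rightarrow> 'a \<Rightarrow> 'm \<Rightarrow> 'm) \<Rightarrow> ('e \<Rightarrow> 'b \<Rightarrow> 'n \<Rightarrow> 'n) \<Rightarrow>
   ('v, 'e, 'a, 'b) tuple \<Rightarrow> ('v, 'e, 'm, 'n) tuple \<Rightarrow> ('v, 'e, 'm, 'n) tuple" where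
  "tuple_map2 Z f g a m =
     (\<lambda>x\<in>Inl -` Z. f x (fst a x) (fst m x), \<lambda>L\<in>Inr -` Z. g L (snd a L) (snd m L))"

definition tuple_restrict ::
  "('v, 'e) pts \<Rightarrow> ('v, 'e, 'm, 'n) tuple \<Rightarrow> ('v, 'e, 'm, 'n) tuple" where
  "tuple_restrict Z m = (restrict (fst m) (Inl -` Z), restrict (snd m) (Inr -` Z))"

type_synonym ('t, 'v, 'e) scalars = "('v, 'e, 't \<Rightarrow> complex, ('t \<Rightarrow> complex) set) tuple"

definition struct_ring ::
  "(complex \<Rightarrow> 't::ab_group_add \<Rightarrow> 't) \<Rightarrow> ('t, 'v, 'e) moment_graph \<Rightarrow> ('v, 'e) pts \<Rightarrow>
   ('t, 'v, 'e) scalars ring" where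
  "struct_ring scale G Z =
     \<lparr>carrier = sections G Z (\<lambda>_. carrier (polyring scale)) (\<lambda>L. carrier (edge_ring scale G L))
                  (\<lambda>_. edge_proj scale G),
      mult = tuple_map2 Z (\<lambda>_. mult (polyring scale)) (\<lambda>L. mult (edge_ring scale G L)),
      one = (\<lambda>x\<in>Inl -` Z. \<one>\<^bsub>polyring scale\<^esub>, \<lambda>L\<in>Inr -` Z. \<one>\<^bsub>edge_ring scale G L\<^esub>),
      zero = (\<lambda>x\<in>Inl -` Z. \<zero>\<^bsub>polyring scale\<^esub>, \<lambda>L\<in>Inr -` Z. \<zero>\<^bsub>edge_ring scale G L\<^esub>),
      add = tuple_map2 Z (\<lambda>_. add (polyring scale)) (\<lambda>L. add (edge_ring scale G L))\<rparr>"

definition struct_deg ::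
  "(complex \<Rightarrow> 't::ab_group_add \<Rightarrow> 't) \<Rightarrow> ('t, 'v, 'e) moment_graph \<Rightarrow> ('v, 'e) pts \<Rightarrow> nat \<Rightarrow>
   ('t, 'v, 'e) scalars set" where
  "struct_deg scale G Z d =
     sections G Z (\<lambda>_. polydeg scale d) (\<lambda>L. edge_deg scale G L d) (\<lambda>_. edge_proj scale G)"


section \<open>Sheaves on a moment graph given by stalks\<close>

record ('t, 'v, 'e, 'm, 'n) gamma_sheaf =
  vmod :: "'v \<Rightarrow> ('t \<Rightarrow> complex, 'm) module"
  vdeg :: "'v \<Rightarrow> int \<Rightarrow> 'm set"
  emod :: "'e \<Rightarrow> (('t \<Rightarrow> complex) set, 'n) module"
  edeg :: "'e \<Rightarrow> int \<Rightarrow> 'n set"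
  rho :: "'v \<Rightarrow> 'e \<Rightarrow> 'm \<Rightarrow> 'n"

definition is_gamma_sheaf ::
  "(complex \<Rightarrow> 't::ab_group_add \<Rightarrow> 't) \<Rightarrow> ('t, 'v, 'e) moment_graph \<Rightarrow>
   ('t, 'v, 'e, 'm, 'n) gamma_sheaf \<Rightarrow> bool" where
  "is_gamma_sheaf scale G M \<longleftrightarrow>
     (\<forall>x\<in>vertices G.
        graded_module (polyring scale) (polydeg scale) (vmod M x) (vdeg M x) \<and>
        finitely_generated (polyring scale) (vmod M x)) \<and>
     (\<forall>L\<in>edges G.
        graded_module (edge_ring scale G L) (edge_deg scale G L) (emod M L) (edeg M L) \<and>
        finitely_generated (edge_ring scale G L) (emod M L)) \<and>
     (\<forall>L\<in>edges G. \<forall>x\<in>ends G L.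
        graded_hom (polyring scale) (edge_proj scale G L)
          (vmod M x) (vdeg M x) (emod M L) (edeg M L) (rho M x L))"

definition gamma_sheaf_iso ::
  "(complex \<Rightarrow> 't::ab_group_add \<Rightarrow> 't) \<Rightarrow> ('t, 'v, 'e) moment_graph \<Rightarrow>
   ('t, 'v, 'e, 'm, 'n) gamma_sheaf \<Rightarrow> ('t, 'v, 'e, 'p, 'q) gamma_sheaf \<Rightarrow> bool" where
  "gamma_sheaf_iso scale G M N \<longleftrightarrow> (\<exists>f g.
     (\<forall>x\<in>vertices G.
        graded_iso (polyring scale) (vmod M x) (vdeg M x) (vmod N x) (vdeg N x) (f x)) \<and>
     (\<forall>L\<in>edges G.
        graded_iso (edge_ring scale G L) (emod M L) (edeg M L) (emod N L) (edeg N L) (g L)) \<and>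
     (\<forall>L\<in>edges G. \<forall>x\<in>ends G L. \<forall>m\<in>carrier (vmod M x).
        g L (rho M x L m) = rho N x L (f x m)))"


section \<open>Sheaves of modules over the structure sheaf\<close>

record ('t, 'v, 'e, 's) module_sheaf =
  sec :: "('v, 'e) pts \<Rightarrow> (('t, 'v, 'e) scalars, 's) module"
  sdeg :: "('v, 'e) pts \<Rightarrow> int \<Rightarrow> 's set"
  res :: "('v, 'e) pts \<Rightarrow> ('v, 'e) pts \<Rightarrow> 's \<Rightarrow> 's"

text \<open>
  \<open>res F U W\<close> is the restriction from \<open>U\<close> to \<open>W\<close>. The parameter \<open>\<B>\<close> is the collection of open sets
  over which the sections are required to be finitely generated. Intended values are the collection
  of all open sets and the collection of least neighbourhoods of points, that is, the requirement
  that the stalks are finitely generated.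
\<close>

definition is_module_sheaf ::
  "(complex \<Rightarrow> 't::ab_group_add \<Rightarrow> 't) \<Rightarrow> ('t, 'v, 'e) moment_graph \<Rightarrow> ('v, 'e) pts set \<Rightarrow>
   ('t, 'v, 'e, 's) module_sheaf \<Rightarrow> bool" where
  "is_module_sheaf scale G \<B> F \<longleftrightarrow>
     (\<forall>U. openin (graph_top G) U \<longrightarrow>
        graded_module (struct_ring scale G U) (struct_deg scale G U) (sec F U) (sdeg F U)) \<and>
     (\<forall>U\<in>\<B>. finitely_generated (struct_ring scale G U) (sec F U)) \<and>
     (\<forall>U W. openin (graph_top G) U \<longrightarrow> openin (graph_top G) W \<longrightarrow> W \<subseteq> U \<longrightarrow>
        graded_hom (struct_ring scale G U) (tuple_restrict W)
          (sec F U) (sdeg F U) (sec F W) (sdeg F W) (res F U W)) \<and>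
     (\<forall>U. openin (graph_top G) U \<longrightarrow> (\<forall>s\<in>carrier (sec F U). res F U U s = s)) \<and>
     (\<forall>U V W. openin (graph_top G) U \<longrightarrow> openin (graph_top G) V \<longrightarrow> openin (graph_top G) W \<longrightarrow>
        W \<subseteq> V \<longrightarrow> V \<subseteq> U \<longrightarrow>
        (\<forall>s\<in>carrier (sec F U). res F V W (res F U V s) = res F U W s)) \<and>
     (\<forall>\<U> s. (\<forall>U\<in>\<U>. openin (graph_top G) U \<and> s U \<in> carrier (sec F U)) \<longrightarrow>
        (\<forall>U\<in>\<U>. \<forall>W\<in>\<U>. res F U (U \<inter> W) (s U) = res F W (U \<inter> W) (s W)) \<longrightarrow>
        (\<exists>!u. u \<in> carrier (sec F (\<Union>\<U>)) \<and> (\<forall>U\<in>\<U>. res F (\<Union>\<U>) U u = s U)))"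

definition module_sheaf_iso ::
  "(complex \<Rightarrow> 't::ab_group_add \<Rightarrow> 't) \<Rightarrow> ('t, 'v, 'e) moment_graph \<Rightarrow>
   ('t, 'v, 'e, 's) module_sheaf \<Rightarrow> ('t, 'v, 'e, 'r) module_sheaf \<Rightarrow> bool" where
  "module_sheaf_iso scale G F H \<longleftrightarrow> (\<exists>h.
     (\<forall>U. openin (graph_top G) U \<longrightarrow>
        graded_iso (struct_ring scale G U) (sec F U) (sdeg F U) (sec H U) (sdeg H U) (h U)) \<and>
     (\<forall>U W. openin (graph_top G) U \<longrightarrow> openin (graph_top G) W \<longrightarrow> W \<subseteq> U \<longrightarrow>
        (\<forall>s\<in>carrier (sec F U). h W (res F U W s) = res H U W (h U s))))"


section \<open>The sheaf of sections\<close>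

text \<open>The fields \<open>mult\<close> and \<open>one\<close> of a module record carry no information.\<close>

definition section_module ::
  "('t, 'v, 'e) moment_graph \<Rightarrow> ('t, 'v, 'e, 'm, 'n) gamma_sheaf \<Rightarrow> ('v, 'e) pts \<Rightarrow>
   (('t, 'v, 'e) scalars, ('v, 'e, 'm, 'n) tuple) module" where
  "section_module G M Z =
     \<lparr>carrier = sections G Z (\<lambda>x. carrier (vmod M x)) (\<lambda>L. carrier (emod M L)) (rho M),
      mult = undefined, one = undefined,
      zero = (\<lambda>x\<in>Inl -` Z. \<zero>\<^bsub>vmod M x\<^esub>, \<lambda>L\<in>Inr -` Z. \<zero>\<^bsub>emod M L\<^esub>),
      add = tuple_map2 Z (\<lambda>x. add (vmod M x)) (\<lambda>L. add (emod M L)),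
      smult = tuple_map2 Z (\<lambda>x. smult (vmod M x)) (\<lambda>L. smult (emod M L))\<rparr>"

definition sheaf_of_sections ::
  "('t, 'v, 'e) moment_graph \<Rightarrow> ('t, 'v, 'e, 'm, 'n) gamma_sheaf \<Rightarrow>
   ('t, 'v, 'e, ('v, 'e, 'm, 'n) tuple) module_sheaf" where
  "sheaf_of_sections G M =
     \<lparr>sec = section_module G M,
      sdeg = (\<lambda>U d. sections G U (\<lambda>x. vdeg M x d) (\<lambda>L. edeg M L d) (rho M)),
      res = (\<lambda>U W. tuple_restrict W)\<rparr>"

end

(*
  A section of M over the star of a vertex x is determined by its value at x, and a section over an
  edge by its value there, so M is recovered from the sections over the least neighbourhoods.
  Conversely a module sheaf F yields the stalks F(U_p) over these neighbourhoods: restriction to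
  them embeds F(U) in the sections over U of the resulting sheaf, and gluing is surjectivity, because
  two distinct least neighbourhoods meet in edge points only. If the vector space is finite
  dimensional, all modules of sections are finitely generated over polynomial functions by
  Hilbert's basis theorem, since they are submodules of finite products of finitely generated modules.
*)
theory Submission
  imports Defs "HOL-Library.Function_Algebras" "HOL-Algebra.Ring_Divisibility"
begin

section \<open>Hilbert's basis theorem\<close>

text \<open>A stalk of a module sheaf is a module over the ring of sections on a star or an edge
  point, whereas a Gamma-sheaf asks for modules over \<open>A\<close> or \<open>A/V_L A\<close>. A
  scalar section over a star is determined by its value at the vertex, so \<open>diag\<close> and
  \<open>edge_tuple\<close> identify these rings, and restriction of scalars along them moves stalks
  to the required rings. The dependence of the finiteness condition on the dimension is genuine. In
  infinite dimension take one edge L between x and y, with \<open>M_x\<close> = A,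
  \<open>M_y\<close> = 0, \<open>M_L\<close> = A/m, where m is the ideal generated by all linear
  functionals. All stalks are finitely generated, but the sections over the whole graph form m, and
  m/m^2 is infinite dimensional. In finite dimension the Noetherian property is proved for A alone.
  Modules of sections are therefore regarded as A-modules through constant sections, and their
  generators are found by evaluating at one point of the finite graph after another.\<close>

inductive_set rspan :: "'a::comm_ring_1 set \<Rightarrow> 'a set \<Rightarrow> 'a set" for R X where
  zero: "0 \<in> rspan R X"
| step: "r \<in> R \<Longrightarrow> x \<in> X \<Longrightarrow> y \<in> rspan R X \<Longrightarrow> r * x + y \<in> rspan R X"

text \<open>Rings are subsets of one commutative ring type here: the algebras of functions that
  arise by adjoining coordinates all lie in the pointwise ring of complex functions, so enlarging a
  subring needs no change of type.\<close>

definition unital_subring :: "'a::comm_ring_1 set \<Rightarrow> bool" where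
  "unital_subring R \<longleftrightarrow> 0 \<in> R \<and> 1 \<in> R \<and>
     (\<forall>x\<in>R. \<forall>y\<in>R. x + y \<in> R \<and> x * y \<in> R) \<and> (\<forall>x\<in>R. - x \<in> R)"

definition ideal_in :: "'a::comm_ring_1 set \<Rightarrow> 'a set \<Rightarrow> bool" where
  "ideal_in R I \<longleftrightarrow> I \<subseteq> R \<and> 0 \<in> I \<and> (\<forall>x\<in>I. \<forall>y\<in>I. x + y \<in> I) \<and> (\<forall>r\<in>R. \<forall>x\<in>I. r * x \<in> I)"

definition noetherian :: "'a::comm_ring_1 set \<Rightarrow> bool" where
  "noetherian R \<longleftrightarrow> (\<forall>I. ideal_in R I \<longrightarrow> (\<exists>X. finite X \<and> X \<subseteq> I \<and> I \<subseteq> rspan R X))"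

lemma rspan_add: "v \<in> rspan R X \<Longrightarrow> w \<in> rspan R X \<Longrightarrow> v + w \<in> rspan R X"
  by (induction rule: rspan.induct) (auto simp: add.assoc intro: rspan.intros)

lemma rspan_minimal:
  assumes "ideal_in R I" "X \<subseteq> I"
  shows "rspan R X \<subseteq> I"
proof
  fix v assume "v \<in> rspan R X"
  then show "v \<in> I"
    using assms by induction (auto simp: ideal_in_def)
qed

lemma ideal_in_diff:
  assumes "unital_subring R" "ideal_in R I" "x \<in> I" "y \<in> I"
  shows "x - y \<in> I"
proof -
  have "- 1 \<in> R" using assms(1) by (simp add: unital_subring_def)
  then have "x + (- 1) * y \<in> I" using assms(2-) unfolding ideal_in_def by blast
  then show ?thesis by simp
qed

text \<open>Values at f of polynomials of degree below n, so only 0 for n = 0. Since f may be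
  algebraic over R, the bound belongs to a chosen expression; an element of the ring has neither a
  degree nor a leading coefficient of its own.\<close>

primrec poly_upto :: "'a::comm_ring_1 set \<Rightarrow> 'a \<Rightarrow> nat \<Rightarrow> 'a set" where
  "poly_upto R f 0 = {0}"
| "poly_upto R f (Suc n) = {p + r * f ^ n | p r. p \<in> poly_upto R f n \<and> r \<in> R}"

definition adjoin :: "'a::comm_ring_1 set \<Rightarrow> 'a \<Rightarrow> 'a set" where
  "adjoin R f = (\<Union>n. poly_upto R f n)"

context
  fixes R :: "'a::comm_ring_1 set" and f :: 'a
  assumes R: "unital_subring R"
begin

lemma poly_upto_zero: "0 \<in> poly_upto R f n"
proof (induction n)
  case (Suc n)
  then have "0 + 0 * f ^ n \<in> poly_upto R f (Suc n)"
    using R unfolding unital_subring_def poly_upto.simps by blast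
  then show ?case by simp
qed simp

lemma poly_upto_Suc: "poly_upto R f n \<subseteq> poly_upto R f (Suc n)"
proof
  fix p assume "p \<in> poly_upto R f n"
  then have "p + 0 * f ^ n \<in> poly_upto R f (Suc n)"
    using R unfolding unital_subring_def poly_upto.simps by blast
  then show "p \<in> poly_upto R f (Suc n)" by simp
qed

lemma poly_upto_mono: "m \<le> n \<Longrightarrow> poly_upto R f m \<subseteq> poly_upto R f n"
  by (rule lift_Suc_mono_le[of "poly_upto R f", OF poly_upto_Suc])

lemma poly_upto_add:
  "p \<in> poly_upto R f n \<Longrightarrow> q \<in> poly_upto R f n \<Longrightarrow> p + q \<in> poly_upto R f n"
proof (induction n arbitrary: p q)
  case (Suc n)
  then obtain p' r q' s where *: "p = p' + r * f ^ n" "q = q' + s * f ^ n"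
    "p' \<in> poly_upto R f n" "q' \<in> poly_upto R f n" "r \<in> R" "s \<in> R" by auto
  have "p + q = (p' + q') + (r + s) * f ^ n" using * by (simp add: algebra_simps)
  moreover have "p' + q' \<in> poly_upto R f n" using Suc.IH * by blast
  moreover have "r + s \<in> R" using * R by (auto simp: unital_subring_def)
  ultimately show ?case by auto
qed simp

lemma poly_upto_smult: "r \<in> R \<Longrightarrow> p \<in> poly_upto R f n \<Longrightarrow> r * p \<in> poly_upto R f n"
proof (induction n arbitrary: p)
  case (Suc n)
  then obtain p' s where *: "p = p' + s * f ^ n" "p' \<in> poly_upto R f n" "s \<in> R" by auto
  have "r * p = r * p' + (r * s) * f ^ n" using * by (simp add: algebra_simps)
  moreover have "r * s \<in> R" using * R Suc.prems by (auto simp: unital_subring_def)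
  moreover have "r * p' \<in> poly_upto R f n" using Suc * by blast
  ultimately show ?case by auto
qed simp

lemma poly_upto_diff:
  assumes "p \<in> poly_upto R f n" "q \<in> poly_upto R f n"
  shows "p - q \<in> poly_upto R f n"
proof -
  have "- 1 \<in> R" using R by (auto simp: unital_subring_def)
  from poly_upto_add[OF assms(1) poly_upto_smult[OF this assms(2)]] show ?thesis by simp
qed

lemma poly_upto_shift: "p \<in> poly_upto R f n \<Longrightarrow> f * p \<in> poly_upto R f (Suc n)"
proof (induction n arbitrary: p)
  case 0
  then show ?case using poly_upto_zero[of 1] by simp
next
  case (Suc n)
  then obtain p' s where *: "p = p' + s * f ^ n" "p' \<in> poly_upto R f n" "s \<in> R" by auto
  have "f * p = f * p' + s * f ^ Suc n" using * by (simp add: algebra_simps)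
  then show ?case using Suc.IH[OF *(2)] *(3) poly_upto.simps(2)[of R f "Suc n"] by blast
qed

lemma poly_upto_shift_power: "p \<in> poly_upto R f n \<Longrightarrow> f ^ k * p \<in> poly_upto R f (n + k)"
proof (induction k)
  case (Suc k)
  then show ?case using poly_upto_shift[of "f ^ k * p" "n + k"] by (simp add: mult.assoc del: poly_upto.simps)
qed simp

lemma poly_upto_coeff: "r \<in> R \<Longrightarrow> r * f ^ n \<in> poly_upto R f (Suc n)"
  unfolding poly_upto.simps using poly_upto_zero[of n] by (metis (mono_tags, lifting) add_0 mem_Collect_eq)

lemma adjoin_base: "R \<subseteq> adjoin R f"
proof
  fix r assume "r \<in> R"
  then show "r \<in> adjoin R f"
    using poly_upto_coeff[of r 0] unfolding adjoin_def by (metis UN_I UNIV_I mult.right_neutral power_0)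
qed

lemma adjoin_gen: "f \<in> adjoin R f"
  using poly_upto_coeff[of 1 1] R unfolding adjoin_def unital_subring_def
  by (metis UN_I UNIV_I mult.left_neutral power_one_right)

lemma adjoin_add: 
  assumes "p \<in> adjoin R f" "q \<in> adjoin R f"
  shows "p + q \<in> adjoin R f"
proof -
  from assms obtain m n where "p \<in> poly_upto R f m" "q \<in> poly_upto R f n" by (auto simp: adjoin_def)
  then have "p \<in> poly_upto R f (max m n)" "q \<in> poly_upto R f (max m n)"
    using poly_upto_mono[of m "max m n"] poly_upto_mono[of n "max m n"] by auto
  from poly_upto_add[OF this] show ?thesis by (auto simp: adjoin_def)
qed

text \<open>Only the left factor is expanded, by induction on its formal degree; the right factor is
  shifted by a power of f and scaled.\<close>

lemma adjoin_mult: 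
  assumes "p \<in> adjoin R f" "q \<in> adjoin R f"
  shows "p * q \<in> adjoin R f"
proof -
  have "p * q \<in> adjoin R f" if "p \<in> poly_upto R f n" for p n
    using that
  proof (induction n arbitrary: p)
    case 0
    then show ?case using poly_upto_zero[of 0] unfolding adjoin_def by (intro UN_I[of 0]) auto
  next
    case (Suc n)
    then obtain p' s where *: "p = p' + s * f ^ n" "p' \<in> poly_upto R f n" "s \<in> R" by auto
    obtain k where "q \<in> poly_upto R f k" using assms by (auto simp: adjoin_def)
    then have "s * (f ^ n * q) \<in> adjoin R f"
      using poly_upto_smult[OF *(3) poly_upto_shift_power] by (auto simp: adjoin_def)
    with Suc.IH[OF *(2)] have "p' * q + s * (f ^ n * q) \<in> adjoin R f" by (rule adjoin_add)
    then show ?case using * by (simp add: algebra_simps)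
  qed
  then show ?thesis using assms by (auto simp: adjoin_def)
qed

lemma unital_subring_adjoin: "unital_subring (adjoin R f)"
  unfolding unital_subring_def
proof (intro conjI ballI)
  show "0 \<in> adjoin R f" "1 \<in> adjoin R f" using adjoin_base R by (auto simp: unital_subring_def)
  fix x y assume "x \<in> adjoin R f" "y \<in> adjoin R f"
  then show "x + y \<in> adjoin R f" "x * y \<in> adjoin R f" by (auto intro: adjoin_add adjoin_mult)
next
  fix x assume "x \<in> adjoin R f"
  moreover have "- 1 \<in> adjoin R f" using adjoin_base R by (auto simp: unital_subring_def)
  ultimately show "- x \<in> adjoin R f" using adjoin_mult by fastforce
qed

text \<open>The leading-coefficient argument. Collecting the top coefficients of all expressions
  \<open>p + r * f ^ n\<close> that lie in I, instead of assigning a leading coefficient to an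
  element, makes it work directly in R[f] with f possibly algebraic over R.\<close>

theorem Hilbert_basis:
  assumes noeth: "noetherian R"
  shows "noetherian (adjoin R f)"
  unfolding noetherian_def
proof (intro allI impI)
  fix I assume I: "ideal_in (adjoin R f) I"
  define J where "J n = {r \<in> R. \<exists>p\<in>poly_upto R f n. p + r * f ^ n \<in> I}" for n
  have I_R: "r * p \<in> I" if "r \<in> R" "p \<in> I" for r p
    using I adjoin_base that by (auto simp: ideal_in_def)
  have idJ: "ideal_in R (J n)" for n
    unfolding ideal_in_def
  proof (intro conjI ballI)
    show "J n \<subseteq> R" by (auto simp: J_def)
    show "0 \<in> J n"
      using R I poly_upto_zero[of n] by (auto simp: J_def unital_subring_def ideal_in_def intro!: bexI[of _ 0])
  next
    fix r s assume "r \<in> J n" "s \<in> J n"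
    then obtain p q where *: "r \<in> R" "s \<in> R" "p \<in> poly_upto R f n" "q \<in> poly_upto R f n"
      "p + r * f ^ n \<in> I" "q + s * f ^ n \<in> I" by (auto simp: J_def)
    then have "(p + r * f ^ n) + (q + s * f ^ n) \<in> I" using I by (auto simp: ideal_in_def)
    then have "(p + q) + (r + s) * f ^ n \<in> I" by (simp add: algebra_simps)
    then show "r + s \<in> J n" using * R poly_upto_add by (auto simp: J_def unital_subring_def)
  next
    fix c r assume "c \<in> R" "r \<in> J n"
    then obtain p where *: "r \<in> R" "p \<in> poly_upto R f n" "p + r * f ^ n \<in> I" by (auto simp: J_def)
    then have "c * (p + r * f ^ n) \<in> I" using I_R \<open>c \<in> R\<close> by blast
    then have "c * p + (c * r) * f ^ n \<in> I" by (simp add: algebra_simps)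
    then show "c * r \<in> J n" using * R \<open>c \<in> R\<close> poly_upto_smult by (auto simp: J_def unital_subring_def)
  qed
  have J_Suc: "J n \<subseteq> J (Suc n)" for n
  proof
    fix r assume "r \<in> J n"
    then obtain p where *: "r \<in> R" "p \<in> poly_upto R f n" "p + r * f ^ n \<in> I" by (auto simp: J_def)
    then have "f * (p + r * f ^ n) \<in> I" using I adjoin_gen by (auto simp: ideal_in_def)
    then have "f * p + r * f ^ Suc n \<in> I" by (simp add: algebra_simps)
    then show "r \<in> J (Suc n)" using * poly_upto_shift by (auto simp: J_def simp del: poly_upto.simps)
  qed
  have J_mono: "m \<le> n \<Longrightarrow> J m \<subseteq> J n" for m n by (rule lift_Suc_mono_le[of J, OF J_Suc])
  \<comment> \<open>Multiplication by f makes the ideals \<open>J n\<close> increase, so their union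
    is again an ideal of R. Its finitely many generators lie in a single \<open>J N\<close>, and the
    chain is constant from there on.\<close>
  have "ideal_in R (\<Union>n. J n)"
    unfolding ideal_in_def
  proof (intro conjI ballI)
    show "(\<Union>n. J n) \<subseteq> R" by (auto simp: J_def)
    show "0 \<in> (\<Union>n. J n)" using idJ[of 0] by (auto simp: ideal_in_def)
    fix x y assume "x \<in> (\<Union>n. J n)" "y \<in> (\<Union>n. J n)"
    then obtain m n where "x \<in> J m" "y \<in> J n" by auto
    then have "x \<in> J (max m n)" "y \<in> J (max m n)"
      using J_mono[of m "max m n"] J_mono[of n "max m n"] by auto
    then show "x + y \<in> (\<Union>n. J n)" using idJ[of "max m n"] by (auto simp: ideal_in_def)
  next
    fix r x assume "r \<in> R" "x \<in> (\<Union>n. J n)"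
    then show "r * x \<in> (\<Union>n. J n)" using idJ unfolding ideal_in_def by blast
  qed
  then obtain X where X: "finite X" "X \<subseteq> (\<Union>n. J n)" "(\<Union>n. J n) \<subseteq> rspan R X"
    using noeth by (auto simp: noetherian_def)
  have "\<exists>N. X \<subseteq> J N"
    using X(1,2)
  proof (induction X)
    case (insert x X)
    then obtain N k where "X \<subseteq> J N" "x \<in> J k" by auto
    then have "insert x X \<subseteq> J (max N k)"
      using J_mono[of N "max N k"] J_mono[of k "max N k"] by auto
    then show ?case by blast
  qed simp
  then obtain N where N: "X \<subseteq> J N" by blast
  have stab: "J n \<subseteq> J N" for n
    using X(3) rspan_minimal[OF idJ N] by blast
  have "\<exists>Y. finite Y \<and> Y \<subseteq> J n \<and> J n \<subseteq> rspan R Y" for n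
    using noeth idJ by (auto simp: noetherian_def)
  then obtain Y where Y: "finite (Y n)" "Y n \<subseteq> J n" "J n \<subseteq> rspan R (Y n)" for n by metis
  have "\<exists>g. g \<in> I \<and> (\<exists>p\<in>poly_upto R f n. g = p + y * f ^ n)" if "y \<in> Y n" for n y
    using subsetD[OF Y(2) that] by (auto simp: J_def)
  note lift = this
  \<comment> \<open>For a generator y of \<open>J n\<close>, an element of the ideal with an
    expression of formal degree n and top coefficient y.\<close>
  define g where "g n y = (SOME g. g \<in> I \<and> (\<exists>p\<in>poly_upto R f n. g = p + y * f ^ n))" for n y
  have g: "g n y \<in> I" "\<exists>p\<in>poly_upto R f n. g n y = p + y * f ^ n" if "y \<in> Y n" for n y
    using someI_ex[OF lift[OF that]] unfolding g_def by blast+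
  define Z where "Z = (\<Union>n\<le>N. g n ` Y n)"
  have Z: "finite Z" "Z \<subseteq> I" using Y g by (auto simp: Z_def)
  \<comment> \<open>A generator of formal degree m is raised to formal degree n by the factor
    \<open>f ^ (n - m)\<close>. Hence the generators of levels up to N realise the coefficients at
    every higher level as well.\<close>
  have lead: "\<exists>h\<in>rspan (adjoin R f) Z. \<exists>p\<in>poly_upto R f n. h = p + r * f ^ n"
    if "r \<in> rspan R (Y m)" "m \<le> n" "m \<le> N" for r m n
    using that(1)
  proof induction
    case zero
    show ?case by (intro bexI[OF _ rspan.zero] bexI[OF _ poly_upto_zero]) simp
  next
    case (step c y r)
    from step.IH obtain h p where hp: "h \<in> rspan (adjoin R f) Z" "p \<in> poly_upto R f n" "h = p + r * f ^ n"
      by auto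
    from g[OF step.hyps(2)] obtain q where q: "q \<in> poly_upto R f m" "g m y = q + y * f ^ m" by auto
    have "c * f ^ (n - m) \<in> poly_upto R f (Suc (n - m))" by (rule poly_upto_coeff[OF step.hyps(1)])
    then have "(c * f ^ (n - m)) * g m y + h \<in> rspan (adjoin R f) Z"
      using step.hyps(2) that(3) hp(1) by (intro rspan.step) (auto simp: adjoin_def Z_def simp del: poly_upto.simps)
    moreover have "c * (f ^ (n - m) * q) + p \<in> poly_upto R f n"
      using poly_upto_add[OF poly_upto_smult[OF step.hyps(1) poly_upto_shift_power[OF q(1), of "n - m"]], of p]
        that(2) hp(2) by simp
    moreover have "f ^ n = f ^ (n - m) * f ^ m" using that(2) by (simp flip: power_add)
    then have "(c * f ^ (n - m)) * g m y + h = (c * (f ^ (n - m) * q) + p) + (c * y + r) * f ^ n"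
      using q(2) hp(3) by (simp add: algebra_simps)
    ultimately show ?case by blast
  qed
  \<comment> \<open>Induction on formal degree: a combination k of the generators with the same top
    coefficient as h is subtracted, and \<open>h - k\<close> has a shorter expression.\<close>
  have "h \<in> rspan (adjoin R f) Z" if "h \<in> I" "h \<in> poly_upto R f n" for h n
    using that
  proof (induction n arbitrary: h)
    case 0
    then show ?case by (simp add: rspan.zero)
  next
    case (Suc n)
    then obtain p r where h: "h = p + r * f ^ n" "p \<in> poly_upto R f n" "r \<in> R" by auto
    with Suc have "r \<in> J n" by (auto simp: J_def)
    \<comment> \<open>Beyond N the coefficient already belongs to \<open>J N\<close>; below N the
      generators of level n itself must be used, as those of level N have too high a degree.\<close>
    then have "r \<in> J (min n N)" using stab[of n] by (auto simp: min_def)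
    then have "r \<in> rspan R (Y (min n N))" using Y by blast
    from lead[OF this, of n] obtain k q where k: "k \<in> rspan (adjoin R f) Z" "q \<in> poly_upto R f n" "k = q + r * f ^ n"
      by auto
    have "k \<in> I" using rspan_minimal[OF I Z(2)] k(1) by blast
    then have "h - k \<in> I" using ideal_in_diff[OF unital_subring_adjoin I] Suc by blast
    moreover have "h - k = p - q" using h k by simp
    ultimately have "h - k \<in> rspan (adjoin R f) Z"
      using Suc.IH poly_upto_diff h k by metis
    from rspan_add[OF this k(1)] show ?case by simp
  qed
  then have "I \<subseteq> rspan (adjoin R f) Z" using I by (auto simp: ideal_in_def adjoin_def)
  with Z show "\<exists>X. finite X \<and> X \<subseteq> I \<and> I \<subseteq> rspan (adjoin R f) X" by blast
qed

end

section \<open>Polynomial functions on a finite-dimensional space\<close>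

lemma noetherian_field:
  assumes "1 \<in> R" and inv: "\<And>x. x \<in> R \<Longrightarrow> x \<noteq> 0 \<Longrightarrow> \<exists>y\<in>R. y * x = 1"
  shows "noetherian R"
  unfolding noetherian_def
proof (intro allI impI)
  fix I assume I: "ideal_in R I"
  show "\<exists>X. finite X \<and> X \<subseteq> I \<and> I \<subseteq> rspan R X"
  proof (cases "I \<subseteq> {0}")
    case True
    then show ?thesis by (intro exI[of _ "{}"]) (auto intro: rspan.zero)
  next
    case False
    then obtain x where x: "x \<in> I" "x \<noteq> 0" by blast
    have "x \<in> R" using x(1) I by (auto simp: ideal_in_def)
    from inv[OF this x(2)] obtain y where y: "y \<in> R" "y * x = 1" by blast
    have "y * x \<in> I" using I x(1) y(1) unfolding ideal_in_def by blast
    then have "1 \<in> I" using y(2) by simp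
    moreover have "I \<subseteq> rspan R {1}"
    proof
      fix z assume "z \<in> I"
      then have "z \<in> R" using I by (auto simp: ideal_in_def)
      from rspan.step[OF this _ rspan.zero, of 1 "{1}"] show "z \<in> rspan R {1}" by simp
    qed
    ultimately show ?thesis by (intro exI[of _ "{1}"]) auto
  qed
qed

lemma sum_apply: "(\<Sum>i\<in>S. p i :: 'a \<Rightarrow> 'b::comm_monoid_add) v = (\<Sum>i\<in>S. p i v)"
  by (induction S rule: infinite_finite_induct) auto

text \<open>The coordinates of a basis are adjoined one at a time to the field of constants. Every
  linear functional is a combination of coordinates, so the resulting ring contains all generators
  of the algebra of polynomial functions.\<close>

lemma noetherian_polyfun:
  assumes "finite_dimensional_vector_space scale B"
  shows "noetherian (polyfun scale)"
proof -
  interpret finite_dimensional_vector_space scale B by fact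
  define coord where "coord b = (\<lambda>v. representation B v b)" for b
  have coord: "coord b \<in> dual scale" for b
    using linear_representation[OF independent_Basis span_Basis] by (simp add: coord_def dual_def)
  \<comment> \<open>The inclusion in \<open>polyfun scale\<close> is carried along so that the last
    ring S is equal to \<open>polyfun scale\<close>; the Noetherian property would not pass to a
    mere subring.\<close>
  have "\<exists>S. unital_subring S \<and> noetherian S \<and> S \<subseteq> polyfun scale \<and> (\<forall>c. (\<lambda>_. c) \<in> S) \<and> coord ` B' \<subseteq> S"
    if "finite B'" for B'
    using that
  proof induction
    case empty
    let ?S = "range (\<lambda>c _. c) :: ('b \<Rightarrow> complex) set"
    have "noetherian ?S"
    proof (rule noetherian_field)
      show "1 \<in> ?S" by (auto simp: one_fun_def)
      fix x assume "x \<in> ?S" "x \<noteq> 0"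
      then obtain c where "x = (\<lambda>_. c)" "c \<noteq> 0" by (auto simp: zero_fun_def)
      then show "\<exists>y\<in>?S. y * x = 1" by (auto simp: times_fun_def one_fun_def intro!: exI[of _ "inverse c"])
    qed
    moreover have "unital_subring ?S"
      by (auto simp: unital_subring_def zero_fun_def one_fun_def plus_fun_def times_fun_def fun_Compl_def)
    ultimately show ?case by (intro exI[of _ ?S]) (auto intro: polyfun.const)
  next
    case (insert b B')
    then obtain S where S: "unital_subring S" "noetherian S" "S \<subseteq> polyfun scale" "\<And>c. (\<lambda>_. c) \<in> S"
      "coord ` B' \<subseteq> S" by blast
    have pow: "coord b ^ n \<in> polyfun scale" for n
    proof (induction n)
      case (Suc n)
      then show ?case using polyfun.mult[OF polyfun.linear[OF coord[of b]] Suc] by (simp add: times_fun_def)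
    qed (simp add: one_fun_def polyfun.const)
    have "p \<in> polyfun scale" if "p \<in> poly_upto S (coord b) n" for p n
      using that
    proof (induction n arbitrary: p)
      case 0
      then show ?case by (simp add: zero_fun_def polyfun.const)
    next
      case (Suc n)
      then obtain q r where *: "p = q + r * coord b ^ n" "q \<in> polyfun scale" "r \<in> polyfun scale"
        using S(3) by auto
      then show ?case using polyfun.add[OF *(2) polyfun.mult[OF *(3) pow]]
        by (simp add: plus_fun_def times_fun_def)
    qed
    then have "adjoin S (coord b) \<subseteq> polyfun scale" by (auto simp: adjoin_def)
    then show ?case
      using S unital_subring_adjoin[OF S(1)] Hilbert_basis[OF S(1,2)] adjoin_base[OF S(1)] adjoin_gen[OF S(1)]
      by (intro exI[of _ "adjoin S (coord b)"]) blast
  qed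
  from this[OF finite_Basis] obtain S where S: "unital_subring S" "noetherian S" "S \<subseteq> polyfun scale"
    "\<And>c. (\<lambda>_. c) \<in> S" "coord ` B \<subseteq> S" by blast
  have "p \<in> S" if "p \<in> polyfun scale" for p
    using that
  proof induction
    case (linear f)
    then interpret f: Vector_Spaces.linear scale "(*)" f by (simp add: dual_def)
    have f_eq: "f v = (\<Sum>b\<in>B. f b * coord b v)" for v
    proof -
      have "v = (\<Sum>b\<in>B. scale (representation B v b) b)"
        by (simp add: sum_representation_eq independent_Basis span_Basis finite_Basis)
      then have "f v = f (\<Sum>b\<in>B. scale (representation B v b) b)" by (rule arg_cong)
      also have "\<dots> = (\<Sum>b\<in>B. f b * coord b v)"
        by (simp add: f.sum f.scale coord_def mult.commute)
      finally show ?thesis .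
    qed
    have "f = (\<Sum>b\<in>B. (\<lambda>_. f b) * coord b)"
      by (rule ext, subst f_eq) (simp add: sum_apply)
    moreover have "(\<Sum>b\<in>B'. (\<lambda>_. f b) * coord b) \<in> S" if "B' \<subseteq> B" for B'
      using finite_subset[OF that finite_Basis] that
    proof induction
      case (insert b F)
      then have "(\<lambda>_. f b) * coord b \<in> S" "(\<Sum>b\<in>F. (\<lambda>_. f b) * coord b) \<in> S"
        using S(1,4,5) unfolding unital_subring_def by blast+
      then have "(\<lambda>_. f b) * coord b + (\<Sum>b\<in>F. (\<lambda>_. f b) * coord b) \<in> S"
        using S(1) unfolding unital_subring_def by blast
      then show ?case by (simp only: sum.insert[OF insert.hyps])
    qed (use S(1) in \<open>simp add: unital_subring_def\<close>)
    ultimately show ?case by (metis order_refl)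
  next
    case (add p q)
    then have "p + q \<in> S" using S(1) unfolding unital_subring_def by blast
    then show ?case by (simp add: plus_fun_def)
  next
    case (mult p q)
    then have "p * q \<in> S" using S(1) unfolding unital_subring_def by blast
    then show ?case by (simp add: times_fun_def)
  qed (rule S(4))
  with S(3) have "polyfun scale = S" by blast
  with S(2) show ?thesis by simp
qed

section \<open>Spans and finitely generated modules\<close>

text \<open>Adding one multiple at a time, with repetition of generators allowed, gives an induction
  rule that avoids manipulating coefficient families; \<open>lspan_eq_finsum\<close> recovers the
  description by finite sums.\<close>

inductive_set lspan :: "('a, 'z) ring_scheme \<Rightarrow> ('a, 'b, 'y) module_scheme \<Rightarrow> 'b set \<Rightarrow> 'b set" for R M X where
  zero: "\<zero>\<^bsub>M\<^esub> \<in> lspan R M X"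
| step: "a \<in> carrier R \<Longrightarrow> x \<in> X \<Longrightarrow> y \<in> lspan R M X \<Longrightarrow> (a \<odot>\<^bsub>M\<^esub> x) \<oplus>\<^bsub>M\<^esub> y \<in> lspan R M X"

text \<open>Finite generation for a subset of an ambient module, so that submodules such as kernels
  and images need no module record of their own.\<close>

definition fg_set :: "('a, 'z) ring_scheme \<Rightarrow> ('a, 'b, 'y) module_scheme \<Rightarrow> 'b set \<Rightarrow> bool" where
  "fg_set R M W \<longleftrightarrow> (\<exists>X. finite X \<and> X \<subseteq> W \<and> W \<subseteq> lspan R M X)"

lemma lspan_mono: "X \<subseteq> Y \<Longrightarrow> lspan R M X \<subseteq> lspan R M Y"
proof
  fix v assume "X \<subseteq> Y" "v \<in> lspan R M X"
  from this(2,1) show "v \<in> lspan R M Y"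
    by induction (auto intro: lspan.intros)
qed

lemma (in Module.module) submoduleI':
  assumes "H \<subseteq> carrier M" "\<zero>\<^bsub>M\<^esub> \<in> H"
    and "\<And>x y. x \<in> H \<Longrightarrow> y \<in> H \<Longrightarrow> x \<oplus>\<^bsub>M\<^esub> y \<in> H"
    and "\<And>a x. a \<in> carrier R \<Longrightarrow> x \<in> H \<Longrightarrow> a \<odot>\<^bsub>M\<^esub> x \<in> H"
  shows "submodule H R M"
proof (rule submoduleI)
  fix x assume x: "x \<in> H"
  have "(\<ominus> \<one>) \<odot>\<^bsub>M\<^esub> x = \<ominus>\<^bsub>M\<^esub> x"
    using x assms(1) smult_l_minus[of \<one> x] by auto
  then show "\<ominus>\<^bsub>M\<^esub> x \<in> H" using assms(4)[of "\<ominus> \<one>" x] x by simp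
qed (use assms in auto)

context Module.module
begin

lemma lspan_carrier: "X \<subseteq> carrier M \<Longrightarrow> lspan R M X \<subseteq> carrier M"
proof
  fix v assume "X \<subseteq> carrier M" "v \<in> lspan R M X"
  from this(2,1) show "v \<in> carrier M" by induction auto
qed

lemma lspan_add:
  assumes "X \<subseteq> carrier M" "v \<in> lspan R M X" "w \<in> lspan R M X"
  shows "v \<oplus>\<^bsub>M\<^esub> w \<in> lspan R M X"
  using assms(2)
proof induction
  case zero
  then show ?case using assms lspan_carrier[OF assms(1)] by auto
next
  case (step a x y)
  then have "(a \<odot>\<^bsub>M\<^esub> x \<oplus>\<^bsub>M\<^esub> y) \<oplus>\<^bsub>M\<^esub> w = a \<odot>\<^bsub>M\<^esub> x \<oplus>\<^bsub>M\<^esub> (y \<oplus>\<^bsub>M\<^esub> w)"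
    using lspan_carrier[OF assms(1)] assms by (intro M.a_assoc) auto
  then show ?case using step lspan.step by metis
qed

lemma lspan_smult:
  assumes "X \<subseteq> carrier M" "a \<in> carrier R" "v \<in> lspan R M X"
  shows "a \<odot>\<^bsub>M\<^esub> v \<in> lspan R M X"
  using assms(3)
proof induction
  case zero
  then show ?case using assms lspan.zero by simp
next
  case (step b x y)
  then have "a \<odot>\<^bsub>M\<^esub> (b \<odot>\<^bsub>M\<^esub> x \<oplus>\<^bsub>M\<^esub> y) = (a \<otimes> b) \<odot>\<^bsub>M\<^esub> x \<oplus>\<^bsub>M\<^esub> (a \<odot>\<^bsub>M\<^esub> y)"
    using lspan_carrier[OF assms(1)] assms by (subst smult_r_distr) (auto simp: smult_assoc1)
  then show ?case using step assms(2) lspan.step[of "a \<otimes> b" R x X "a \<odot>\<^bsub>M\<^esub> y" M] by simp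
qed

lemma lspan_base:
  assumes "X \<subseteq> carrier M" "x \<in> X"
  shows "x \<in> lspan R M X"
proof -
  have "\<one> \<odot>\<^bsub>M\<^esub> x \<oplus>\<^bsub>M\<^esub> \<zero>\<^bsub>M\<^esub> \<in> lspan R M X"
    using assms by (intro lspan.step lspan.zero) auto
  moreover have "x \<in> carrier M" using assms by auto
  ultimately show ?thesis by simp
qed

lemma submodule_lspan: "X \<subseteq> carrier M \<Longrightarrow> submodule (lspan R M X) R M"
  by (rule submoduleI') (auto simp: lspan_add lspan_smult lspan.zero dest: subsetD[OF lspan_carrier])

lemma submodule_zero_closed: "submodule H R M \<Longrightarrow> \<zero>\<^bsub>M\<^esub> \<in> H"
  using subgroup.one_closed[OF submodule.axioms(1)] by fastforce

lemma lspan_minimal: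
  assumes H: "submodule H R M" and X: "X \<subseteq> H"
  shows "lspan R M X \<subseteq> H"
proof
  fix v assume "v \<in> lspan R M X"
  then show "v \<in> H"
  proof induction
    case zero
    show ?case by (rule submodule_zero_closed[OF H])
  next
    case (step a x y)
    then show ?case using submoduleE(4,5)[OF H] X by blast
  qed
qed

lemma lspan_eq_finsum:
  assumes "finite X" "X \<subseteq> carrier M"
  shows "m \<in> lspan R M X \<longleftrightarrow> (\<exists>c. c \<in> X \<rightarrow> carrier R \<and> m = (\<Oplus>\<^bsub>M\<^esub> x\<in>X. c x \<odot>\<^bsub>M\<^esub> x))"
proof
  assume "m \<in> lspan R M X"
  then show "\<exists>c. c \<in> X \<rightarrow> carrier R \<and> m = (\<Oplus>\<^bsub>M\<^esub> x\<in>X. c x \<odot>\<^bsub>M\<^esub> x)"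
  proof induction
    case zero
    have "(\<Oplus>\<^bsub>M\<^esub> x\<in>X. \<zero> \<odot>\<^bsub>M\<^esub> x) = (\<Oplus>\<^bsub>M\<^esub> x\<in>X. \<zero>\<^bsub>M\<^esub>)"
      using assms(2) by (intro M.finsum_cong') auto
    then show ?case by (intro exI[of _ "\<lambda>_. \<zero>"]) simp
  next
    case (step a x y)
    then obtain c where c: "c \<in> X \<rightarrow> carrier R" "y = (\<Oplus>\<^bsub>M\<^esub> x\<in>X. c x \<odot>\<^bsub>M\<^esub> x)" by auto
    \<comment> \<open>The generator x may already occur in y, so only its coefficient is raised by
      a.\<close>
    define c' where "c' = c(x := a \<oplus> c x)"
    have X: "X = insert x (X - {x})" "finite (X - {x})" "x \<notin> X - {x}" using step assms by auto
    have xM: "x \<in> carrier M" and cx: "c x \<in> carrier R" using step assms c by auto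
    have rest: "(\<lambda>x. c x \<odot>\<^bsub>M\<^esub> x) \<in> X - {x} \<rightarrow> carrier M" using c assms by auto
    have "y = c x \<odot>\<^bsub>M\<^esub> x \<oplus>\<^bsub>M\<^esub> (\<Oplus>\<^bsub>M\<^esub> x\<in>X-{x}. c x \<odot>\<^bsub>M\<^esub> x)"
      unfolding c(2) using M.finsum_insert[OF X(2,3) rest] xM cx X(1) by simp
    moreover have "(\<Oplus>\<^bsub>M\<^esub> x\<in>X. c' x \<odot>\<^bsub>M\<^esub> x) = c' x \<odot>\<^bsub>M\<^esub> x \<oplus>\<^bsub>M\<^esub> (\<Oplus>\<^bsub>M\<^esub> x\<in>X-{x}. c' x \<odot>\<^bsub>M\<^esub> x)"
      using M.finsum_insert[OF X(2,3), of "\<lambda>x. c' x \<odot>\<^bsub>M\<^esub> x"] xM cx X(1) rest step.hyps(1)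
      by (auto simp: c'_def Pi_iff)
    moreover have "(\<Oplus>\<^bsub>M\<^esub> x\<in>X-{x}. c' x \<odot>\<^bsub>M\<^esub> x) = (\<Oplus>\<^bsub>M\<^esub> x\<in>X-{x}. c x \<odot>\<^bsub>M\<^esub> x)"
      using rest by (intro M.finsum_cong') (auto simp: c'_def)
    ultimately have "(\<Oplus>\<^bsub>M\<^esub> x\<in>X. c' x \<odot>\<^bsub>M\<^esub> x) = a \<odot>\<^bsub>M\<^esub> x \<oplus>\<^bsub>M\<^esub> y"
      using xM cx step.hyps(1) M.finsum_closed[OF rest]
      by (simp add: c'_def smult_l_distr M.a_assoc)
    moreover have "c' \<in> X \<rightarrow> carrier R" using c cx step.hyps(1) by (auto simp: c'_def)
    ultimately show ?case by metis
  qed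
next
  assume "\<exists>c. c \<in> X \<rightarrow> carrier R \<and> m = (\<Oplus>\<^bsub>M\<^esub> x\<in>X. c x \<odot>\<^bsub>M\<^esub> x)"
  then obtain c where c: "c \<in> X \<rightarrow> carrier R" "m = (\<Oplus>\<^bsub>M\<^esub> x\<in>X. c x \<odot>\<^bsub>M\<^esub> x)" by auto
  have "(\<Oplus>\<^bsub>M\<^esub> x\<in>Y. c x \<odot>\<^bsub>M\<^esub> x) \<in> lspan R M X" if "Y \<subseteq> X" for Y
    using finite_subset[OF that assms(1)] that
  proof induction
    case empty
    then show ?case by (simp add: lspan.zero)
  next
    case (insert x Y)
    then have "(\<Oplus>\<^bsub>M\<^esub> x\<in>insert x Y. c x \<odot>\<^bsub>M\<^esub> x) = c x \<odot>\<^bsub>M\<^esub> x \<oplus>\<^bsub>M\<^esub> (\<Oplus>\<^bsub>M\<^esub> x\<in>Y. c x \<odot>\<^bsub>M\<^esub> x)"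
      using c(1) assms(2) by (intro M.finsum_insert) (auto simp: Pi_iff subset_iff)
    then show ?case using insert c(1) by (auto intro: lspan.step)
  qed
  then show "m \<in> lspan R M X" using c(2) by blast
qed

end

lemma finitely_generated_iff:
  assumes "Module.module R M"
  shows "finitely_generated R M \<longleftrightarrow> fg_set R M (carrier M)"
proof -
  interpret Module.module R M by fact
  have "(\<forall>m\<in>carrier M. \<exists>c. c \<in> X \<rightarrow> carrier R \<and> m = (\<Oplus>\<^bsub>M\<^esub> x\<in>X. c x \<odot>\<^bsub>M\<^esub> x)) \<longleftrightarrow>
        carrier M \<subseteq> lspan R M X" if "finite X" "X \<subseteq> carrier M" for X
    unfolding subset_eq[of "carrier M"] lspan_eq_finsum[OF that] by blast
  then show ?thesis
    unfolding finitely_generated_def fg_set_def by (intro ex_cong1 conj_cong refl)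
qed

section \<open>Submodules of finitely generated modules over a Noetherian ring\<close>

lemma (in cring) idealI':
  assumes "I \<subseteq> carrier R" "\<zero> \<in> I"
    and "\<And>x y. x \<in> I \<Longrightarrow> y \<in> I \<Longrightarrow> x \<oplus> y \<in> I"
    and smult: "\<And>a x. a \<in> carrier R \<Longrightarrow> x \<in> I \<Longrightarrow> a \<otimes> x \<in> I"
  shows "ideal I R"
proof (rule idealI)
  show "ring R" by (rule ring_axioms)
  show "subgroup I (add_monoid R)"
  proof
    fix x assume x: "x \<in> I"
    have "(\<ominus> \<one>) \<otimes> x = \<ominus> x" using x assms(1) l_minus[of \<one> x] by auto
    then have "\<ominus> x \<in> I" using smult[of "\<ominus> \<one>" x] x by simp
    then show "inv\<^bsub>add_monoid R\<^esub> x \<in> I" by (simp add: a_inv_def)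
  qed (use assms in auto)
  fix a x assume ax: "a \<in> I" "x \<in> carrier R"
  then show "x \<otimes> a \<in> I" by (intro smult)
  then show "a \<otimes> x \<in> I" using ax assms(1) m_comm[of a x] by auto
qed

context Module.module
begin

lemma lspan_insert:
  assumes "X \<subseteq> carrier M" "x \<in> carrier M" "v \<in> lspan R M (insert x X)"
  shows "\<exists>r\<in>carrier R. \<exists>y\<in>lspan R M X. v = r \<odot>\<^bsub>M\<^esub> x \<oplus>\<^bsub>M\<^esub> y"
  using assms(3)
proof induction
  case zero
  have "\<zero>\<^bsub>M\<^esub> = \<zero> \<odot>\<^bsub>M\<^esub> x \<oplus>\<^bsub>M\<^esub> \<zero>\<^bsub>M\<^esub>" using assms(2) by simp
  then show ?case using lspan.zero[of M R X] by blast
next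
  case (step a z v)
  then obtain r y where *: "r \<in> carrier R" "y \<in> lspan R M X" "v = r \<odot>\<^bsub>M\<^esub> x \<oplus>\<^bsub>M\<^esub> y" by blast
  have yM: "y \<in> carrier M" using * lspan_carrier[OF assms(1)] by blast
  show ?case
  proof (cases "z = x")
    case True
    have "a \<odot>\<^bsub>M\<^esub> z \<oplus>\<^bsub>M\<^esub> v = (a \<oplus> r) \<odot>\<^bsub>M\<^esub> x \<oplus>\<^bsub>M\<^esub> y"
      using True * yM assms(2) step.hyps(1) by (simp add: smult_l_distr M.a_assoc)
    then show ?thesis using * step.hyps(1) by blast
  next
    case False
    then have "z \<in> X" using step by blast
    have "a \<odot>\<^bsub>M\<^esub> z \<oplus>\<^bsub>M\<^esub> v = r \<odot>\<^bsub>M\<^esub> x \<oplus>\<^bsub>M\<^esub> (a \<odot>\<^bsub>M\<^esub> z \<oplus>\<^bsub>M\<^esub> y)"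
      using * yM assms(1,2) step.hyps(1) \<open>z \<in> X\<close> by (auto intro!: M.a_lcomm)
    moreover have "a \<odot>\<^bsub>M\<^esub> z \<oplus>\<^bsub>M\<^esub> y \<in> lspan R M X"
      using * step.hyps(1) \<open>z \<in> X\<close> by (intro lspan.step)
    ultimately show ?thesis using *(1) by blast
  qed
qed

lemma submodule_minus_closed:
  assumes H: "submodule H R M" and "x \<in> H" "y \<in> H"
  shows "x \<ominus>\<^bsub>M\<^esub> y \<in> H"
  using submoduleE(3,5)[OF H] assms(2,3) unfolding a_minus_def by blast

lemma submodule_Int:
  assumes "submodule H R M" "submodule K R M"
  shows "submodule (H \<inter> K) R M"
  using submoduleE(1,4,5)[OF assms(1)] submoduleE(1,4,5)[OF assms(2)]
    submodule_zero_closed[OF assms(1)] submodule_zero_closed[OF assms(2)]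
  by (intro submoduleI') auto

text \<open>Generators modulo K together with generators of K. This closes both the induction in
  \<open>fg_submodule\<close> and the kernel-image argument in
  \<open>fg_set_kernel_image\<close>.\<close>

lemma fg_set_extend:
  assumes W: "W \<subseteq> carrier M" and Y: "finite Y" "Y \<subseteq> W"
    and K: "K \<subseteq> W" "fg_set R M K"
    and dec: "\<And>w. w \<in> W \<Longrightarrow> \<exists>g\<in>lspan R M Y. \<exists>k\<in>K. w = g \<oplus>\<^bsub>M\<^esub> k"
  shows "fg_set R M W"
proof -
  obtain Z where Z: "finite Z" "Z \<subseteq> K" "K \<subseteq> lspan R M Z" using K by (auto simp: fg_set_def)
  have "W \<subseteq> lspan R M (Y \<union> Z)"
  proof
    fix w assume "w \<in> W"
    from dec[OF this] obtain g k where gk: "g \<in> lspan R M Y" "k \<in> K" "w = g \<oplus>\<^bsub>M\<^esub> k" by blast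
    have "g \<in> lspan R M (Y \<union> Z)" "k \<in> lspan R M (Y \<union> Z)"
      using gk Z lspan_mono[of Y "Y \<union> Z"] lspan_mono[of Z "Y \<union> Z"] by blast+
    then show "w \<in> lspan R M (Y \<union> Z)"
      unfolding gk(3) using W Y Z K by (intro lspan_add) auto
  qed
  then show ?thesis unfolding fg_set_def using Y Z K by (intro exI[of _ "Y \<union> Z"]) auto
qed

text \<open>Induction on the number of ambient generators. The coefficients at the new generator x
  form a finitely generated ideal; lifting its generators to W leaves only the part of W inside the
  span of the remaining generators, where the induction hypothesis applies.\<close>

lemma fg_submodule:
  assumes "noetherian_ring R" "finite X" "X \<subseteq> carrier M"
    and "submodule W R M" "W \<subseteq> lspan R M X"
  shows "fg_set R M W"
  using assms(2-)
proof (induction X arbitrary: W)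
  case empty
  have "lspan R M {} \<subseteq> {\<zero>\<^bsub>M\<^esub>}"
  proof
    fix v assume "v \<in> lspan R M {}"
    then show "v \<in> {\<zero>\<^bsub>M\<^esub>}" by induction auto
  qed
  then have "W \<subseteq> lspan R M {}" using empty by auto
  then show ?case unfolding fg_set_def by blast
next
  case (insert x X)
  note W = \<open>submodule W R M\<close>
  have X: "X \<subseteq> carrier M" and x: "x \<in> carrier M" using insert by auto
  note WM = submoduleE(1)[OF W]
  let ?L = "lspan R M X"
  have LM: "?L \<subseteq> carrier M" by (rule lspan_carrier[OF X])
  note L = submodule_lspan[OF X]
  \<comment> \<open>The generators may be linearly dependent, so an element can have several
    x-coefficients; all of them are collected.\<close>
  define coef where "coef V = {r \<in> carrier R. \<exists>v\<in>V. \<exists>y\<in>?L. v = r \<odot>\<^bsub>M\<^esub> x \<oplus>\<^bsub>M\<^esub> y}" for V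
  have coef_ideal: "ideal (coef V) R" if V: "submodule V R M" for V
  proof (rule idealI')
    note VM = submoduleE(1)[OF V]
    show "coef V \<subseteq> carrier R" by (auto simp: coef_def)
    have "\<zero>\<^bsub>M\<^esub> = \<zero> \<odot>\<^bsub>M\<^esub> x \<oplus>\<^bsub>M\<^esub> \<zero>\<^bsub>M\<^esub>" using x by simp
    then show "\<zero> \<in> coef V"
      using submodule_zero_closed[OF V] submodule_zero_closed[OF L] unfolding coef_def by blast
  next
    fix r s assume "r \<in> coef V" "s \<in> coef V"
    then obtain v w y z where *: "r \<in> carrier R" "s \<in> carrier R" "v \<in> V" "w \<in> V" "y \<in> ?L" "z \<in> ?L"
      "v = r \<odot>\<^bsub>M\<^esub> x \<oplus>\<^bsub>M\<^esub> y" "w = s \<odot>\<^bsub>M\<^esub> x \<oplus>\<^bsub>M\<^esub> z"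
      unfolding coef_def by blast
    have yz: "y \<in> carrier M" "z \<in> carrier M" using * LM by auto
    have "v \<oplus>\<^bsub>M\<^esub> w = (r \<oplus> s) \<odot>\<^bsub>M\<^esub> x \<oplus>\<^bsub>M\<^esub> (y \<oplus>\<^bsub>M\<^esub> z)"
      using * x yz by (simp add: smult_l_distr M.a_ac)
    moreover have "v \<oplus>\<^bsub>M\<^esub> w \<in> V" "y \<oplus>\<^bsub>M\<^esub> z \<in> ?L"
      using * submoduleE(5)[OF \<open>submodule V R M\<close>] submoduleE(5)[OF L] by blast+
    ultimately show "r \<oplus> s \<in> coef V" unfolding coef_def using *(1,2) by blast
  next
    fix a r assume a: "a \<in> carrier R" and "r \<in> coef V"
    then obtain v y where *: "r \<in> carrier R" "v \<in> V" "y \<in> ?L" "v = r \<odot>\<^bsub>M\<^esub> x \<oplus>\<^bsub>M\<^esub> y"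
      unfolding coef_def by blast
    have yM: "y \<in> carrier M" using * LM by auto
    have "a \<odot>\<^bsub>M\<^esub> v = (a \<otimes> r) \<odot>\<^bsub>M\<^esub> x \<oplus>\<^bsub>M\<^esub> (a \<odot>\<^bsub>M\<^esub> y)"
      using * x yM a by (simp add: smult_r_distr smult_assoc1)
    moreover have "a \<odot>\<^bsub>M\<^esub> v \<in> V" "a \<odot>\<^bsub>M\<^esub> y \<in> ?L"
      using * a submoduleE(4)[OF \<open>submodule V R M\<close>] submoduleE(4)[OF L] by blast+
    ultimately show "a \<otimes> r \<in> coef V" unfolding coef_def using *(1) a by blast
  qed
  from noetherian_ring.finetely_gen[OF assms(1) coef_ideal[OF W]]
  obtain Y where Y: "Y \<subseteq> carrier R" "finite Y" "coef W = Idl Y" by blast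
  then have YW: "Y \<subseteq> coef W" using genideal_self by blast
  have "\<forall>r\<in>Y. \<exists>v. v \<in> W \<and> (\<exists>y\<in>?L. v = r \<odot>\<^bsub>M\<^esub> x \<oplus>\<^bsub>M\<^esub> y)"
    using YW unfolding coef_def by blast
  from bchoice[OF this] obtain l
    where l: "\<forall>r\<in>Y. l r \<in> W \<and> (\<exists>y\<in>?L. l r = r \<odot>\<^bsub>M\<^esub> x \<oplus>\<^bsub>M\<^esub> y)" by blast
  have lW: "l ` Y \<subseteq> W" and lM: "l ` Y \<subseteq> carrier M" using l WM by auto
  \<comment> \<open>The span of the lifts is itself a submodule, so its coefficients form an ideal.
    That ideal contains the generators Y of \<open>coef W\<close>, hence all of
    \<open>coef W\<close>.\<close>
  have "Y \<subseteq> coef (lspan R M (l ` Y))"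
    using l lspan_base[OF lM] Y(1) unfolding coef_def by blast
  then have coef_sub: "coef W \<subseteq> coef (lspan R M (l ` Y))"
    unfolding Y(3) by (rule genideal_minimal[OF coef_ideal[OF submodule_lspan[OF lM]]])
  have gW: "lspan R M (l ` Y) \<subseteq> W" by (rule lspan_minimal[OF W lW])
  show ?case
  proof (rule fg_set_extend[OF WM])
    show "finite (l ` Y)" "l ` Y \<subseteq> W" using Y lW by auto
    show "W \<inter> ?L \<subseteq> W" by blast
    show "fg_set R M (W \<inter> ?L)"
      by (rule insert.IH[OF X submodule_Int[OF W L]]) blast
    fix w assume w: "w \<in> W"
    then obtain r y where r: "r \<in> carrier R" "y \<in> ?L" "w = r \<odot>\<^bsub>M\<^esub> x \<oplus>\<^bsub>M\<^esub> y"
      using lspan_insert[OF X x] insert.prems by blast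
    then have "r \<in> coef W" using w unfolding coef_def by blast
    \<comment> \<open>Here g is a combination of the lifts with the same x-coefficient r as w, so
      their difference no longer involves x.\<close>
    then obtain g z where g: "g \<in> lspan R M (l ` Y)" "z \<in> ?L" "g = r \<odot>\<^bsub>M\<^esub> x \<oplus>\<^bsub>M\<^esub> z"
      using coef_sub unfolding coef_def by blast
    have yz: "y \<in> carrier M" "z \<in> carrier M" "g \<in> carrier M" "w \<in> carrier M" using r g LM gW WM w by auto
    have eq: "g \<oplus>\<^bsub>M\<^esub> (y \<ominus>\<^bsub>M\<^esub> z) = w"
    proof -
      have "g \<oplus>\<^bsub>M\<^esub> (y \<ominus>\<^bsub>M\<^esub> z) = r \<odot>\<^bsub>M\<^esub> x \<oplus>\<^bsub>M\<^esub> (z \<oplus>\<^bsub>M\<^esub> (y \<ominus>\<^bsub>M\<^esub> z))"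
        unfolding g(3) using yz r(1) x by (intro M.a_assoc) auto
      also have "z \<oplus>\<^bsub>M\<^esub> (y \<ominus>\<^bsub>M\<^esub> z) = y"
        using yz(1,2) by (simp add: a_minus_def M.a_lcomm[of z y] M.r_neg)
      finally show ?thesis using r(3) by simp
    qed
    have "y \<ominus>\<^bsub>M\<^esub> z \<in> ?L" using submodule_minus_closed[OF L] r(2) g(2) by blast
    moreover have "y \<ominus>\<^bsub>M\<^esub> z = w \<ominus>\<^bsub>M\<^esub> g"
    proof -
      let ?k = "y \<ominus>\<^bsub>M\<^esub> z"
      have k: "?k \<in> carrier M" using yz by simp
      have "w \<ominus>\<^bsub>M\<^esub> g = (?k \<oplus>\<^bsub>M\<^esub> g) \<oplus>\<^bsub>M\<^esub> \<ominus>\<^bsub>M\<^esub> g"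
        using eq M.a_comm[OF k yz(3)] by (simp add: a_minus_def)
      also have "\<dots> = ?k" using k yz(3) by (simp add: M.a_assoc M.r_neg del: a_minus_def)
      finally show ?thesis by simp
    qed
    then have "y \<ominus>\<^bsub>M\<^esub> z \<in> W" using submodule_minus_closed[OF W w] g(1) gW by auto
    ultimately show "\<exists>g\<in>lspan R M (l ` Y). \<exists>k\<in>W \<inter> ?L. w = g \<oplus>\<^bsub>M\<^esub> k"
      using g(1) eq by blast
  qed
qed

end

text \<open>Preimages of generators of the image generate W up to the kernel: a combination of the
  images is the image of the same combination of preimages.\<close>

lemma fg_set_kernel_image:
  assumes M: "Module.module R M" and N: "Module.module R N" and W: "submodule W R M"
    and h: "h \<in> W \<rightarrow> carrier N"
    and h_add: "\<And>x y. x \<in> W \<Longrightarrow> y \<in> W \<Longrightarrow> h (x \<oplus>\<^bsub>M\<^esub> y) = h x \<oplus>\<^bsub>N\<^esub> h y"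
    and h_smult: "\<And>a x. a \<in> carrier R \<Longrightarrow> x \<in> W \<Longrightarrow> h (a \<odot>\<^bsub>M\<^esub> x) = a \<odot>\<^bsub>N\<^esub> h x"
    and image: "fg_set R N (h ` W)" and kernel: "fg_set R M {w \<in> W. h w = \<zero>\<^bsub>N\<^esub>}"
  shows "fg_set R M W"
proof -
  interpret M: Module.module R M by fact
  interpret N: Module.module R N by fact
  note WM = M.submoduleE(1)[OF W]
  have h0: "h \<zero>\<^bsub>M\<^esub> = \<zero>\<^bsub>N\<^esub>"
    using h_smult[of "\<zero>\<^bsub>R\<^esub>" "\<zero>\<^bsub>M\<^esub>"] M.submodule_zero_closed[OF W] h by (auto simp: Pi_iff)
  obtain X where X: "finite X" "X \<subseteq> h ` W" "h ` W \<subseteq> lspan R N X" using image by (auto simp: fg_set_def)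
  obtain Y where Y: "finite Y" "Y \<subseteq> W" "X = h ` Y" using finite_subset_image[OF X(1,2)] by blast
  have YM: "Y \<subseteq> carrier M" using Y WM by blast
  have YW: "lspan R M Y \<subseteq> W" by (rule M.lspan_minimal[OF W Y(2)])
  have lift: "\<exists>g\<in>lspan R M Y. h g = n" if "n \<in> lspan R N (h ` Y)" for n
    using that
  proof induction
    case zero
    then show ?case using h0 lspan.zero by blast
  next
    case (step a z n)
    then obtain g y where *: "g \<in> lspan R M Y" "h g = n" "y \<in> Y" "z = h y" by blast
    then have "a \<odot>\<^bsub>M\<^esub> y \<oplus>\<^bsub>M\<^esub> g \<in> lspan R M Y" using step by (intro lspan.step)
    moreover have "h (a \<odot>\<^bsub>M\<^esub> y \<oplus>\<^bsub>M\<^esub> g) = a \<odot>\<^bsub>N\<^esub> z \<oplus>\<^bsub>N\<^esub> n"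
      using * step.hyps(1) YW Y(2) M.submoduleE(4)[OF W, of a y] by (auto simp: h_add h_smult subset_iff)
    ultimately show ?case by blast
  qed
  show ?thesis
  proof (rule M.fg_set_extend[OF WM Y(1,2) _ kernel])
    show "{w \<in> W. h w = \<zero>\<^bsub>N\<^esub>} \<subseteq> W" by blast
    fix w assume w: "w \<in> W"
    then obtain g where g: "g \<in> lspan R M Y" "h g = h w" using X(3) Y(3) lift by blast
    have gW: "g \<in> W" using g YW by blast
    let ?k = "w \<ominus>\<^bsub>M\<^esub> g"
    have k: "?k \<in> W" by (rule M.submodule_minus_closed[OF W w gW])
    have eq: "w = g \<oplus>\<^bsub>M\<^esub> ?k"
      using w gW WM by (auto simp: a_minus_def M.a_lcomm[of g w] M.r_neg subset_iff)
    have "h w = h w \<oplus>\<^bsub>N\<^esub> h ?k" using h_add[OF gW k] eq g(2) by simp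
    then have "h ?k = \<zero>\<^bsub>N\<^esub>"
      using N.add.l_cancel_one'[of "h w" "h ?k"] funcset_mem[OF h w] funcset_mem[OF h k] by simp
    then show "\<exists>g\<in>lspan R M Y. \<exists>k\<in>{w \<in> W. h w = \<zero>\<^bsub>N\<^esub>}. w = g \<oplus>\<^bsub>M\<^esub> k"
      using g eq k by blast
  qed
qed

section \<open>Restriction of scalars and transport of finite generation\<close>

definition restrict_scalars :: "('a \<Rightarrow> 'c) \<Rightarrow> ('c, 'b) module \<Rightarrow> ('a, 'b) module" where
  "restrict_scalars \<phi> M = \<lparr>carrier = carrier M, monoid.mult = monoid.mult M, one = \<one>\<^bsub>M\<^esub>, zero = \<zero>\<^bsub>M\<^esub>,
     add = ring.add M, smult = (\<lambda>a. module.smult M (\<phi> a))\<rparr>"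

lemma restrict_scalars_simps [simp]:
  "carrier (restrict_scalars \<phi> M) = carrier M" "\<zero>\<^bsub>restrict_scalars \<phi> M\<^esub> = \<zero>\<^bsub>M\<^esub>"
  "ring.add (restrict_scalars \<phi> M) = ring.add M"
  "module.smult (restrict_scalars \<phi> M) a = module.smult M (\<phi> a)"
  by (simp_all add: restrict_scalars_def)

lemma finsum_restrict_scalars [simp]: "finsum (restrict_scalars \<phi> M) = finsum M"
  by (intro ext) (simp add: finsum_def finprod_def)

lemma module_restrict_scalars:
  assumes "Module.module S M" "cring R" "\<phi> \<in> ring_hom R S"
  shows "Module.module R (restrict_scalars \<phi> M)"
proof -
  interpret M: Module.module S M by fact
  have ab: "abelian_group (restrict_scalars \<phi> M)"
  proof (rule abelian_groupI)
    fix x assume "x \<in> carrier (restrict_scalars \<phi> M)"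
    then show "\<exists>y\<in>carrier (restrict_scalars \<phi> M). y \<oplus>\<^bsub>restrict_scalars \<phi> M\<^esub> x = \<zero>\<^bsub>restrict_scalars \<phi> M\<^esub>"
      using M.l_neg[of x] M.a_inv_closed[of x] by auto
  qed (auto simp: M.a_ac)
  show ?thesis
    by (rule Module.moduleI[OF assms(2) ab])
       (use assms(3) in \<open>auto simp: ring_hom_add ring_hom_mult ring_hom_one ring_hom_closed
          M.smult_l_distr M.smult_r_distr M.smult_assoc1\<close>)
qed

text \<open>The map \<phi> on scalars is only required to send scalars to scalars, not to be a ring
  homomorphism. It may thus be a mere choice of lifts along a surjection, and with h the identity
  the lemma changes the ring of a fixed module in either direction.\<close>

lemma finitely_generated_image:
  assumes M: "Module.module R M" and N: "Module.module S N" and "finitely_generated R M"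
    and \<phi>: "\<phi> \<in> carrier R \<rightarrow> carrier S" and h: "h ` carrier M = carrier N"
    and h_add: "\<And>x y. x \<in> carrier M \<Longrightarrow> y \<in> carrier M \<Longrightarrow> h (x \<oplus>\<^bsub>M\<^esub> y) = h x \<oplus>\<^bsub>N\<^esub> h y"
    and h_smult: "\<And>a x. a \<in> carrier R \<Longrightarrow> x \<in> carrier M \<Longrightarrow> h (a \<odot>\<^bsub>M\<^esub> x) = \<phi> a \<odot>\<^bsub>N\<^esub> h x"
  shows "finitely_generated S N"
proof -
  interpret M: Module.module R M by fact
  interpret N: Module.module S N by fact
  obtain X where X: "finite X" "X \<subseteq> carrier M" "carrier M \<subseteq> lspan R M X"
    using assms(3) unfolding finitely_generated_iff[OF M] fg_set_def by blast
  have h0: "h \<zero>\<^bsub>M\<^esub> = \<zero>\<^bsub>N\<^esub>"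
  proof -
    have "h \<zero>\<^bsub>M\<^esub> \<in> carrier N" using h by blast
    then show ?thesis
      using h_add[of "\<zero>\<^bsub>M\<^esub>" "\<zero>\<^bsub>M\<^esub>"] N.add.l_cancel_one'[of "h \<zero>\<^bsub>M\<^esub>" "h \<zero>\<^bsub>M\<^esub>"] by simp
  qed
  have "h m \<in> lspan S N (h ` X)" if "m \<in> lspan R M X" for m
    using that
  proof induction
    case zero
    then show ?case using h0 lspan.zero by metis
  next
    case (step a x y)
    then have "\<phi> a \<odot>\<^bsub>N\<^esub> h x \<oplus>\<^bsub>N\<^esub> h y \<in> lspan S N (h ` X)"
      using \<phi> by (intro lspan.step) auto
    moreover have "x \<in> carrier M" "y \<in> carrier M" using step X(2) M.lspan_carrier[OF X(2)] by blast+
    ultimately show ?case using step.hyps(1) by (simp add: h_add h_smult)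
  qed
  then have "carrier N \<subseteq> lspan S N (h ` X)" unfolding h[symmetric] using X(3) by auto
  then show ?thesis
    unfolding finitely_generated_iff[OF N] fg_set_def using X(1,2) h by (intro exI[of _ "h ` X"]) auto
qed

section \<open>Graded modules\<close>

lemma a_inv_restrict_scalars [simp]: "a_inv (restrict_scalars \<phi> M) = a_inv M"
  by (intro ext) (simp add: a_inv_def m_inv_def)

lemma (in abelian_group) additive_subgroupI':
  assumes "H \<subseteq> carrier G" "\<zero> \<in> H"
    and "\<And>x y. x \<in> H \<Longrightarrow> y \<in> H \<Longrightarrow> x \<oplus> y \<in> H" "\<And>x. x \<in> H \<Longrightarrow> \<ominus> x \<in> H"
  shows "additive_subgroup H G"
proof (rule additive_subgroupI, rule subgroup.intro)
  fix x assume "x \<in> H"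
  then show "inv\<^bsub>add_monoid G\<^esub> x \<in> H" using assms(4) by (simp add: a_inv_def)
qed (use assms in auto)

lemma additive_zero:
  assumes "abelian_group M" "abelian_group N" "h \<in> carrier M \<rightarrow> carrier N"
    and "\<And>x y. x \<in> carrier M \<Longrightarrow> y \<in> carrier M \<Longrightarrow> h (x \<oplus>\<^bsub>M\<^esub> y) = h x \<oplus>\<^bsub>N\<^esub> h y"
  shows "h \<zero>\<^bsub>M\<^esub> = \<zero>\<^bsub>N\<^esub>"
proof -
  interpret M: abelian_group M by fact
  interpret N: abelian_group N by fact
  have "h \<zero>\<^bsub>M\<^esub> \<in> carrier N" using assms(3) by auto
  then show ?thesis
    using assms(4)[of "\<zero>\<^bsub>M\<^esub>" "\<zero>\<^bsub>M\<^esub>"] N.add.l_cancel_one'[of "h \<zero>\<^bsub>M\<^esub>" "h \<zero>\<^bsub>M\<^esub>"] by simp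
qed

lemma additive_finsum:
  assumes "abelian_group M" "abelian_group N" "h \<in> carrier M \<rightarrow> carrier N"
    and h_add: "\<And>x y. x \<in> carrier M \<Longrightarrow> y \<in> carrier M \<Longrightarrow> h (x \<oplus>\<^bsub>M\<^esub> y) = h x \<oplus>\<^bsub>N\<^esub> h y"
    and "f \<in> S \<rightarrow> carrier M"
  shows "h (finsum M f S) = finsum N (\<lambda>i. h (f i)) S"
  using assms(5)
proof (induction S rule: infinite_finite_induct)
  interpret M: abelian_group M by fact
  interpret N: abelian_group N by fact
  {
    \<comment> \<open>Over an infinite index set both sums have the default value zero, which h
      preserves.\<close>
    case (infinite S)
    then show ?case using additive_zero[OF assms(1-4)] by (simp add: M.finsum_infinite N.finsum_infinite)
  next
    case empty
    then show ?case using additive_zero[OF assms(1-4)] by simp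
  next
    case (insert i S)
    then have f: "f \<in> S \<rightarrow> carrier M" "f i \<in> carrier M" by auto
    then have hf: "(\<lambda>i. h (f i)) \<in> S \<rightarrow> carrier N" "h (f i) \<in> carrier N" using assms(3) by auto
    show ?case
      using insert.hyps insert.IH[OF f(1)] M.finsum_insert[OF insert.hyps f] N.finsum_insert[OF insert.hyps hf]
        h_add[OF f(2) M.finsum_closed[OF f(1)]] by simp
  }
qed

definition hcomp :: "('a, 'b) module \<Rightarrow> (int \<Rightarrow> 'b set) \<Rightarrow> 'b \<Rightarrow> int \<Rightarrow> 'b" where
  "hcomp M Md m = (THE f. (\<forall>d. f d \<in> Md d) \<and> finite {d. f d \<noteq> \<zero>\<^bsub>M\<^esub>} \<and>
     m = (\<Oplus>\<^bsub>M\<^esub> d\<in>{d. f d \<noteq> \<zero>\<^bsub>M\<^esub>}. f d))"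

locale graded = Module.module R M for R (structure) and M :: "('a, 'b) module" (structure) +
  fixes Rd :: "nat \<Rightarrow> 'a set" and Md :: "int \<Rightarrow> 'b set"
  assumes graded: "graded_module R Rd M Md"
begin

lemma additive_subgroup_homog: "additive_subgroup (Md d) M"
  using graded by (simp add: graded_module_def)

lemma homog_carrier: "m \<in> Md d \<Longrightarrow> m \<in> carrier M"
  using additive_subgroup.a_subset[OF additive_subgroup_homog] by blast

lemma homog_zero: "\<zero>\<^bsub>M\<^esub> \<in> Md d"
  using additive_subgroup.zero_closed[OF additive_subgroup_homog] .

lemma homog_add: "m \<in> Md d \<Longrightarrow> n \<in> Md d \<Longrightarrow> m \<oplus>\<^bsub>M\<^esub> n \<in> Md d"
  using additive_subgroup.a_closed[OF additive_subgroup_homog] .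

lemma homog_a_inv: "m \<in> Md d \<Longrightarrow> \<ominus>\<^bsub>M\<^esub> m \<in> Md d"
  using additive_subgroup.a_inv_closed[OF additive_subgroup_homog] .

lemma homog_smult: "a \<in> Rd i \<Longrightarrow> m \<in> Md d \<Longrightarrow> a \<odot>\<^bsub>M\<^esub> m \<in> Md (int i + d)"
  using graded by (simp add: graded_module_def)

lemma hcomp_ex1:
  "m \<in> carrier M \<Longrightarrow> \<exists>!f. (\<forall>d. f d \<in> Md d) \<and> finite {d. f d \<noteq> \<zero>\<^bsub>M\<^esub>} \<and>
     m = (\<Oplus>\<^bsub>M\<^esub> d\<in>{d. f d \<noteq> \<zero>\<^bsub>M\<^esub>}. f d)"
  using graded by (simp add: graded_module_def)

lemma
  assumes "m \<in> carrier M"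
  shows hcomp_homog: "hcomp M Md m d \<in> Md d"
    and hcomp_finite: "finite {d. hcomp M Md m d \<noteq> \<zero>\<^bsub>M\<^esub>}"
    and hcomp_sum: "m = (\<Oplus>\<^bsub>M\<^esub> d\<in>{d. hcomp M Md m d \<noteq> \<zero>\<^bsub>M\<^esub>}. hcomp M Md m d)"
  using theI'[OF hcomp_ex1[OF assms]] unfolding hcomp_def[symmetric] by blast+

lemma sum_support:
  assumes "\<And>d. f d \<in> Md d" "finite S" "\<And>d. d \<notin> S \<Longrightarrow> f d = \<zero>\<^bsub>M\<^esub>"
  shows "(\<Oplus>\<^bsub>M\<^esub> d\<in>{d. f d \<noteq> \<zero>\<^bsub>M\<^esub>}. f d) = (\<Oplus>\<^bsub>M\<^esub> d\<in>S. f d)"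
  using assms homog_carrier[OF assms(1)]
  by (intro M.add.finprod_mono_neutral_cong_left) auto

text \<open>The finite set S may exceed the support of f, so that decompositions at different points
  of the graph can share one index set.\<close>

lemma hcomp_unique:
  assumes "\<And>d. f d \<in> Md d" "finite S" "\<And>d. d \<notin> S \<Longrightarrow> f d = \<zero>\<^bsub>M\<^esub>" "m = (\<Oplus>\<^bsub>M\<^esub> d\<in>S. f d)"
  shows "hcomp M Md m = f"
proof -
  have "m \<in> carrier M" unfolding assms(4) using homog_carrier[OF assms(1)] by (intro M.finsum_closed) auto
  moreover have "finite {d. f d \<noteq> \<zero>\<^bsub>M\<^esub>}"
    by (rule finite_subset[OF _ assms(2)]) (use assms(3) in blast)
  moreover have "m = (\<Oplus>\<^bsub>M\<^esub> d\<in>{d. f d \<noteq> \<zero>\<^bsub>M\<^esub>}. f d)"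
    using sum_support[OF assms(1-3)] assms(4) by simp
  ultimately show ?thesis
    unfolding hcomp_def using assms(1) by (intro the1_equality hcomp_ex1) auto
qed

lemma hcomp_sum':
  assumes "m \<in> carrier M" "finite S" "{d. hcomp M Md m d \<noteq> \<zero>\<^bsub>M\<^esub>} \<subseteq> S"
  shows "(\<Oplus>\<^bsub>M\<^esub> d\<in>S. hcomp M Md m d) = m"
  using sum_support[OF hcomp_homog[OF assms(1)] assms(2)] hcomp_sum[OF assms(1)] assms(3) by force

lemma hcomp_of_homog: "m \<in> Md d \<Longrightarrow> hcomp M Md m = (\<lambda>e. if e = d then m else \<zero>\<^bsub>M\<^esub>)"
  by (rule hcomp_unique[of _ "{d}"])
     (auto simp: homog_zero homog_carrier M.finsum_insert[where F = "{}"])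

lemma homogI:
  assumes "m \<in> carrier M" "\<And>e. e \<noteq> d \<Longrightarrow> hcomp M Md m e = \<zero>\<^bsub>M\<^esub>"
  shows "m \<in> Md d"
proof -
  have "m = (\<Oplus>\<^bsub>M\<^esub> e\<in>{d}. hcomp M Md m e)"
    by (rule hcomp_sum'[symmetric]) (use assms in auto)
  also have "\<dots> = hcomp M Md m d"
    using homog_carrier[OF hcomp_homog[OF assms(1), of d]] by (simp add: M.finsum_insert[where F = "{}"])
  finally show ?thesis using hcomp_homog[OF assms(1), of d] by simp
qed

end

lemma gradedI: "graded_module R Rd M Md \<Longrightarrow> graded R M Rd Md"
  by (simp add: graded_def graded_axioms_def graded_module_def)

text \<open>The images of the components form a homogeneous decomposition of the image, and such a
  decomposition is unique. Scalars do not enter, so the two modules may live over different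
  rings.\<close>

lemma hcomp_hom:
  assumes M: "graded R M Rd Md" and N: "graded S N Sd Nd"
    and h: "h \<in> carrier M \<rightarrow> carrier N"
    and h_add: "\<And>x y. x \<in> carrier M \<Longrightarrow> y \<in> carrier M \<Longrightarrow> h (x \<oplus>\<^bsub>M\<^esub> y) = h x \<oplus>\<^bsub>N\<^esub> h y"
    and h_deg: "\<And>d. h ` Md d \<subseteq> Nd d" and m: "m \<in> carrier M"
  shows "hcomp N Nd (h m) = (\<lambda>d. h (hcomp M Md m d))"
proof -
  interpret M: graded R M Rd Md by fact
  interpret N: graded S N Sd Nd by fact
  note h0 = additive_zero[OF M.M.abelian_group_axioms N.M.abelian_group_axioms h h_add]
  show ?thesis
  proof (rule N.hcomp_unique[OF _ M.hcomp_finite[OF m]])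
    show "h (hcomp M Md m d) \<in> Nd d" for d using h_deg M.hcomp_homog[OF m] by blast
    show "h (hcomp M Md m d) = \<zero>\<^bsub>N\<^esub>" if "d \<notin> {d. hcomp M Md m d \<noteq> \<zero>\<^bsub>M\<^esub>}" for d
      using that h0 by simp
    have "h m = h (\<Oplus>\<^bsub>M\<^esub> d\<in>{d. hcomp M Md m d \<noteq> \<zero>\<^bsub>M\<^esub>}. hcomp M Md m d)"
      using M.hcomp_sum[OF m] by (rule arg_cong)
    also have "\<dots> = (\<Oplus>\<^bsub>N\<^esub> d\<in>{d. hcomp M Md m d \<noteq> \<zero>\<^bsub>M\<^esub>}. h (hcomp M Md m d))"
      using M.homog_carrier[OF M.hcomp_homog[OF m]]
      by (intro additive_finsum[OF M.M.abelian_group_axioms N.M.abelian_group_axioms h h_add]) auto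
    finally show "h m = (\<Oplus>\<^bsub>N\<^esub> d\<in>{d. hcomp M Md m d \<noteq> \<zero>\<^bsub>M\<^esub>}. h (hcomp M Md m d))" .
  qed
qed

lemma graded_hom_hcomp:
  assumes "graded R M Rd Md" "graded S N Sd Nd" "graded_hom R \<phi> M Md N Nd h" "m \<in> carrier M"
  shows "hcomp N Nd (h m) = (\<lambda>d. h (hcomp M Md m d))"
  using assms(3) by (intro hcomp_hom[OF assms(1,2) _ _ _ assms(4)]) (auto simp: graded_hom_def)

lemma graded_homD:
  assumes "graded_hom R \<phi> P Pd Q Qd h"
  shows "m \<in> carrier P \<Longrightarrow> h m \<in> carrier Q"
    "m \<in> carrier P \<Longrightarrow> n \<in> carrier P \<Longrightarrow> h (m \<oplus>\<^bsub>P\<^esub> n) = h m \<oplus>\<^bsub>Q\<^esub> h n"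
    "a \<in> carrier R \<Longrightarrow> m \<in> carrier P \<Longrightarrow> h (a \<odot>\<^bsub>P\<^esub> m) = \<phi> a \<odot>\<^bsub>Q\<^esub> h m"
    "m \<in> Pd d \<Longrightarrow> h m \<in> Qd d"
  using assms by (auto simp: graded_hom_def image_subset_iff)

lemma graded_moduleI:
  assumes M: "Module.module R M" and "\<And>d. additive_subgroup (Md d) M"
    and "\<And>i d a m. a \<in> Rd i \<Longrightarrow> m \<in> Md d \<Longrightarrow> a \<odot>\<^bsub>M\<^esub> m \<in> Md (int i + d)"
    and c: "\<And>m d. m \<in> carrier M \<Longrightarrow> c m d \<in> Md d"
      "\<And>m. m \<in> carrier M \<Longrightarrow> finite {d. c m d \<noteq> \<zero>\<^bsub>M\<^esub>}"
      "\<And>m. m \<in> carrier M \<Longrightarrow> m = (\<Oplus>\<^bsub>M\<^esub> d\<in>{d. c m d \<noteq> \<zero>\<^bsub>M\<^esub>}. c m d)"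
    and uniq: "\<And>m f. m \<in> carrier M \<Longrightarrow> (\<And>d. f d \<in> Md d) \<Longrightarrow> finite {d. f d \<noteq> \<zero>\<^bsub>M\<^esub>} \<Longrightarrow>
      m = (\<Oplus>\<^bsub>M\<^esub> d\<in>{d. f d \<noteq> \<zero>\<^bsub>M\<^esub>}. f d) \<Longrightarrow> f = c m"
  shows "graded_module R Rd M Md"
  unfolding graded_module_def
proof (intro conjI allI ballI)
  fix m assume m: "m \<in> carrier M"
  show "\<exists>!f. (\<forall>d. f d \<in> Md d) \<and> finite {d. f d \<noteq> \<zero>\<^bsub>M\<^esub>} \<and> m = (\<Oplus>\<^bsub>M\<^esub> d\<in>{d. f d \<noteq> \<zero>\<^bsub>M\<^esub>}. f d)"
    by (rule ex1I[of _ "c m"]) (use c[OF m] uniq[OF m] in blast)+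
qed (use assms in auto)

text \<open>\<open>graded_iso\<close> asks only that h send degree d into degree d; the inverse does
  so as well. If h m has degree d, then h kills the components of m in all other degrees, and h is
  injective.\<close>

lemma graded_iso_sym:
  assumes M: "graded R M Rd Md" and N: "graded R N Sd Nd" and h: "graded_iso R M Md N Nd h"
  shows "graded_iso R N Nd M Md (inv_into (carrier M) h)"
proof -
  interpret M: graded R M Rd Md by fact
  interpret N: graded R N Sd Nd by fact
  let ?k = "inv_into (carrier M) h"
  have hom: "graded_hom R (\<lambda>a. a) M Md N Nd h" and bij: "bij_betw h (carrier M) (carrier N)"
    using h by (auto simp: graded_iso_def)
  have hC: "h m \<in> carrier N" if "m \<in> carrier M" for m using hom that by (auto simp: graded_hom_def)
  have h_add: "h (m \<oplus>\<^bsub>M\<^esub> n) = h m \<oplus>\<^bsub>N\<^esub> h n" if "m \<in> carrier M" "n \<in> carrier M" for m n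
    using hom that by (auto simp: graded_hom_def)
  have h_smult: "h (a \<odot>\<^bsub>M\<^esub> m) = a \<odot>\<^bsub>N\<^esub> h m" if "a \<in> carrier R" "m \<in> carrier M" for a m
    using hom that by (auto simp: graded_hom_def)
  have inj: "m = n" if "h m = h n" "m \<in> carrier M" "n \<in> carrier M" for m n
    using bij that by (auto simp: bij_betw_def inj_on_def)
  have k: "?k n \<in> carrier M" "h (?k n) = n" if "n \<in> carrier N" for n
    using bij that by (auto simp: bij_betw_def inv_into_into f_inv_into_f)
  have "graded_hom R (\<lambda>a. a) N Nd M Md ?k"
    unfolding graded_hom_def
  proof (intro conjI ballI allI subsetI)
    show "?k \<in> carrier N \<rightarrow> carrier M" using k by blast
    fix m n assume "m \<in> carrier N" "n \<in> carrier N"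
    then show "?k (m \<oplus>\<^bsub>N\<^esub> n) = ?k m \<oplus>\<^bsub>M\<^esub> ?k n"
      by (intro inj) (simp_all add: k h_add)
  next
    fix a n assume "a \<in> carrier R" "n \<in> carrier N"
    then show "?k (a \<odot>\<^bsub>N\<^esub> n) = a \<odot>\<^bsub>M\<^esub> ?k n"
      by (intro inj) (simp_all add: k h_smult)
  next
    fix d m assume "m \<in> ?k ` Nd d"
    then obtain n where n: "n \<in> Nd d" "m = ?k n" by blast
    have nN: "n \<in> carrier N" by (rule N.homog_carrier[OF n(1)])
    have mM: "m \<in> carrier M" "h m = n" using k[OF nN] n by auto
    have "hcomp M Md m e = \<zero>\<^bsub>M\<^esub>" if "e \<noteq> d" for e
    proof (rule inj)
      have "h (hcomp M Md m e) = hcomp N Nd n e"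
        using graded_hom_hcomp[OF M N hom mM(1)] mM(2) by simp
      also have "\<dots> = \<zero>\<^bsub>N\<^esub>" using N.hcomp_of_homog[OF n(1)] that by simp
      also have "\<dots> = h \<zero>\<^bsub>M\<^esub>"
        using additive_zero[OF M.M.abelian_group_axioms N.M.abelian_group_axioms, of h] hC h_add by auto
      finally show "h (hcomp M Md m e) = h \<zero>\<^bsub>M\<^esub>" .
      show "hcomp M Md m e \<in> carrier M" by (rule M.homog_carrier[OF M.hcomp_homog[OF mM(1)]])
    qed simp
    then show "m \<in> Md d" by (rule M.homogI[OF mM(1)])
  qed
  moreover have "bij_betw ?k (carrier N) (carrier M)" by (rule bij_betw_inv_into[OF bij])
  ultimately show ?thesis by (simp add: graded_iso_def)
qed

lemma graded_module_restrict_scalars: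
  assumes M: "graded_module S Sd M Md" and R: "cring R" and \<phi>: "\<phi> \<in> ring_hom R S"
    and \<phi>_deg: "\<And>i. \<phi> ` Rd i \<subseteq> Sd i"
  shows "graded_module R Rd (restrict_scalars \<phi> M) Md"
proof -
  interpret M: graded S M Sd Md by (rule gradedI[OF M])
  let ?M = "restrict_scalars \<phi> M"
  note mod = module_restrict_scalars[OF M.module_axioms R \<phi>]
  interpret N: Module.module R ?M by (rule mod)
  show ?thesis
  proof (rule graded_moduleI[where c = "hcomp M Md", OF mod])
    show "additive_subgroup (Md d) ?M" for d
      by (rule N.additive_subgroupI')
         (auto simp: M.homog_carrier M.homog_zero M.homog_add M.homog_a_inv)
    show "a \<odot>\<^bsub>?M\<^esub> m \<in> Md (int i + d)" if "a \<in> Rd i" "m \<in> Md d" for i d a m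
      using M.homog_smult[OF _ that(2), of "\<phi> a" i] \<phi>_deg[of i] that(1) by auto
    fix m assume m: "m \<in> carrier ?M"
    show "hcomp M Md m d \<in> Md d" for d using m M.hcomp_homog by simp
    show "finite {d. hcomp M Md m d \<noteq> \<zero>\<^bsub>?M\<^esub>}" using m M.hcomp_finite by simp
    show "m = (\<Oplus>\<^bsub>?M\<^esub> d\<in>{d. hcomp M Md m d \<noteq> \<zero>\<^bsub>?M\<^esub>}. hcomp M Md m d)"
      using m M.hcomp_sum by simp
    fix f assume f: "\<And>d. f d \<in> Md d" "finite {d. f d \<noteq> \<zero>\<^bsub>?M\<^esub>}"
      "m = (\<Oplus>\<^bsub>?M\<^esub> d\<in>{d. f d \<noteq> \<zero>\<^bsub>?M\<^esub>}. f d)"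
    then have "hcomp M Md m = f" by (intro M.hcomp_unique[of f "{d. f d \<noteq> \<zero>\<^bsub>?M\<^esub>}"]) auto
    then show "f = hcomp M Md m" by simp
  qed
qed

section \<open>Sections and the structure sheaf\<close>

lemma sections_iff:
  "s \<in> sections G Z C D \<rho> \<longleftrightarrow>
     fst s \<in> extensional (Inl -` Z) \<and> snd s \<in> extensional (Inr -` Z) \<and>
     (\<forall>x. Inl x \<in> Z \<longrightarrow> fst s x \<in> C x) \<and> (\<forall>L. Inr L \<in> Z \<longrightarrow> snd s L \<in> D L) \<and>
     (\<forall>x L. Inl x \<in> Z \<longrightarrow> Inr L \<in> Z \<longrightarrow> x \<in> ends G L \<longrightarrow> \<rho> x L (fst s x) = snd s L)"
  by (cases s) (auto simp: sections_def PiE_def Pi_def)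

text \<open>Tuples are \<open>undefined\<close> off Z, so their values on Z decide equality. The two
  families of carriers and maps may differ, since only extensionality is taken from them.\<close>

lemma tuple_eqI:
  assumes "s \<in> sections G Z C D \<rho>" "t \<in> sections G Z C' D' \<rho>'"
    and "\<And>x. Inl x \<in> Z \<Longrightarrow> fst s x = fst t x" "\<And>L. Inr L \<in> Z \<Longrightarrow> snd s L = snd t L"
  shows "s = t"
  using assms unfolding sections_iff
  by (intro prod_eqI; auto intro!: extensionalityI[of _ "Inl -` Z"] extensionalityI[of _ "Inr -` Z"])

lemma tuple_map2_apply [simp]:
  "Inl x \<in> Z \<Longrightarrow> fst (tuple_map2 Z f g a m) x = f x (fst a x) (fst m x)"
  "Inr L \<in> Z \<Longrightarrow> snd (tuple_map2 Z f g a m) L = g L (snd a L) (snd m L)"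
  by (simp_all add: tuple_map2_def)

text \<open>Three independent families of carriers and maps let one closure statement cover
  addition, ring multiplication and the action of scalar sections on module sections, also in
  prescribed degrees.\<close>

lemma tuple_map2_sections:
  assumes "a \<in> sections G Z C1 D1 \<rho>1" "b \<in> sections G Z C2 D2 \<rho>2"
    and "\<And>x u v. Inl x \<in> Z \<Longrightarrow> u \<in> C1 x \<Longrightarrow> v \<in> C2 x \<Longrightarrow> f x u v \<in> C3 x"
    and "\<And>L u v. Inr L \<in> Z \<Longrightarrow> u \<in> D1 L \<Longrightarrow> v \<in> D2 L \<Longrightarrow> g L u v \<in> D3 L"
    and "\<And>x L u v. Inl x \<in> Z \<Longrightarrow> Inr L \<in> Z \<Longrightarrow> x \<in> ends G L \<Longrightarrow> u \<in> C1 x \<Longrightarrow> v \<in> C2 x \<Longrightarrow>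
      \<rho>3 x L (f x u v) = g L (\<rho>1 x L u) (\<rho>2 x L v)"
  shows "tuple_map2 Z f g a b \<in> sections G Z C3 D3 \<rho>3"
  using assms unfolding sections_iff by (auto simp: tuple_map2_def)

lemma restrict_sections_iff:
  "(restrict s (Inl -` Z), restrict t (Inr -` Z)) \<in> sections G Z C D \<rho> \<longleftrightarrow>
     (\<forall>x. Inl x \<in> Z \<longrightarrow> s x \<in> C x) \<and> (\<forall>L. Inr L \<in> Z \<longrightarrow> t L \<in> D L) \<and>
     (\<forall>x L. Inl x \<in> Z \<longrightarrow> Inr L \<in> Z \<longrightarrow> x \<in> ends G L \<longrightarrow> \<rho> x L (s x) = t L)"
  by (auto simp: sections_iff)

lemma tuple_restrict_sections:
  "s \<in> sections G Z C D \<rho> \<Longrightarrow> W \<subseteq> Z \<Longrightarrow> tuple_restrict W s \<in> sections G W C D \<rho>"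
  unfolding tuple_restrict_def restrict_sections_iff unfolding sections_iff by blast

text \<open>N is any record with the given carrier, addition and zero, so that the rings of scalar
  sections and the modules of sections are both instances.\<close>

lemma abelian_group_sections:
  fixes N :: "(('v, 'e, 'm, 'n) tuple, 'z) ring_scheme"
  assumes P: "\<And>x. Inl x \<in> Z \<Longrightarrow> abelian_group (P x)" and Q: "\<And>L. Inr L \<in> Z \<Longrightarrow> abelian_group (Q L)"
    and \<rho>: "\<And>x L. Inl x \<in> Z \<Longrightarrow> Inr L \<in> Z \<Longrightarrow> x \<in> ends G L \<Longrightarrow> \<rho> x L \<in> carrier (P x) \<rightarrow> carrier (Q L)"
    and \<rho>_add: "\<And>x L m n. Inl x \<in> Z \<Longrightarrow> Inr L \<in> Z \<Longrightarrow> x \<in> ends G L \<Longrightarrow> m \<in> carrier (P x) \<Longrightarrow>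
      n \<in> carrier (P x) \<Longrightarrow> \<rho> x L (m \<oplus>\<^bsub>P x\<^esub> n) = \<rho> x L m \<oplus>\<^bsub>Q L\<^esub> \<rho> x L n"
    and N: "carrier N = sections G Z (\<lambda>x. carrier (P x)) (\<lambda>L. carrier (Q L)) \<rho>"
      "ring.add N = tuple_map2 Z (\<lambda>x. ring.add (P x)) (\<lambda>L. ring.add (Q L))"
      "\<zero>\<^bsub>N\<^esub> = (\<lambda>x\<in>Inl -` Z. \<zero>\<^bsub>P x\<^esub>, \<lambda>L\<in>Inr -` Z. \<zero>\<^bsub>Q L\<^esub>)"
  shows "abelian_group N"
proof (rule abelian_groupI)
  have abm: "Inl x \<in> Z \<Longrightarrow> abelian_monoid (P x)" "Inr L \<in> Z \<Longrightarrow> abelian_monoid (Q L)" for x L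
    using P Q by (auto intro: abelian_group.axioms)
  show add: "s \<oplus>\<^bsub>N\<^esub> t \<in> carrier N" if "s \<in> carrier N" "t \<in> carrier N" for s t
    using that unfolding N
    by (rule tuple_map2_sections) (auto intro: abelian_monoid.a_closed abm simp: \<rho>_add)
  have \<rho>0: "\<rho> x L \<zero>\<^bsub>P x\<^esub> = \<zero>\<^bsub>Q L\<^esub>" if "Inl x \<in> Z" "Inr L \<in> Z" "x \<in> ends G L" for x L
    using that by (intro additive_zero[OF P Q \<rho> \<rho>_add])
  show zero: "\<zero>\<^bsub>N\<^esub> \<in> carrier N"
    unfolding N restrict_sections_iff using \<rho>0 by (auto intro: abelian_monoid.zero_closed abm)
  fix s assume s: "s \<in> carrier N"
  have fs: "Inl x \<in> Z \<Longrightarrow> fst s x \<in> carrier (P x)" "Inr L \<in> Z \<Longrightarrow> snd s L \<in> carrier (Q L)"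
    if "s \<in> carrier N" for x L s using that by (auto simp: N sections_iff)
  show "\<zero>\<^bsub>N\<^esub> \<oplus>\<^bsub>N\<^esub> s = s"
    by (rule tuple_eqI[OF add[OF zero s, unfolded N(1)] s[unfolded N(1)]])
       (auto simp: N(2,3) fs[OF s] abelian_monoid.l_zero abm)
  show "s \<oplus>\<^bsub>N\<^esub> t = t \<oplus>\<^bsub>N\<^esub> s" if t: "t \<in> carrier N" for t
    by (rule tuple_eqI[OF add[OF s t, unfolded N(1)] add[OF t s, unfolded N(1)]])
       (auto simp: N(2) fs[OF s] fs[OF t] intro: abelian_monoid.a_comm abm)
  show "s \<oplus>\<^bsub>N\<^esub> t \<oplus>\<^bsub>N\<^esub> u = s \<oplus>\<^bsub>N\<^esub> (t \<oplus>\<^bsub>N\<^esub> u)" if t: "t \<in> carrier N" and u: "u \<in> carrier N" for t u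
    by (rule tuple_eqI[OF add[OF add[OF s t] u, unfolded N(1)] add[OF s add[OF t u], unfolded N(1)]])
       (auto simp: N(2) fs[OF s] fs[OF t] fs[OF u] intro: abelian_monoid.a_assoc abm)
  \<comment> \<open>The pointwise negative is a compatible tuple because the additive maps \<rho>
    commute with negation.\<close>
  define t where "t = (\<lambda>x\<in>Inl -` Z. \<ominus>\<^bsub>P x\<^esub> fst s x, \<lambda>L\<in>Inr -` Z. \<ominus>\<^bsub>Q L\<^esub> snd s L)"
  have "\<rho> x L (\<ominus>\<^bsub>P x\<^esub> fst s x) = \<ominus>\<^bsub>Q L\<^esub> snd s L" if "Inl x \<in> Z" "Inr L \<in> Z" "x \<in> ends G L" for x L
  proof -
    have eq: "snd s L = \<rho> x L (fst s x)" using s that by (auto simp: N sections_iff)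
    have inv: "\<ominus>\<^bsub>P x\<^esub> fst s x \<in> carrier (P x)"
      using P[OF that(1)] fs(1)[OF s that(1)] by (rule abelian_group.a_inv_closed)
    have "\<rho> x L (\<ominus>\<^bsub>P x\<^esub> fst s x) \<oplus>\<^bsub>Q L\<^esub> \<rho> x L (fst s x) = \<zero>\<^bsub>Q L\<^esub>"
      using \<rho>_add[OF that inv fs(1)[OF s that(1)]] abelian_group.l_neg[OF P[OF that(1)] fs(1)[OF s that(1)]]
        \<rho>0[OF that] by simp
    from abelian_group.minus_equality[OF Q[OF that(2)] this] show ?thesis
      using funcset_mem[OF \<rho>[OF that] inv] fs(2)[OF s that(2)] eq by simp
  qed
  then have t: "t \<in> carrier N"
    unfolding N t_def restrict_sections_iff using fs[OF s] P Q by (auto intro: abelian_group.a_inv_closed)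
  moreover have "t \<oplus>\<^bsub>N\<^esub> s = \<zero>\<^bsub>N\<^esub>"
    by (rule tuple_eqI[OF add[OF t s, unfolded N(1)] zero[unfolded N(1)]])
       (auto simp: N(2,3) t_def fs[OF s] intro: abelian_group.l_neg P Q)
  ultimately show "\<exists>t\<in>carrier N. t \<oplus>\<^bsub>N\<^esub> s = \<zero>\<^bsub>N\<^esub>" by blast
qed

section \<open>The polynomial ring and the rings of sections of the structure sheaf\<close>

lemma polyring_simps [simp]:
  "carrier (polyring scale) = polyfun scale"
  "p \<oplus>\<^bsub>polyring scale\<^esub> q = (\<lambda>v. p v + q v)" "p \<otimes>\<^bsub>polyring scale\<^esub> q = (\<lambda>v. p v * q v)"
  "\<zero>\<^bsub>polyring scale\<^esub> = (\<lambda>_. 0)" "\<one>\<^bsub>polyring scale\<^esub> = (\<lambda>_. 1)"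
  by (simp_all add: polyring_def)

lemma polyring_cring: "cring (polyring scale)"
proof (rule cringI)
  show "abelian_group (polyring scale)"
  proof (rule abelian_groupI)
    fix p assume "p \<in> carrier (polyring scale)"
    then have "(\<lambda>v. (- 1) * p v) \<in> polyfun scale" by (intro polyfun.mult polyfun.const) simp
    then show "\<exists>q\<in>carrier (polyring scale). q \<oplus>\<^bsub>polyring scale\<^esub> p = \<zero>\<^bsub>polyring scale\<^esub>"
      by (intro bexI[of _ "\<lambda>v. (- 1) * p v"]) auto
  qed (auto intro: polyfun.intros)
  show "Group.comm_monoid (polyring scale)"
    by (rule comm_monoidI) (auto intro: polyfun.intros)
qed (auto simp: algebra_simps)

text \<open>Passage from subsets of the pointwise function ring to the ring record: the operations
  coincide, and minimality of \<open>rspan\<close> puts I inside the ideal generated by the finite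
  set.\<close>

lemma noetherian_polyring:
  assumes "finite_dimensional_vector_space scale B"
  shows "noetherian_ring (polyring scale)"
proof -
  interpret A: cring "polyring scale" by (rule polyring_cring)
  show ?thesis
  proof (rule A.noetherian_ringI)
    fix I assume I: "ideal I (polyring scale)"
    interpret I: ideal I "polyring scale" by fact
    have I_in: "ideal_in (polyfun scale) I"
      using I.a_subset I.zero_closed I.a_closed I.I_l_closed
      unfolding ideal_in_def by (simp add: plus_fun_def times_fun_def zero_fun_def)
    then obtain X where X: "finite X" "X \<subseteq> I" "I \<subseteq> rspan (polyfun scale) X"
      using noetherian_polyfun[OF assms] by (auto simp: noetherian_def)
    have XA: "X \<subseteq> carrier (polyring scale)" using X I.a_subset by auto
    interpret J: ideal "Idl\<^bsub>polyring scale\<^esub> X" "polyring scale" by (rule A.genideal_ideal[OF XA])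
    have "ideal_in (polyfun scale) (Idl\<^bsub>polyring scale\<^esub> X)"
      using J.a_subset J.zero_closed J.a_closed J.I_l_closed
      unfolding ideal_in_def by (simp add: plus_fun_def times_fun_def zero_fun_def)
    from rspan_minimal[OF this A.genideal_self[OF XA]] have "I = Idl\<^bsub>polyring scale\<^esub> X"
      using X A.genideal_minimal[OF I X(2)] by blast
    then show "\<exists>X\<subseteq>carrier (polyring scale). finite X \<and> I = Idl\<^bsub>polyring scale\<^esub> X"
      using X XA by blast
  qed
qed

locale moment_graph_on =
  fixes scale :: "complex \<Rightarrow> 't::ab_group_add \<Rightarrow> 't" and G :: "('t, 'v, 'e) moment_graph"
  assumes moment_graph: "is_moment_graph scale G"
begin

abbreviation "A \<equiv> polyring scale"
abbreviation "E \<equiv> edge_ring scale G"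
abbreviation "pr \<equiv> edge_proj scale G"
abbreviation "S \<equiv> struct_ring scale G"

sublocale A: cring A by (rule polyring_cring)

lemma edge_ends:
  assumes "L \<in> edges G"
  obtains x y where "x \<in> vertices G" "y \<in> vertices G" "ends G L = {x, y}"
  using moment_graph assms unfolding is_moment_graph_def by blast

lemma ends_vertices: "L \<in> edges G \<Longrightarrow> x \<in> ends G L \<Longrightarrow> x \<in> vertices G"
  by (erule edge_ends) auto

lemma finite_graph_points: "finite (graph_points G)"
  using moment_graph by (auto simp: is_moment_graph_def graph_points_def)

lemma points_vertex: "Z \<subseteq> graph_points G \<Longrightarrow> Inl x \<in> Z \<Longrightarrow> x \<in> vertices G"
  and points_edge: "Z \<subseteq> graph_points G \<Longrightarrow> Inr L \<in> Z \<Longrightarrow> L \<in> edges G"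
  by (auto simp: graph_points_def)

lemma edge_ideal_ideal:
  assumes "L \<in> edges G"
  shows "ideal (edge_ideal scale G L) A"
  unfolding edge_ideal_def
proof (rule A.genideal_ideal)
  obtain \<phi> where "\<phi> \<in> dual scale" "direction G L = {(\<lambda>v. c * \<phi> v) | c. True}"
    using moment_graph assms unfolding is_moment_graph_def by blast
  then show "direction G L \<subseteq> carrier A" by (auto intro: polyfun.intros)
qed

lemma edge_ring_cring: "L \<in> edges G \<Longrightarrow> cring (E L)"
  unfolding edge_ring_def by (rule ideal.quotient_is_cring[OF edge_ideal_ideal A.cring_axioms])

lemma edge_proj_hom: "L \<in> edges G \<Longrightarrow> pr L \<in> ring_hom A (E L)"
  using ideal.rcos_ring_hom[OF edge_ideal_ideal]
  unfolding edge_ring_def edge_proj_def[abs_def] by simp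

lemma edge_proj_surj: "L \<in> edges G \<Longrightarrow> pr L ` carrier A = carrier (E L)"
  by (auto simp: edge_ring_def edge_proj_def[abs_def] FactRing_def A_RCOSETS_def' a_r_coset_def')

lemma struct_simps [simp]:
  "carrier (S Z) = sections G Z (\<lambda>_. carrier A) (\<lambda>L. carrier (E L)) (\<lambda>_. pr)"
  "a \<otimes>\<^bsub>S Z\<^esub> b = tuple_map2 Z (\<lambda>_. monoid.mult A) (\<lambda>L. monoid.mult (E L)) a b"
  "a \<oplus>\<^bsub>S Z\<^esub> b = tuple_map2 Z (\<lambda>_. ring.add A) (\<lambda>L. ring.add (E L)) a b"
  "\<one>\<^bsub>S Z\<^esub> = (\<lambda>x\<in>Inl -` Z. \<one>\<^bsub>A\<^esub>, \<lambda>L\<in>Inr -` Z. \<one>\<^bsub>E L\<^esub>)"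
  "\<zero>\<^bsub>S Z\<^esub> = (\<lambda>x\<in>Inl -` Z. \<zero>\<^bsub>A\<^esub>, \<lambda>L\<in>Inr -` Z. \<zero>\<^bsub>E L\<^esub>)"
  by (simp_all add: struct_ring_def)

end

text \<open>The section over the open point of an edge with value u. There are no vertices in this
  open set, so the vertex part is \<open>undefined\<close> everywhere, as extensionality over an
  empty index set demands.\<close>

definition edge_tuple :: "'e \<Rightarrow> 'n \<Rightarrow> ('v, 'e, 'm, 'n) tuple" where
  "edge_tuple L u = (\<lambda>x. undefined, \<lambda>L'\<in>{L}. u)"

lemma edge_tuple_apply [simp]: "snd (edge_tuple L u) L = u"
  by (simp add: edge_tuple_def)

lemma edge_tuple_mem_iff:
  "edge_tuple L u \<in> sections G {Inr L} C D \<rho> \<longleftrightarrow> u \<in> D L"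
  by (auto simp: edge_tuple_def sections_iff extensional_def)

context moment_graph_on
begin

lemma edge_proj_simps:
  assumes "L \<in> edges G"
  shows "p \<in> carrier A \<Longrightarrow> pr L p \<in> carrier (E L)"
    "p \<in> carrier A \<Longrightarrow> q \<in> carrier A \<Longrightarrow> pr L (p \<oplus>\<^bsub>A\<^esub> q) = pr L p \<oplus>\<^bsub>E L\<^esub> pr L q"
    "p \<in> carrier A \<Longrightarrow> q \<in> carrier A \<Longrightarrow> pr L (p \<otimes>\<^bsub>A\<^esub> q) = pr L p \<otimes>\<^bsub>E L\<^esub> pr L q"
    "pr L \<one>\<^bsub>A\<^esub> = \<one>\<^bsub>E L\<^esub>" "pr L \<zero>\<^bsub>A\<^esub> = \<zero>\<^bsub>E L\<^esub>"
  using edge_proj_hom[OF assms] edge_ring_cring[OF assms] A.ring_axioms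
  by (auto simp del: polyring_simps simp: ring_hom_closed ring_hom_add ring_hom_mult ring_hom_one ring_hom_zero cring.axioms(1))

lemma struct_ring_cring:
  assumes Z: "Z \<subseteq> graph_points G"
  shows "cring (S Z)"
proof -
  note eZ = points_edge[OF Z]
  note E = cring.cring_simprules[OF edge_ring_cring[OF eZ]]
  note AA = A.cring_simprules
  note PZ = edge_proj_simps[OF eZ]
  note [simp del] = polyring_simps
  have mult: "a \<otimes>\<^bsub>S Z\<^esub> b \<in> carrier (S Z)" if "a \<in> carrier (S Z)" "b \<in> carrier (S Z)" for a b
    using that unfolding struct_simps by (rule tuple_map2_sections) (auto intro: AA E simp: PZ)
  have add: "a \<oplus>\<^bsub>S Z\<^esub> b \<in> carrier (S Z)" if "a \<in> carrier (S Z)" "b \<in> carrier (S Z)" for a b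
    using that unfolding struct_simps by (rule tuple_map2_sections) (auto intro: AA E simp: PZ)
  have one: "\<one>\<^bsub>S Z\<^esub> \<in> carrier (S Z)"
    unfolding struct_simps restrict_sections_iff by (auto intro: AA E simp: PZ)
  have fs: "Inl x \<in> Z \<Longrightarrow> fst s x \<in> carrier A" "Inr L \<in> Z \<Longrightarrow> snd s L \<in> carrier (E L)"
    if "s \<in> carrier (S Z)" for x L s using that by (auto simp: sections_iff)
  have eqI: "a = b" if "a \<in> carrier (S Z)" "b \<in> carrier (S Z)"
    "\<And>x. Inl x \<in> Z \<Longrightarrow> fst a x = fst b x" "\<And>L. Inr L \<in> Z \<Longrightarrow> snd a L = snd b L" for a b
    using that unfolding struct_simps by (rule tuple_eqI)
  show ?thesis
  proof (rule cringI)
    show "abelian_group (S Z)"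
      by (rule abelian_group_sections[where P = "\<lambda>_. A" and Q = E and \<rho> = "\<lambda>_. pr" and Z = Z])
         (auto simp: struct_ring_def PZ intro: A.abelian_group_axioms cring.axioms(1) 
           ring.is_abelian_group edge_ring_cring eZ)
    show "Group.comm_monoid (S Z)"
    proof (rule comm_monoidI)
      fix a b c assume a: "a \<in> carrier (S Z)" and b: "b \<in> carrier (S Z)" and c: "c \<in> carrier (S Z)"
      show "a \<otimes>\<^bsub>S Z\<^esub> b \<otimes>\<^bsub>S Z\<^esub> c = a \<otimes>\<^bsub>S Z\<^esub> (b \<otimes>\<^bsub>S Z\<^esub> c)"
        by (rule eqI[OF mult[OF mult[OF a b] c] mult[OF a mult[OF b c]]])
           (simp_all add: AA E fs[OF a] fs[OF b] fs[OF c])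
    next
      fix a b assume a: "a \<in> carrier (S Z)" and b: "b \<in> carrier (S Z)"
      show "a \<otimes>\<^bsub>S Z\<^esub> b \<in> carrier (S Z)" by (rule mult[OF a b])
      show "a \<otimes>\<^bsub>S Z\<^esub> b = b \<otimes>\<^bsub>S Z\<^esub> a"
        by (rule eqI[OF mult[OF a b] mult[OF b a]]) (simp_all add: AA E fs[OF a] fs[OF b])
    next
      fix a assume a: "a \<in> carrier (S Z)"
      show "\<one>\<^bsub>S Z\<^esub> \<otimes>\<^bsub>S Z\<^esub> a = a"
        using monoid.l_one[OF ring.is_monoid[OF cring.axioms(1)[OF edge_ring_cring[OF eZ]]]]
        by (intro eqI[OF mult[OF one a] a]) (simp_all add: fs[OF a])
    qed (rule one)
    fix a b c assume a: "a \<in> carrier (S Z)" and b: "b \<in> carrier (S Z)" and c: "c \<in> carrier (S Z)"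
    show "(a \<oplus>\<^bsub>S Z\<^esub> b) \<otimes>\<^bsub>S Z\<^esub> c = a \<otimes>\<^bsub>S Z\<^esub> c \<oplus>\<^bsub>S Z\<^esub> b \<otimes>\<^bsub>S Z\<^esub> c"
      by (rule eqI[OF mult[OF add[OF a b] c] add[OF mult[OF a c] mult[OF b c]]])
         (simp_all add: AA E fs[OF a] fs[OF b] fs[OF c])
  qed
qed

text \<open>The canonical A-algebra structure on a ring of sections, sending a polynomial to the
  constant section. Over a star it is a bijection, with evaluation at the vertex as inverse.\<close>

definition diag :: "('v, 'e) pts \<Rightarrow> ('t \<Rightarrow> complex) \<Rightarrow> ('t, 'v, 'e) scalars" where
  "diag Z a = (\<lambda>x\<in>Inl -` Z. a, \<lambda>L\<in>Inr -` Z. pr L a)"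

lemma diag_apply [simp]:
  "Inl x \<in> Z \<Longrightarrow> fst (diag Z a) x = a" "Inr L \<in> Z \<Longrightarrow> snd (diag Z a) L = pr L a"
  by (simp_all add: diag_def)

lemma diag_carrier:
  assumes Z: "Z \<subseteq> graph_points G" and "a \<in> carrier A"
  shows "diag Z a \<in> carrier (S Z)"
  using assms(2) edge_proj_simps(1)[OF points_edge[OF Z]]
  unfolding struct_simps(1) diag_def restrict_sections_iff by blast

lemma diag_hom:
  assumes Z: "Z \<subseteq> graph_points G"
  shows "diag Z \<in> ring_hom A (S Z)"
proof (rule ring_hom_memI)
  interpret SZ: cring "S Z" by (rule struct_ring_cring[OF Z])
  note [simp del] = polyring_simps
  note PZ = edge_proj_simps[OF points_edge[OF Z]]
  have eqI: "a = b" if "a \<in> carrier (S Z)" "b \<in> carrier (S Z)"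
    "\<And>x. Inl x \<in> Z \<Longrightarrow> fst a x = fst b x" "\<And>L. Inr L \<in> Z \<Longrightarrow> snd a L = snd b L" for a b
    using that unfolding struct_simps by (rule tuple_eqI)
  fix a assume a: "a \<in> carrier A"
  show "diag Z a \<in> carrier (S Z)" by (rule diag_carrier[OF Z a])
  fix b assume b: "b \<in> carrier A"
  show "diag Z (a \<otimes>\<^bsub>A\<^esub> b) = diag Z a \<otimes>\<^bsub>S Z\<^esub> diag Z b"
    using a b by (intro eqI SZ.m_closed diag_carrier[OF Z] A.m_closed) (simp_all add: PZ)
  show "diag Z (a \<oplus>\<^bsub>A\<^esub> b) = diag Z a \<oplus>\<^bsub>S Z\<^esub> diag Z b"
    using a b by (intro eqI SZ.a_closed diag_carrier[OF Z] A.a_closed) (simp_all add: PZ)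
next
  show "diag Z \<one>\<^bsub>A\<^esub> = \<one>\<^bsub>S Z\<^esub>"
    unfolding diag_def struct_simps using edge_proj_simps(4)[OF points_edge[OF Z]] by (auto intro!: restrict_ext)
qed

lemma diag_deg: "diag Z ` polydeg scale i \<subseteq> struct_deg scale G Z i"
  unfolding struct_deg_def diag_def edge_deg_def by (auto simp: restrict_sections_iff)

lemma edge_tuple_hom:
  assumes L: "L \<in> edges G"
  shows "edge_tuple L \<in> ring_hom (E L) (S {Inr L})"
proof (rule ring_hom_memI)
  interpret EL: cring "E L" by (rule edge_ring_cring[OF L])
  fix a assume a: "a \<in> carrier (E L)"
  then show "edge_tuple L a \<in> carrier (S {Inr L})" by (simp add: edge_tuple_mem_iff)
  fix b assume b: "b \<in> carrier (E L)"
  show "edge_tuple L (a \<otimes>\<^bsub>E L\<^esub> b) = edge_tuple L a \<otimes>\<^bsub>S {Inr L}\<^esub> edge_tuple L b"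
    "edge_tuple L (a \<oplus>\<^bsub>E L\<^esub> b) = edge_tuple L a \<oplus>\<^bsub>S {Inr L}\<^esub> edge_tuple L b"
    unfolding struct_simps edge_tuple_def tuple_map2_def by (auto simp: restrict_def fun_eq_iff)
qed (auto simp: edge_tuple_def restrict_def fun_eq_iff)

lemma edge_tuple_deg: "edge_tuple L ` edge_deg scale G L i \<subseteq> struct_deg scale G {Inr L} i"
  unfolding struct_deg_def by (auto simp: edge_tuple_mem_iff)

end

section \<open>Modules of sections of a Gamma-sheaf\<close>

lemma section_module_simps [simp]:
  "carrier (section_module G M Z) = sections G Z (\<lambda>x. carrier (vmod M x)) (\<lambda>L. carrier (emod M L)) (rho M)"
  "s \<oplus>\<^bsub>section_module G M Z\<^esub> t = tuple_map2 Z (\<lambda>x. ring.add (vmod M x)) (\<lambda>L. ring.add (emod M L)) s t"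
  "\<zero>\<^bsub>section_module G M Z\<^esub> = (\<lambda>x\<in>Inl -` Z. \<zero>\<^bsub>vmod M x\<^esub>, \<lambda>L\<in>Inr -` Z. \<zero>\<^bsub>emod M L\<^esub>)"
  "a \<odot>\<^bsub>section_module G M Z\<^esub> s =
     tuple_map2 Z (\<lambda>x. module.smult (vmod M x)) (\<lambda>L. module.smult (emod M L)) a s"
  by (simp_all add: section_module_def)

locale gamma_sheaf_on = moment_graph_on scale G
  for scale :: "complex \<Rightarrow> 't::ab_group_add \<Rightarrow> 't" and G :: "('t, 'v, 'e) moment_graph" +
  fixes M :: "('t, 'v, 'e, 'm, 'n) gamma_sheaf"
  assumes gamma_sheaf: "is_gamma_sheaf scale G M"
begin

abbreviation "\<Gamma> \<equiv> section_module G M"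
abbreviation "\<Gamma>d Z d \<equiv> sections G Z (\<lambda>x. vdeg M x d) (\<lambda>L. edeg M L d) (rho M)"

lemma vmod_graded: "x \<in> vertices G \<Longrightarrow> graded A (vmod M x) (polydeg scale) (vdeg M x)"
  and emod_graded: "L \<in> edges G \<Longrightarrow> graded (E L) (emod M L) (edge_deg scale G L) (edeg M L)"
  and vmod_fg: "x \<in> vertices G \<Longrightarrow> finitely_generated A (vmod M x)"
  and emod_fg: "L \<in> edges G \<Longrightarrow> finitely_generated (E L) (emod M L)"
  and rho_graded_hom: "L \<in> edges G \<Longrightarrow> x \<in> ends G L \<Longrightarrow>
    graded_hom A (pr L) (vmod M x) (vdeg M x) (emod M L) (edeg M L) (rho M x L)"
  using gamma_sheaf by (auto simp: is_gamma_sheaf_def intro: gradedI)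

lemma vmod_module: "x \<in> vertices G \<Longrightarrow> Module.module A (vmod M x)"
  using vmod_graded by (simp add: graded_def)

lemma emod_module: "L \<in> edges G \<Longrightarrow> Module.module (E L) (emod M L)"
  using emod_graded by (simp add: graded_def)

lemma rho_simps:
  assumes "L \<in> edges G" "x \<in> ends G L"
  shows "m \<in> carrier (vmod M x) \<Longrightarrow> rho M x L m \<in> carrier (emod M L)"
    "m \<in> carrier (vmod M x) \<Longrightarrow> n \<in> carrier (vmod M x) \<Longrightarrow>
      rho M x L (m \<oplus>\<^bsub>vmod M x\<^esub> n) = rho M x L m \<oplus>\<^bsub>emod M L\<^esub> rho M x L n"
    "a \<in> carrier A \<Longrightarrow> m \<in> carrier (vmod M x) \<Longrightarrow>
      rho M x L (a \<odot>\<^bsub>vmod M x\<^esub> m) = pr L a \<odot>\<^bsub>emod M L\<^esub> rho M x L m"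
    "m \<in> vdeg M x d \<Longrightarrow> rho M x L m \<in> edeg M L d"
  using rho_graded_hom[OF assms] by (auto simp: graded_hom_def image_subset_iff)

lemma vmod_abelian: "x \<in> vertices G \<Longrightarrow> abelian_group (vmod M x)"
  and emod_abelian: "L \<in> edges G \<Longrightarrow> abelian_group (emod M L)"
  using vmod_module emod_module by (auto intro: Module.module.axioms)

lemma section_module_module:
  assumes Z: "Z \<subseteq> graph_points G"
  shows "Module.module (S Z) (\<Gamma> Z)"
proof (rule Module.moduleI[OF struct_ring_cring[OF Z]])
  note [simp del] = polyring_simps
  note eZ = points_edge[OF Z] and vZ = points_vertex[OF Z]
  note R = rho_simps[OF eZ]
  note V = Module.module.smult_closed[OF vmod_module[OF vZ]] Module.module.smult_closed[OF emod_module[OF eZ]]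
    Module.module.smult_l_distr[OF vmod_module[OF vZ]] Module.module.smult_l_distr[OF emod_module[OF eZ]]
    Module.module.smult_r_distr[OF vmod_module[OF vZ]] Module.module.smult_r_distr[OF emod_module[OF eZ]]
    Module.module.smult_assoc1[OF vmod_module[OF vZ]] Module.module.smult_assoc1[OF emod_module[OF eZ]]
    Module.module.smult_one[OF vmod_module[OF vZ]] Module.module.smult_one[OF emod_module[OF eZ]]
  show ab: "abelian_group (\<Gamma> Z)"
    by (rule abelian_group_sections[where P = "vmod M" and Q = "emod M" and \<rho> = "rho M" and Z = Z])
       (auto simp: section_module_def R intro: vmod_abelian emod_abelian eZ vZ)
  interpret \<Gamma>Z: abelian_group "\<Gamma> Z" by (rule ab)
  interpret SZ: cring "S Z" by (rule struct_ring_cring[OF Z])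
  have smult: "a \<odot>\<^bsub>\<Gamma> Z\<^esub> s \<in> carrier (\<Gamma> Z)" if "a \<in> carrier (S Z)" "s \<in> carrier (\<Gamma> Z)" for a s
    using that unfolding struct_simps section_module_simps
    by (rule tuple_map2_sections) (auto intro: V simp: R)
  have fs: "Inl x \<in> Z \<Longrightarrow> fst s x \<in> carrier (vmod M x)" "Inr L \<in> Z \<Longrightarrow> snd s L \<in> carrier (emod M L)"
    if "s \<in> carrier (\<Gamma> Z)" for x L s using that by (auto simp: sections_iff)
  have fa: "Inl x \<in> Z \<Longrightarrow> fst s x \<in> carrier A" "Inr L \<in> Z \<Longrightarrow> snd s L \<in> carrier (E L)"
    if "s \<in> carrier (S Z)" for x L s using that by (auto simp: sections_iff)
  have eqI: "a = b" if "a \<in> carrier (\<Gamma> Z)" "b \<in> carrier (\<Gamma> Z)"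
    "\<And>x. Inl x \<in> Z \<Longrightarrow> fst a x = fst b x" "\<And>L. Inr L \<in> Z \<Longrightarrow> snd a L = snd b L" for a b
    using that unfolding section_module_simps by (rule tuple_eqI)
  fix a s assume a: "a \<in> carrier (S Z)" and s: "s \<in> carrier (\<Gamma> Z)"
  show "a \<odot>\<^bsub>\<Gamma> Z\<^esub> s \<in> carrier (\<Gamma> Z)" by (rule smult[OF a s])
  show "a \<odot>\<^bsub>\<Gamma> Z\<^esub> (s \<oplus>\<^bsub>\<Gamma> Z\<^esub> t) = a \<odot>\<^bsub>\<Gamma> Z\<^esub> s \<oplus>\<^bsub>\<Gamma> Z\<^esub> a \<odot>\<^bsub>\<Gamma> Z\<^esub> t" if t: "t \<in> carrier (\<Gamma> Z)" for t
    by (rule eqI[OF smult[OF a \<Gamma>Z.a_closed[OF s t]] \<Gamma>Z.a_closed[OF smult[OF a s] smult[OF a t]]])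
       (auto intro: V fs[OF s] fs[OF t] fa[OF a])
  fix b assume b: "b \<in> carrier (S Z)"
  show "(a \<oplus>\<^bsub>S Z\<^esub> b) \<odot>\<^bsub>\<Gamma> Z\<^esub> s = a \<odot>\<^bsub>\<Gamma> Z\<^esub> s \<oplus>\<^bsub>\<Gamma> Z\<^esub> b \<odot>\<^bsub>\<Gamma> Z\<^esub> s"
    by (rule eqI[OF smult[OF SZ.a_closed[OF a b] s] \<Gamma>Z.a_closed[OF smult[OF a s] smult[OF b s]]])
       (auto intro: V fs[OF s] fa[OF a] fa[OF b])
  show "a \<otimes>\<^bsub>S Z\<^esub> b \<odot>\<^bsub>\<Gamma> Z\<^esub> s = a \<odot>\<^bsub>\<Gamma> Z\<^esub> (b \<odot>\<^bsub>\<Gamma> Z\<^esub> s)"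
    by (rule eqI[OF smult[OF SZ.m_closed[OF a b] s] smult[OF a smult[OF b s]]])
       (auto intro: V fs[OF s] fa[OF a] fa[OF b])
next
  note [simp del] = polyring_simps
  interpret SZ: cring "S Z" by (rule struct_ring_cring[OF Z])
  fix s assume s: "s \<in> carrier (\<Gamma> Z)"
  \<comment> \<open>The unit tuple is taken as a section of the singleton families consisting of the
    units, so closure and equality reduce to multiplication by a unit at each point.\<close>
  show "\<one>\<^bsub>S Z\<^esub> \<odot>\<^bsub>\<Gamma> Z\<^esub> s = s"
    using s Module.module.smult_one[OF vmod_module[OF points_vertex[OF Z]]]
      Module.module.smult_one[OF emod_module[OF points_edge[OF Z]]]
    unfolding section_module_simps struct_simps
    by (intro tuple_eqI[OF tuple_map2_sections[where ?\<rho>1.0 = "\<lambda>_. pr" and ?C1.0 = "\<lambda>_. {\<one>\<^bsub>A\<^esub>}" and ?D1.0 = "\<lambda>L. {\<one>\<^bsub>E L\<^esub>}"]]) 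
      (auto simp: sections_iff edge_proj_simps[OF points_edge[OF Z]])
qed

end

lemma additive_a_inv:
  assumes M: "abelian_group M" and N: "abelian_group N" and h: "h \<in> carrier M \<rightarrow> carrier N"
    and h_add: "\<And>x y. x \<in> carrier M \<Longrightarrow> y \<in> carrier M \<Longrightarrow> h (x \<oplus>\<^bsub>M\<^esub> y) = h x \<oplus>\<^bsub>N\<^esub> h y"
    and m: "m \<in> carrier M"
  shows "h (\<ominus>\<^bsub>M\<^esub> m) = \<ominus>\<^bsub>N\<^esub> h m"
proof -
  have inv: "\<ominus>\<^bsub>M\<^esub> m \<in> carrier M" by (rule abelian_group.a_inv_closed[OF M m])
  have "h (\<ominus>\<^bsub>M\<^esub> m) \<oplus>\<^bsub>N\<^esub> h m = \<zero>\<^bsub>N\<^esub>"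
    using h_add[OF inv m] abelian_group.l_neg[OF M m] additive_zero[OF M N h h_add] by simp
  from abelian_group.minus_equality[OF N this] show ?thesis
    using funcset_mem[OF h inv] funcset_mem[OF h m] by simp
qed

text \<open>Over a Noetherian ring the image in a finitely generated module is finitely generated,
  so only the kernel is left. The assumption on the kernel is conditional on its being a submodule
  because an induction hypothesis about submodules is to be supplied there.\<close>

lemma fg_set_kernel:
  assumes R: "noetherian_ring R" and M: "Module.module R M" and N: "Module.module R N"
    and fg: "finitely_generated R N" and W: "submodule W R M" and h: "h \<in> W \<rightarrow> carrier N"
    and h_add: "\<And>x y. x \<in> W \<Longrightarrow> y \<in> W \<Longrightarrow> h (x \<oplus>\<^bsub>M\<^esub> y) = h x \<oplus>\<^bsub>N\<^esub> h y"
    and h_smult: "\<And>a x. a \<in> carrier R \<Longrightarrow> x \<in> W \<Longrightarrow> h (a \<odot>\<^bsub>M\<^esub> x) = a \<odot>\<^bsub>N\<^esub> h x"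
    and ker: "submodule {w \<in> W. h w = \<zero>\<^bsub>N\<^esub>} R M \<Longrightarrow> fg_set R M {w \<in> W. h w = \<zero>\<^bsub>N\<^esub>}"
  shows "fg_set R M W"
proof (rule fg_set_kernel_image[OF M N W h h_add h_smult])
  interpret M: Module.module R M by fact
  interpret N: Module.module R N by fact
  note W0 = M.submodule_zero_closed[OF W] and WE = M.submoduleE(1,4,5)[OF W]
  have h0: "h \<zero>\<^bsub>M\<^esub> = \<zero>\<^bsub>N\<^esub>"
    using h_smult[of "\<zero>\<^bsub>R\<^esub>" "\<zero>\<^bsub>M\<^esub>"] W0 h by (auto simp: Pi_iff)
  have "submodule (h ` W) R N"
  proof (rule N.submoduleI')
    show "h ` W \<subseteq> carrier N" using h by auto
    show "\<zero>\<^bsub>N\<^esub> \<in> h ` W" using h0 W0 by (metis imageI)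
    fix x y assume "x \<in> h ` W" "y \<in> h ` W"
    then obtain u v where "u \<in> W" "v \<in> W" "x = h u" "y = h v" by blast
    then show "x \<oplus>\<^bsub>N\<^esub> y \<in> h ` W" using WE(3)[of u v] by (metis h_add imageI)
  next
    fix a x assume a: "a \<in> carrier R" and "x \<in> h ` W"
    then obtain u where "u \<in> W" "x = h u" by blast
    then show "a \<odot>\<^bsub>N\<^esub> x \<in> h ` W" using WE(2)[OF a, of u] a by (metis h_smult imageI)
  qed
  moreover obtain X where "finite X" "X \<subseteq> carrier N" "carrier N \<subseteq> lspan R N X"
    using fg unfolding finitely_generated_iff[OF N] fg_set_def by blast
  ultimately show "fg_set R N (h ` W)"
    using h by (intro N.fg_submodule[OF R]) auto
  have "submodule {w \<in> W. h w = \<zero>\<^bsub>N\<^esub>} R M"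
    by (rule M.submoduleI') (use WE W0 h0 in \<open>auto simp: h_add h_smult\<close>)
  then show "fg_set R M {w \<in> W. h w = \<zero>\<^bsub>N\<^esub>}" by (rule ker)
qed

section \<open>Open sets, stars and least neighbourhoods\<close>

context moment_graph_on
begin

lemma open_points: "openin (graph_top G) U \<Longrightarrow> U \<subseteq> graph_points G"
  by (simp add: openin_graph_top)

lemma open_edge: "openin (graph_top G) U \<Longrightarrow> Inl x \<in> U \<Longrightarrow> L \<in> edges G \<Longrightarrow> x \<in> ends G L \<Longrightarrow> Inr L \<in> U"
  using ends_vertices by (auto simp: openin_graph_top)

definition star :: "'v \<Rightarrow> ('v, 'e) pts" where
  "star x = insert (Inl x) (Inr ` {L \<in> edges G. x \<in> ends G L})"

lemma star_simps [simp]: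
  "Inl y \<in> star x \<longleftrightarrow> y = x" "Inr L \<in> star x \<longleftrightarrow> L \<in> edges G \<and> x \<in> ends G L"
  by (auto simp: star_def)

lemma open_star: "x \<in> vertices G \<Longrightarrow> openin (graph_top G) (star x)"
  by (auto simp: openin_graph_top graph_points_def star_def)

lemma open_edge_point: "L \<in> edges G \<Longrightarrow> openin (graph_top G) {Inr L}"
  by (auto simp: openin_graph_top graph_points_def)

lemma star_subset: "openin (graph_top G) U \<Longrightarrow> Inl x \<in> U \<Longrightarrow> star x \<subseteq> U"
  using open_edge by (auto simp: star_def)

lemma least_nbhd_vertex: "x \<in> vertices G \<Longrightarrow> least_nbhd G (Inl x) = star x"
  unfolding least_nbhd_def
  by (intro subset_antisym Inter_lower Inter_greatest) (auto simp: open_star star_subset[THEN subsetD])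

lemma least_nbhd_edge: "L \<in> edges G \<Longrightarrow> least_nbhd G (Inr L) = {Inr L}"
  using open_edge_point unfolding least_nbhd_def by auto

lemma tuple_restrict_apply [simp]:
  "Inl x \<in> W \<Longrightarrow> fst (tuple_restrict W s) x = fst s x"
  "Inr L \<in> W \<Longrightarrow> snd (tuple_restrict W s) L = snd s L"
  by (simp_all add: tuple_restrict_def)

end

section \<open>The grading on modules of sections\<close>

context gamma_sheaf_on
begin

lemma section_eqI:
  assumes "s \<in> carrier (\<Gamma> Z)" "t \<in> carrier (\<Gamma> Z)"
    and "\<And>x. Inl x \<in> Z \<Longrightarrow> fst s x = fst t x" "\<And>L. Inr L \<in> Z \<Longrightarrow> snd s L = snd t L"
  shows "s = t"
  using assms unfolding section_module_simps by (rule tuple_eqI)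

lemma section_apply:
  assumes "s \<in> carrier (\<Gamma> Z)"
  shows "Inl x \<in> Z \<Longrightarrow> fst s x \<in> carrier (vmod M x)" "Inr L \<in> Z \<Longrightarrow> snd s L \<in> carrier (emod M L)"
    "Inl x \<in> Z \<Longrightarrow> Inr L \<in> Z \<Longrightarrow> x \<in> ends G L \<Longrightarrow> snd s L = rho M x L (fst s x)"
  using assms by (auto simp: sections_iff)

lemma section_abelian: "Z \<subseteq> graph_points G \<Longrightarrow> abelian_group (\<Gamma> Z)"
  using section_module_module by (auto intro: Module.module.axioms)

text \<open>Evaluation at a point is additive, hence commutes with negation and sums. Both
  operations of the module of sections are defined abstractly, so their values at a point are not
  visible from the record.\<close>

lemma
  assumes Z: "Z \<subseteq> graph_points G"
  shows section_a_inv_fst: "s \<in> carrier (\<Gamma> Z) \<Longrightarrow> Inl x \<in> Z \<Longrightarrow> fst (\<ominus>\<^bsub>\<Gamma> Z\<^esub> s) x = \<ominus>\<^bsub>vmod M x\<^esub> fst s x"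
    and section_finsum_fst: "f \<in> I \<rightarrow> carrier (\<Gamma> Z) \<Longrightarrow> Inl x \<in> Z \<Longrightarrow>
      fst (finsum (\<Gamma> Z) f I) x = finsum (vmod M x) (\<lambda>i. fst (f i) x) I"
    and section_a_inv_snd: "s \<in> carrier (\<Gamma> Z) \<Longrightarrow> Inr L \<in> Z \<Longrightarrow> snd (\<ominus>\<^bsub>\<Gamma> Z\<^esub> s) L = \<ominus>\<^bsub>emod M L\<^esub> snd s L"
    and section_finsum_snd: "f \<in> I \<rightarrow> carrier (\<Gamma> Z) \<Longrightarrow> Inr L \<in> Z \<Longrightarrow>
      snd (finsum (\<Gamma> Z) f I) L = finsum (emod M L) (\<lambda>i. snd (f i) L) I"
proof -
  note ab = section_abelian[OF Z] and vab = vmod_abelian[OF points_vertex[OF Z]]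
    and eab = emod_abelian[OF points_edge[OF Z]]
  show "fst (\<ominus>\<^bsub>\<Gamma> Z\<^esub> s) x = \<ominus>\<^bsub>vmod M x\<^esub> fst s x" if "s \<in> carrier (\<Gamma> Z)" "Inl x \<in> Z"
    by (rule additive_a_inv[OF ab vab, where h = "\<lambda>s. fst s x"])
       (use that in \<open>auto simp: sections_iff\<close>)
  show "fst (finsum (\<Gamma> Z) f I) x = finsum (vmod M x) (\<lambda>i. fst (f i) x) I"
    if "f \<in> I \<rightarrow> carrier (\<Gamma> Z)" "Inl x \<in> Z"
    by (rule additive_finsum[OF ab vab, where h = "\<lambda>s. fst s x", OF that(2) _ _ that(1)])
       (use that in \<open>auto simp: sections_iff\<close>)
  show "snd (\<ominus>\<^bsub>\<Gamma> Z\<^esub> s) L = \<ominus>\<^bsub>emod M L\<^esub> snd s L" if "s \<in> carrier (\<Gamma> Z)" "Inr L \<in> Z"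
    by (rule additive_a_inv[OF ab eab, where h = "\<lambda>s. snd s L"])
       (use that in \<open>auto simp: sections_iff\<close>)
  show "snd (finsum (\<Gamma> Z) f I) L = finsum (emod M L) (\<lambda>i. snd (f i) L) I"
    if "f \<in> I \<rightarrow> carrier (\<Gamma> Z)" "Inr L \<in> Z"
    by (rule additive_finsum[OF ab eab, where h = "\<lambda>s. snd s L", OF that(2) _ _ that(1)])
       (use that in \<open>auto simp: sections_iff\<close>)
qed

lemma homog_section_carrier: "Z \<subseteq> graph_points G \<Longrightarrow> s \<in> \<Gamma>d Z d \<Longrightarrow> s \<in> carrier (\<Gamma> Z)"
  using graded.homog_carrier[OF vmod_graded[OF points_vertex]] graded.homog_carrier[OF emod_graded[OF points_edge]]
  unfolding section_module_simps sections_iff by blast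

text \<open>Components are taken at each point. They fit together because the maps
  \<open>rho\<close> preserve degrees and therefore commute with taking components; only finitely
  many are nonzero because the graph is finite. Uniqueness is uniqueness at each point.\<close>

lemma section_graded_module:
  assumes Z: "Z \<subseteq> graph_points G"
  shows "graded_module (S Z) (struct_deg scale G Z) (\<Gamma> Z) (\<Gamma>d Z)"
proof -
  note vg = vmod_graded[OF points_vertex[OF Z]] and eg = emod_graded[OF points_edge[OF Z]]
  note R = rho_simps[OF points_edge[OF Z]]
  note homC = homog_section_carrier[OF Z]
  interpret \<Gamma>Z: Module.module "S Z" "\<Gamma> Z" by (rule section_module_module[OF Z])
  define c where "c s d = (\<lambda>x\<in>Inl -` Z. hcomp (vmod M x) (vdeg M x) (fst s x) d,
    \<lambda>L\<in>Inr -` Z. hcomp (emod M L) (edeg M L) (snd s L) d)" for s d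
  have c_apply: "Inl x \<in> Z \<Longrightarrow> fst (c s d) x = hcomp (vmod M x) (vdeg M x) (fst s x) d"
    "Inr L \<in> Z \<Longrightarrow> snd (c s d) L = hcomp (emod M L) (edeg M L) (snd s L) d" for s d x L
    by (simp_all add: c_def)
  have c_hom: "c s d \<in> \<Gamma>d Z d" if s: "s \<in> carrier (\<Gamma> Z)" for s d
    unfolding c_def restrict_sections_iff
  proof (intro conjI allI impI)
    fix x assume x: "Inl x \<in> Z"
    show "hcomp (vmod M x) (vdeg M x) (fst s x) d \<in> vdeg M x d"
      by (rule graded.hcomp_homog[OF vg[OF x] section_apply(1)[OF s x]])
    fix L assume L: "Inr L \<in> Z" "x \<in> ends G L"
    show "rho M x L (hcomp (vmod M x) (vdeg M x) (fst s x) d) = hcomp (emod M L) (edeg M L) (snd s L) d"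
      using graded_hom_hcomp[OF vg[OF x] eg[OF L(1)] rho_graded_hom[OF points_edge[OF Z L(1)] L(2)] section_apply(1)[OF s x]]
      by (simp add: section_apply(3)[OF s x L])
  next
    fix L assume L: "Inr L \<in> Z"
    show "hcomp (emod M L) (edeg M L) (snd s L) d \<in> edeg M L d"
      by (rule graded.hcomp_homog[OF eg[OF L] section_apply(2)[OF s L]])
  qed
  note cC = homC[OF c_hom]
  show ?thesis
  proof (rule graded_moduleI[where c = c, OF \<Gamma>Z.module_axioms])
    fix d
    show "additive_subgroup (\<Gamma>d Z d) (\<Gamma> Z)"
    proof (rule \<Gamma>Z.additive_subgroupI')
      show "\<Gamma>d Z d \<subseteq> carrier (\<Gamma> Z)" using homC by blast
      show "\<zero>\<^bsub>\<Gamma> Z\<^esub> \<in> \<Gamma>d Z d"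
        using \<Gamma>Z.zero_closed unfolding section_module_simps restrict_sections_iff
        by (auto intro: graded.homog_zero vg eg)
      show "s \<oplus>\<^bsub>\<Gamma> Z\<^esub> t \<in> \<Gamma>d Z d" if "s \<in> \<Gamma>d Z d" "t \<in> \<Gamma>d Z d" for s t
        using that unfolding section_module_simps
        by (rule tuple_map2_sections)
           (auto intro: graded.homog_add vg eg simp: R graded.homog_carrier[OF vg])
      show "\<ominus>\<^bsub>\<Gamma> Z\<^esub> s \<in> \<Gamma>d Z d" if s: "s \<in> \<Gamma>d Z d" for s
        using s \<Gamma>Z.a_inv_closed[OF homC[OF s]] section_a_inv_fst[OF Z homC[OF s]] section_a_inv_snd[OF Z homC[OF s]]
        by (auto simp: sections_iff intro: graded.homog_a_inv vg eg)
    qed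
    show "a \<odot>\<^bsub>\<Gamma> Z\<^esub> s \<in> \<Gamma>d Z (int i + d)" if "a \<in> struct_deg scale G Z i" "s \<in> \<Gamma>d Z d" for i a s
      using that unfolding section_module_simps struct_deg_def
      by (rule tuple_map2_sections)
         (auto intro: graded.homog_smult vg eg simp: R graded.homog_carrier[OF vg] polydeg_def)
  next
    fix s assume s: "s \<in> carrier (\<Gamma> Z)"
    show "c s d \<in> \<Gamma>d Z d" for d by (rule c_hom[OF s])
    let ?T = "(\<Union>x\<in>Inl -` Z. {d. hcomp (vmod M x) (vdeg M x) (fst s x) d \<noteq> \<zero>\<^bsub>vmod M x\<^esub>}) \<union>
      (\<Union>L\<in>Inr -` Z. {d. hcomp (emod M L) (edeg M L) (snd s L) d \<noteq> \<zero>\<^bsub>emod M L\<^esub>})"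
    have "finite Z" using finite_subset[OF Z finite_graph_points] .
    then have "finite ?T"
      using graded.hcomp_finite[OF vg section_apply(1)[OF s]] graded.hcomp_finite[OF eg section_apply(2)[OF s]]
      by (intro finite_UnI finite_UN_I finite_vimageI) auto
    moreover have "{d. c s d \<noteq> \<zero>\<^bsub>\<Gamma> Z\<^esub>} \<subseteq> ?T"
    proof
      fix d assume "d \<in> {d. c s d \<noteq> \<zero>\<^bsub>\<Gamma> Z\<^esub>}"
      then have "c s d \<noteq> \<zero>\<^bsub>\<Gamma> Z\<^esub>" by simp
      then show "d \<in> ?T"
        using section_eqI[OF cC[OF s] \<Gamma>Z.zero_closed, of d] by (auto simp: c_apply)
    qed
    ultimately show fin: "finite {d. c s d \<noteq> \<zero>\<^bsub>\<Gamma> Z\<^esub>}" by (rule rev_finite_subset)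
    let ?D = "{d. c s d \<noteq> \<zero>\<^bsub>\<Gamma> Z\<^esub>}"
    have sum: "(\<lambda>d. c s d) \<in> ?D \<rightarrow> carrier (\<Gamma> Z)" using cC[OF s] by blast
    have c0: "fst (c s d) x = \<zero>\<^bsub>vmod M x\<^esub>" if "d \<notin> ?D" "Inl x \<in> Z" for d x
      using that by simp
    have c0': "snd (c s d) L = \<zero>\<^bsub>emod M L\<^esub>" if "d \<notin> ?D" "Inr L \<in> Z" for d L
      using that by simp
    \<comment> \<open>The supports at the individual points differ, but \<open>?D\<close> contains
      all of them, and \<open>hcomp_sum'\<close> permits a larger index set.\<close>
    show "s = (\<Oplus>\<^bsub>\<Gamma> Z\<^esub> d\<in>?D. c s d)"
    proof (rule section_eqI[OF s \<Gamma>Z.finsum_closed[OF sum]])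
      fix x assume x: "Inl x \<in> Z"
      have "fst s x = (\<Oplus>\<^bsub>vmod M x\<^esub> d\<in>?D. hcomp (vmod M x) (vdeg M x) (fst s x) d)"
        using c0[OF _ x, unfolded c_apply(1)[OF x]]
        by (intro graded.hcomp_sum'[OF vg[OF x], symmetric] section_apply[OF s] x fin) blast
      then show "fst s x = fst (\<Oplus>\<^bsub>\<Gamma> Z\<^esub> d\<in>?D. c s d) x"
        unfolding section_finsum_fst[OF Z sum x] c_apply(1)[OF x] .
    next
      fix L assume L: "Inr L \<in> Z"
      have "snd s L = (\<Oplus>\<^bsub>emod M L\<^esub> d\<in>?D. hcomp (emod M L) (edeg M L) (snd s L) d)"
        using c0'[OF _ L, unfolded c_apply(2)[OF L]]
        by (intro graded.hcomp_sum'[OF eg[OF L], symmetric] section_apply[OF s] L fin) blast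
      then show "snd s L = snd (\<Oplus>\<^bsub>\<Gamma> Z\<^esub> d\<in>?D. c s d) L"
        unfolding section_finsum_snd[OF Z sum L] c_apply(2)[OF L] .
    qed
    fix f assume f: "\<And>d. f d \<in> \<Gamma>d Z d" and finf: "finite {d. f d \<noteq> \<zero>\<^bsub>\<Gamma> Z\<^esub>}"
      and sumf: "s = (\<Oplus>\<^bsub>\<Gamma> Z\<^esub> d\<in>{d. f d \<noteq> \<zero>\<^bsub>\<Gamma> Z\<^esub>}. f d)"
    let ?F = "{d. f d \<noteq> \<zero>\<^bsub>\<Gamma> Z\<^esub>}"
    have fC: "f \<in> ?F \<rightarrow> carrier (\<Gamma> Z)" using homC[OF f] by blast
    have v: "hcomp (vmod M x) (vdeg M x) (fst s x) = (\<lambda>d. fst (f d) x)" if x: "Inl x \<in> Z" for x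
    proof (rule graded.hcomp_unique[OF vg[OF x] _ finf])
      show "fst (f d) x \<in> vdeg M x d" for d using f x by (auto simp: sections_iff)
      show "fst (f d) x = \<zero>\<^bsub>vmod M x\<^esub>" if "d \<notin> ?F" for d using that x by simp
      show "fst s x = (\<Oplus>\<^bsub>vmod M x\<^esub> d\<in>?F. fst (f d) x)"
        using arg_cong[OF sumf, of "\<lambda>s. fst s x"] section_finsum_fst[OF Z fC x] by (rule trans)
    qed
    have e: "hcomp (emod M L) (edeg M L) (snd s L) = (\<lambda>d. snd (f d) L)" if L: "Inr L \<in> Z" for L
    proof (rule graded.hcomp_unique[OF eg[OF L] _ finf])
      show "snd (f d) L \<in> edeg M L d" for d using f L by (auto simp: sections_iff)
      show "snd (f d) L = \<zero>\<^bsub>emod M L\<^esub>" if "d \<notin> ?F" for d using that L by simp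
      show "snd s L = (\<Oplus>\<^bsub>emod M L\<^esub> d\<in>?F. snd (f d) L)"
        using arg_cong[OF sumf, of "\<lambda>s. snd s L"] section_finsum_snd[OF Z fC L] by (rule trans)
    qed
    show "f = c s"
    proof
      fix d show "f d = c s d"
        by (rule section_eqI[OF homC[OF f] cC[OF s]]) (simp_all add: c_apply v e)
    qed
  qed
qed

end

section \<open>The sheaf of sections\<close>

context gamma_sheaf_on
begin

text \<open>The inverse of evaluation at x on sections over the star of x: compatibility forces the
  value on each adjacent edge.\<close>

definition vertex_section :: "'v \<Rightarrow> 'm \<Rightarrow> ('v, 'e, 'm, 'n) tuple" where
  "vertex_section x m = (\<lambda>y\<in>Inl -` star x. m, \<lambda>L\<in>Inr -` star x. rho M x L m)"

lemma vertex_section_apply [simp]: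
  "fst (vertex_section x m) x = m"
  "L \<in> edges G \<Longrightarrow> x \<in> ends G L \<Longrightarrow> snd (vertex_section x m) L = rho M x L m"
  by (simp_all add: vertex_section_def)

lemma vertex_section_carrier: "m \<in> carrier (vmod M x) \<Longrightarrow> vertex_section x m \<in> carrier (\<Gamma> (star x))"
  unfolding section_module_simps vertex_section_def restrict_sections_iff using rho_simps(1) by simp

lemma vertex_section_homog: "m \<in> vdeg M x d \<Longrightarrow> vertex_section x m \<in> \<Gamma>d (star x) d"
  unfolding vertex_section_def restrict_sections_iff using rho_simps(4) by simp

lemma vertex_section_fst:
  assumes "s \<in> carrier (\<Gamma> (star x))"
  shows "vertex_section x (fst s x) = s"
proof (rule section_eqI[OF vertex_section_carrier assms])
  show "fst s x \<in> carrier (vmod M x)" using section_apply(1)[OF assms] by simp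
  show "snd (vertex_section x (fst s x)) L = snd s L" if "Inr L \<in> star x" for L
    using that section_apply(3)[OF assms, of x L] by simp
qed simp

lemma star_points: "x \<in> vertices G \<Longrightarrow> star x \<subseteq> graph_points G"
  by (rule open_points[OF open_star])

lemma edge_points: "L \<in> edges G \<Longrightarrow> {Inr L} \<subseteq> graph_points G"
  by (rule open_points[OF open_edge_point])

lemma vertex_section_add:
  assumes x: "x \<in> vertices G" and "m \<in> carrier (vmod M x)" "n \<in> carrier (vmod M x)"
  shows "vertex_section x (m \<oplus>\<^bsub>vmod M x\<^esub> n) = vertex_section x m \<oplus>\<^bsub>\<Gamma> (star x)\<^esub> vertex_section x n"
proof -
  interpret V: Module.module A "vmod M x" by (rule vmod_module[OF x])
  interpret V': Module.module "S (star x)" "\<Gamma> (star x)" by (rule section_module_module[OF star_points[OF x]])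
  show ?thesis
    using assms(2,3)
    by (intro section_eqI[OF vertex_section_carrier V'.a_closed[OF vertex_section_carrier vertex_section_carrier]])
       (simp_all add: rho_simps)
qed

lemma vertex_section_smult:
  assumes x: "x \<in> vertices G" and "a \<in> carrier A" "m \<in> carrier (vmod M x)"
  shows "vertex_section x (a \<odot>\<^bsub>vmod M x\<^esub> m) = diag (star x) a \<odot>\<^bsub>\<Gamma> (star x)\<^esub> vertex_section x m"
proof -
  interpret V: Module.module A "vmod M x" by (rule vmod_module[OF x])
  interpret V': Module.module "S (star x)" "\<Gamma> (star x)" by (rule section_module_module[OF star_points[OF x]])
  show ?thesis
    using assms(2,3)
    by (intro section_eqI[OF vertex_section_carrier V'.smult_closed[OF diag_carrier[OF star_points[OF x]] vertex_section_carrier]])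
       (simp_all add: rho_simps)
qed

lemma edge_tuple_carrier: "n \<in> carrier (emod M L) \<Longrightarrow> edge_tuple L n \<in> carrier (\<Gamma> {Inr L})"
  by (simp add: edge_tuple_mem_iff)

lemma edge_tuple_snd: "s \<in> carrier (\<Gamma> {Inr L}) \<Longrightarrow> edge_tuple L (snd s L) = s"
  by (rule section_eqI[OF edge_tuple_carrier[OF section_apply(2)]]) auto

lemma edge_tuple_add:
  "edge_tuple L (m \<oplus>\<^bsub>emod M L\<^esub> n) = edge_tuple L m \<oplus>\<^bsub>\<Gamma> {Inr L}\<^esub> edge_tuple L n"
  by (auto simp: edge_tuple_def tuple_map2_def restrict_def fun_eq_iff)

lemma edge_tuple_smult:
  "edge_tuple L (a \<odot>\<^bsub>emod M L\<^esub> n) = edge_tuple L a \<odot>\<^bsub>\<Gamma> {Inr L}\<^esub> edge_tuple L n"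
  by (auto simp: edge_tuple_def tuple_map2_def restrict_def fun_eq_iff)

section \<open>Finite generation of the modules of sections\<close>

lemma finitely_generated_star:
  assumes x: "x \<in> vertices G"
  shows "finitely_generated (S (star x)) (\<Gamma> (star x))"
proof (rule finitely_generated_image[OF vmod_module[OF x] section_module_module[OF star_points[OF x]] vmod_fg[OF x]])
  show "diag (star x) \<in> carrier A \<rightarrow> carrier (S (star x))" using diag_carrier[OF star_points[OF x]] by blast
  show "vertex_section x ` carrier (vmod M x) = carrier (\<Gamma> (star x))"
  proof
    show "carrier (\<Gamma> (star x)) \<subseteq> vertex_section x ` carrier (vmod M x)"
    proof
      fix s assume s: "s \<in> carrier (\<Gamma> (star x))"
      then have "fst s x \<in> carrier (vmod M x)" using section_apply(1)[OF s] by simp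
      then show "s \<in> vertex_section x ` carrier (vmod M x)" using vertex_section_fst[OF s] by (metis imageI)
    qed
  qed (use vertex_section_carrier in blast)
qed (use vertex_section_add[OF x] vertex_section_smult[OF x] in blast)+

lemma finitely_generated_edge:
  assumes L: "L \<in> edges G"
  shows "finitely_generated (S {Inr L}) (\<Gamma> {Inr L})"
proof (rule finitely_generated_image[OF emod_module[OF L] section_module_module[OF edge_points[OF L]] emod_fg[OF L]])
  show "edge_tuple L \<in> carrier (E L) \<rightarrow> carrier (S {Inr L})" by (simp add: edge_tuple_mem_iff)
  show "edge_tuple L ` carrier (emod M L) = carrier (\<Gamma> {Inr L})"
  proof
    show "carrier (\<Gamma> {Inr L}) \<subseteq> edge_tuple L ` carrier (emod M L)"
    proof
      fix s assume s: "s \<in> carrier (\<Gamma> {Inr L})"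
      then have "snd s L \<in> carrier (emod M L)" using section_apply(2)[OF s] by simp
      then show "s \<in> edge_tuple L ` carrier (emod M L)" using edge_tuple_snd[OF s] by (metis imageI)
    qed
  qed (use edge_tuple_carrier in blast)
qed (rule edge_tuple_add edge_tuple_smult)+

text \<open>Every scalar of the edge ring lifts to a polynomial, so the same generators suffice over
  A. The lift \<open>?\<phi>\<close> is an arbitrary choice and need not respect the ring
  operations.\<close>

lemma emod_restrict_fg:
  assumes L: "L \<in> edges G"
  shows "finitely_generated A (restrict_scalars (pr L) (emod M L))"
proof -
  let ?N = "restrict_scalars (pr L) (emod M L)"
  let ?\<phi> = "inv_into (carrier A) (pr L)"
  have \<phi>: "?\<phi> u \<in> carrier A" "pr L (?\<phi> u) = u" if "u \<in> carrier (E L)" for u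
    using that inv_into_into[of u "pr L" "carrier A"] f_inv_into_f[of u "pr L" "carrier A"]
    unfolding edge_proj_surj[OF L] by blast+
  show ?thesis
  proof (rule finitely_generated_image[OF emod_module[OF L] _ emod_fg[OF L]])
    show "Module.module A ?N"
      by (rule module_restrict_scalars[OF emod_module[OF L] A.cring_axioms edge_proj_hom[OF L]])
    show "?\<phi> \<in> carrier (E L) \<rightarrow> carrier A" using \<phi> by blast
    show "(\<lambda>n. n) ` carrier (emod M L) = carrier ?N" by simp
  qed (simp_all add: \<phi> del: polyring_simps)
qed

text \<open>Induction on a finite set P of points off which all tuples of W vanish. Evaluation at
  one point p maps W into a finitely generated A-module, and the tuples in its kernel vanish at p
  too, so P loses that point.\<close>

lemma finitely_generated_sections:
  assumes noeth: "noetherian_ring A" and Z: "Z \<subseteq> graph_points G"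
  shows "finitely_generated (S Z) (\<Gamma> Z)"
proof -
  let ?N = "restrict_scalars (diag Z) (\<Gamma> Z)"
  note mod = section_module_module[OF Z]
  have N: "Module.module A ?N" by (rule module_restrict_scalars[OF mod A.cring_axioms diag_hom[OF Z]])
  interpret N: Module.module A ?N by (rule N)
  interpret \<Gamma>Z: Module.module "S Z" "\<Gamma> Z" by (rule mod)
  have WC: "W \<subseteq> carrier (\<Gamma> Z)" if "submodule W A ?N" for W using N.submoduleE(1)[OF that] by simp
  have "fg_set A ?N W"
    if "finite P" "P \<subseteq> Z" "submodule W A ?N"
      "\<And>w x. w \<in> W \<Longrightarrow> Inl x \<in> Z - P \<Longrightarrow> fst w x = \<zero>\<^bsub>vmod M x\<^esub>"
      "\<And>w L. w \<in> W \<Longrightarrow> Inr L \<in> Z - P \<Longrightarrow> snd w L = \<zero>\<^bsub>emod M L\<^esub>" for P W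
    using that
  proof (induction P arbitrary: W)
    case empty
    have "w = \<zero>\<^bsub>\<Gamma> Z\<^esub>" if "w \<in> W" for w
      by (rule section_eqI[OF subsetD[OF WC[OF empty.prems(2)] that] \<Gamma>Z.zero_closed])
         (use empty.prems(3,4)[OF that] in simp_all)
    then have "W \<subseteq> lspan A ?N {}" using lspan.zero[of ?N A "{}"] by auto
    then show ?case unfolding fg_set_def by blast
  next
    case (insert p P)
    note W = insert.prems(2)
    note C = WC[OF W, THEN subsetD]
    show ?case
    proof (cases p)
      case (Inl x)
      have xZ: "Inl x \<in> Z" using Inl insert.prems(1) by simp
      have x: "x \<in> vertices G" by (rule points_vertex[OF Z xZ])
      show ?thesis
      proof (rule fg_set_kernel[OF noeth N vmod_module[OF x] vmod_fg[OF x] W, where h = "\<lambda>w. fst w x"])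
        show "(\<lambda>w. fst w x) \<in> W \<rightarrow> carrier (vmod M x)" using section_apply(1)[OF C xZ] by blast
        show "fg_set A ?N {w \<in> W. fst w x = \<zero>\<^bsub>vmod M x\<^esub>}"
          if "submodule {w \<in> W. fst w x = \<zero>\<^bsub>vmod M x\<^esub>} A ?N"
          using insert.prems Inl by (intro insert.IH that) auto
      qed (simp_all add: xZ)
    next
      case (Inr L)
      have LZ: "Inr L \<in> Z" using Inr insert.prems(1) by simp
      have L: "L \<in> edges G" by (rule points_edge[OF Z LZ])
      \<comment> \<open>The edge module is taken over A, so that the Noetherian property of A serves
        at edges as well as at vertices.\<close>
      let ?E = "restrict_scalars (pr L) (emod M L)"
      have E: "Module.module A ?E"
        by (rule module_restrict_scalars[OF emod_module[OF L] A.cring_axioms edge_proj_hom[OF L]])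
      show ?thesis
      proof (rule fg_set_kernel[OF noeth N E emod_restrict_fg[OF L] W, where h = "\<lambda>w. snd w L"])
        show "(\<lambda>w. snd w L) \<in> W \<rightarrow> carrier ?E" using section_apply(2)[OF C LZ] by simp
        show "fg_set A ?N {w \<in> W. snd w L = \<zero>\<^bsub>?E\<^esub>}"
          if "submodule {w \<in> W. snd w L = \<zero>\<^bsub>?E\<^esub>} A ?N"
        proof (rule insert.IH[OF _ that])
          show "snd w L' = \<zero>\<^bsub>emod M L'\<^esub>"
            if "w \<in> {w \<in> W. snd w L = \<zero>\<^bsub>?E\<^esub>}" "Inr L' \<in> Z - P" for w L'
            using that insert.prems(4)[of w L'] Inr by (cases "L' = L") auto
        qed (use insert.prems(1,3) Inr in auto)
      qed (simp_all add: LZ)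
    qed
  qed
  \<comment> \<open>With P = Z no vanishing is imposed, which gives the whole module. Since constant
    sections are scalar sections, generators over A also generate over the ring of sections.\<close>
  from this[OF finite_subset[OF Z finite_graph_points] subset_refl N.carrier_is_submodule]
  have "finitely_generated A ?N" unfolding finitely_generated_iff[OF N] by simp
  then show ?thesis
    by (rule finitely_generated_image[OF N mod, where \<phi> = "diag Z" and h = "\<lambda>s. s"])
       (use diag_carrier[OF Z] in auto)
qed

section \<open>Restriction, gluing and the sheaf property\<close>

lemma sheaf_of_sections_simps [simp]:
  "sec (sheaf_of_sections G M) = \<Gamma>" "sdeg (sheaf_of_sections G M) U d = \<Gamma>d U d"
  "res (sheaf_of_sections G M) U W = tuple_restrict W"
  by (simp_all add: sheaf_of_sections_def)

lemma restriction_graded_hom: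
  assumes U: "U \<subseteq> graph_points G" and W: "W \<subseteq> U"
  shows "graded_hom (S U) (tuple_restrict W) (\<Gamma> U) (\<Gamma>d U) (\<Gamma> W) (\<Gamma>d W) (tuple_restrict W)"
  unfolding graded_hom_def
proof (intro conjI ballI allI)
  show "tuple_restrict W \<in> carrier (\<Gamma> U) \<rightarrow> carrier (\<Gamma> W)"
    using tuple_restrict_sections[OF _ W] by auto
  show "tuple_restrict W (s \<oplus>\<^bsub>\<Gamma> U\<^esub> t) = tuple_restrict W s \<oplus>\<^bsub>\<Gamma> W\<^esub> tuple_restrict W t" for s t
    using W by (auto simp: tuple_restrict_def tuple_map2_def fun_eq_iff restrict_def)
  show "tuple_restrict W (a \<odot>\<^bsub>\<Gamma> U\<^esub> s) = tuple_restrict W a \<odot>\<^bsub>\<Gamma> W\<^esub> tuple_restrict W s" for a s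
    using W by (auto simp: tuple_restrict_def tuple_map2_def fun_eq_iff restrict_def)
  show "tuple_restrict W ` \<Gamma>d U d \<subseteq> \<Gamma>d W d" for d
    using tuple_restrict_sections[OF _ W] by blast
qed

lemma tuple_restrict_id: "s \<in> carrier (\<Gamma> U) \<Longrightarrow> tuple_restrict U s = s"
  by (cases s) (auto simp: tuple_restrict_def sections_iff extensional_restrict)

lemma tuple_restrict_restrict: "W \<subseteq> V \<Longrightarrow> tuple_restrict W (tuple_restrict V s) = tuple_restrict W s"
  by (auto simp: tuple_restrict_def restrict_def fun_eq_iff)

text \<open>Tuples glue point by point. The one condition linking two points is compatibility of a
  vertex with an edge, and an open member of the cover containing the vertex also contains the edge,
  so the condition holds within that member.\<close>

lemma sections_glue:
  assumes "\<And>U. U \<in> \<U> \<Longrightarrow> openin (graph_top G) U" "\<And>U. U \<in> \<U> \<Longrightarrow> s U \<in> carrier (\<Gamma> U)"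
    and compat: "\<And>U W. U \<in> \<U> \<Longrightarrow> W \<in> \<U> \<Longrightarrow> tuple_restrict (U \<inter> W) (s U) = tuple_restrict (U \<inter> W) (s W)"
  shows "\<exists>!u. u \<in> carrier (\<Gamma> (\<Union>\<U>)) \<and> (\<forall>U\<in>\<U>. tuple_restrict U u = s U)"
proof -
  define cover where "cover p = (SOME U. U \<in> \<U> \<and> p \<in> U)" for p
  have cover: "cover p \<in> \<U>" "p \<in> cover p" if "p \<in> \<Union>\<U>" for p
    using someI_ex[of "\<lambda>U. U \<in> \<U> \<and> p \<in> U"] that unfolding cover_def by blast+
  have compat_v: "fst (s U) x = fst (s W) x" if "U \<in> \<U>" "W \<in> \<U>" "Inl x \<in> U" "Inl x \<in> W" for U W x
    using arg_cong[OF compat[OF that(1,2)], of "\<lambda>s. fst s x"] that by simp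
  have compat_e: "snd (s U) L = snd (s W) L" if "U \<in> \<U>" "W \<in> \<U>" "Inr L \<in> U" "Inr L \<in> W" for U W L
    using arg_cong[OF compat[OF that(1,2)], of "\<lambda>s. snd s L"] that by simp
  define u where "u = (\<lambda>x\<in>Inl -` (\<Union>\<U>). fst (s (cover (Inl x))) x, \<lambda>L\<in>Inr -` (\<Union>\<U>). snd (s (cover (Inr L))) L)"
  have u_v: "fst u x = fst (s U) x" if "U \<in> \<U>" "Inl x \<in> U" for U x
    using that cover[of "Inl x"] by (auto simp: u_def intro: compat_v)
  have u_e: "snd u L = snd (s U) L" if "U \<in> \<U>" "Inr L \<in> U" for U L
    using that cover[of "Inr L"] by (auto simp: u_def intro: compat_e)
  have u: "u \<in> carrier (\<Gamma> (\<Union>\<U>))"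
    unfolding section_module_simps sections_iff
  proof (intro conjI allI impI)
    show "fst u \<in> extensional (Inl -` \<Union>\<U>)" "snd u \<in> extensional (Inr -` \<Union>\<U>)" by (simp_all add: u_def)
    show "fst u x \<in> carrier (vmod M x)" if "Inl x \<in> \<Union>\<U>" for x
      using that section_apply(1)[OF assms(2)] u_v by auto
    show "snd u L \<in> carrier (emod M L)" if "Inr L \<in> \<Union>\<U>" for L
      using that section_apply(2)[OF assms(2)] u_e by auto
    fix x L assume "Inl x \<in> \<Union>\<U>" "Inr L \<in> \<Union>\<U>" and xL: "x \<in> ends G L"
    then obtain U W where U: "U \<in> \<U>" "Inl x \<in> U" and W: "W \<in> \<U>" "Inr L \<in> W" by blast
    have "L \<in> edges G" by (rule points_edge[OF open_points[OF assms(1)[OF W(1)]] W(2)])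
    \<comment> \<open>The edge was found in W, perhaps not the member holding x; openness of U puts
      it into U, where the compatibility of \<open>s U\<close> applies.\<close>
    then have LU: "Inr L \<in> U" using open_edge[OF assms(1)[OF U(1)] U(2) _ xL] by blast
    show "rho M x L (fst u x) = snd u L"
      using section_apply(3)[OF assms(2)[OF U(1)] U(2) LU xL] u_v[OF U] u_e[OF U(1) LU] by simp
  qed
  have res: "tuple_restrict U u = s U" if U: "U \<in> \<U>" for U
  proof (rule section_eqI[OF _ assms(2)[OF U]])
    show "tuple_restrict U u \<in> carrier (\<Gamma> U)"
      using u U unfolding section_module_simps by (intro tuple_restrict_sections[where Z = "\<Union>\<U>"]) auto
  qed (simp_all add: u_v[OF U] u_e[OF U])
  show ?thesis
  proof (rule ex1I[of _ u])
    fix v assume v: "v \<in> carrier (\<Gamma> (\<Union>\<U>)) \<and> (\<forall>U\<in>\<U>. tuple_restrict U v = s U)"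
    then have vU: "tuple_restrict U v = s U" if "U \<in> \<U>" for U using that by blast
    show "v = u"
    proof (rule section_eqI[OF _ u])
      show "v \<in> carrier (\<Gamma> (\<Union>\<U>))" using v by blast
      show "fst v x = fst u x" if "Inl x \<in> \<Union>\<U>" for x
      proof -
        from that obtain U where U: "U \<in> \<U>" "Inl x \<in> U" by blast
        then show ?thesis using arg_cong[OF vU[OF U(1)], of "\<lambda>s. fst s x"] u_v[OF U] by simp
      qed
      show "snd v L = snd u L" if "Inr L \<in> \<Union>\<U>" for L
      proof -
        from that obtain U where U: "U \<in> \<U>" "Inr L \<in> U" by blast
        then show ?thesis using arg_cong[OF vU[OF U(1)], of "\<lambda>s. snd s L"] u_e[OF U] by simp
      qed
    qed
  qed (use u res in blast)
qed

theorem is_module_sheaf_sections: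
  assumes "\<And>U. U \<in> \<B> \<Longrightarrow> finitely_generated (S U) (\<Gamma> U)"
  shows "is_module_sheaf scale G \<B> (sheaf_of_sections G M)"
  unfolding is_module_sheaf_def sheaf_of_sections_simps
proof (intro conjI allI impI ballI)
  show "finitely_generated (S U) (\<Gamma> U)" if "U \<in> \<B>" for U by (rule assms[OF that])
  show "graded_module (S U) (struct_deg scale G U) (\<Gamma> U) (\<Gamma>d U)"
    if "openin (graph_top G) U" for U
    by (rule section_graded_module[OF open_points[OF that]])
  show "graded_hom (S U) (tuple_restrict W) (\<Gamma> U) (\<Gamma>d U)
     (\<Gamma> W) (\<Gamma>d W) (tuple_restrict W)"
    if "openin (graph_top G) U" "W \<subseteq> U" for U W
    by (rule restriction_graded_hom[OF open_points[OF that(1)] that(2)])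
  show "tuple_restrict U s = s" if "s \<in> carrier (\<Gamma> U)" for U s by (rule tuple_restrict_id[OF that])
  show "tuple_restrict W (tuple_restrict V s) = tuple_restrict W s" if "W \<subseteq> V" for V W s
    by (rule tuple_restrict_restrict[OF that])
  show "\<exists>!u. u \<in> carrier (\<Gamma> (\<Union>\<U>)) \<and> (\<forall>U\<in>\<U>. tuple_restrict U u = s U)"
    if "\<forall>U\<in>\<U>. openin (graph_top G) U \<and> s U \<in> carrier (\<Gamma> U)"
      "\<forall>U\<in>\<U>. \<forall>W\<in>\<U>. tuple_restrict (U \<inter> W) (s U) = tuple_restrict (U \<inter> W) (s W)" for \<U> s
    by (rule sections_glue) (use that in auto)
qed

end

section \<open>Isomorphisms\<close>

locale gamma_sheaf_pair = M: gamma_sheaf_on scale G M + N: gamma_sheaf_on scale G N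
  for scale :: "complex \<Rightarrow> 't::ab_group_add \<Rightarrow> 't" and G :: "('t, 'v, 'e) moment_graph"
    and M :: "('t, 'v, 'e, 'm, 'n) gamma_sheaf" and N :: "('t, 'v, 'e, 'p, 'q) gamma_sheaf"
begin

lemma module_sheaf_isoI:
  assumes "gamma_sheaf_iso scale G M N"
  shows "module_sheaf_iso scale G (sheaf_of_sections G M) (sheaf_of_sections G N)"
proof -
  obtain f g where
    f: "\<And>x. x \<in> vertices G \<Longrightarrow> graded_iso M.A (vmod M x) (vdeg M x) (vmod N x) (vdeg N x) (f x)"
    and g: "\<And>L. L \<in> edges G \<Longrightarrow> graded_iso (M.E L) (emod M L) (edeg M L) (emod N L) (edeg N L) (g L)"
    and fg: "\<And>L x m. L \<in> edges G \<Longrightarrow> x \<in> ends G L \<Longrightarrow> m \<in> carrier (vmod M x) \<Longrightarrow>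
      g L (rho M x L m) = rho N x L (f x m)"
    using assms unfolding gamma_sheaf_iso_def by blast
  have fh: "graded_hom M.A (\<lambda>a. a) (vmod M x) (vdeg M x) (vmod N x) (vdeg N x) (f x)"
    and fb: "bij_betw (f x) (carrier (vmod M x)) (carrier (vmod N x))" if "x \<in> vertices G" for x
    using f[OF that] by (simp_all add: graded_iso_def)
  have gh: "graded_hom (M.E L) (\<lambda>a. a) (emod M L) (edeg M L) (emod N L) (edeg N L) (g L)"
    and gb: "bij_betw (g L) (carrier (emod M L)) (carrier (emod N L))" if "L \<in> edges G" for L
    using g[OF that] by (simp_all add: graded_iso_def)
  \<comment> \<open>The stalk isomorphisms are applied point by point; they commute with
    \<open>rho\<close>, so compatible tuples go to compatible tuples.\<close>
  define h where "h U s = (\<lambda>x\<in>Inl -` U. f x (fst s x), \<lambda>L\<in>Inr -` U. g L (snd s L))"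
    for U and s :: "('v, 'e, 'm, 'n) tuple"
  have h_apply: "Inl x \<in> U \<Longrightarrow> fst (h U s) x = f x (fst s x)" "Inr L \<in> U \<Longrightarrow> snd (h U s) L = g L (snd s L)"
    for U s x L by (simp_all add: h_def)
  have "graded_iso (M.S U) (M.\<Gamma> U) (M.\<Gamma>d U) (N.\<Gamma> U) (N.\<Gamma>d U) (h U)" if U: "openin (graph_top G) U" for U
  proof -
    have U': "U \<subseteq> graph_points G" by (rule M.open_points[OF U])
    note xU = M.points_vertex[OF U'] and LU = M.points_edge[OF U']
    note fD = graded_homD[OF fh[OF xU]] and gD = graded_homD[OF gh[OF LU]]
    interpret MU: Module.module "M.S U" "M.\<Gamma> U" by (rule M.section_module_module[OF U'])
    interpret NU: Module.module "M.S U" "N.\<Gamma> U" by (rule N.section_module_module[OF U'])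
    have hC: "h U s \<in> carrier (N.\<Gamma> U)" if s: "s \<in> carrier (M.\<Gamma> U)" for s
      unfolding section_module_simps h_def restrict_sections_iff
      using M.section_apply[OF s] fD(1) gD(1) fg[OF LU] by auto
    have "graded_hom (M.S U) (\<lambda>a. a) (M.\<Gamma> U) (M.\<Gamma>d U) (N.\<Gamma> U) (N.\<Gamma>d U) (h U)"
      unfolding graded_hom_def
    proof (intro conjI ballI allI)
      show "h U \<in> carrier (M.\<Gamma> U) \<rightarrow> carrier (N.\<Gamma> U)" using hC by blast
      fix s t assume s: "s \<in> carrier (M.\<Gamma> U)" and t: "t \<in> carrier (M.\<Gamma> U)"
      show "h U (s \<oplus>\<^bsub>M.\<Gamma> U\<^esub> t) = h U s \<oplus>\<^bsub>N.\<Gamma> U\<^esub> h U t"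
        by (rule N.section_eqI[OF hC[OF MU.a_closed[OF s t]] NU.a_closed[OF hC[OF s] hC[OF t]]])
           (simp_all add: h_apply fD gD M.section_apply[OF s] M.section_apply[OF t])
    next
      fix a s assume a: "a \<in> carrier (M.S U)" and s: "s \<in> carrier (M.\<Gamma> U)"
      show "h U (a \<odot>\<^bsub>M.\<Gamma> U\<^esub> s) = a \<odot>\<^bsub>N.\<Gamma> U\<^esub> h U s"
        by (rule N.section_eqI[OF hC[OF MU.smult_closed[OF a s]] NU.smult_closed[OF a hC[OF s]]])
           (use a in \<open>simp_all add: h_apply fD gD M.section_apply[OF s] sections_iff\<close>)
    next
      fix d
      show "h U ` M.\<Gamma>d U d \<subseteq> N.\<Gamma>d U d"
      proof (rule image_subsetI)
        fix s assume s: "s \<in> M.\<Gamma>d U d"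
        note sC = M.homog_section_carrier[OF U' s]
        show "h U s \<in> N.\<Gamma>d U d"
          unfolding h_def restrict_sections_iff
          using s fD(4) gD(4) fg[OF LU] M.section_apply[OF sC] by (auto simp: sections_iff)
      qed
    qed
    moreover have "bij_betw (h U) (carrier (M.\<Gamma> U)) (carrier (N.\<Gamma> U))"
    proof (rule bij_betwI')
      fix s t assume s: "s \<in> carrier (M.\<Gamma> U)" and t: "t \<in> carrier (M.\<Gamma> U)"
      show "h U s = h U t \<longleftrightarrow> s = t"
      proof
        assume eq: "h U s = h U t"
        show "s = t"
        proof (rule M.section_eqI[OF s t])
          show "fst s x = fst t x" if x: "Inl x \<in> U" for x
            using arg_cong[OF eq, of "\<lambda>s. fst s x"] fb[OF xU[OF x]] M.section_apply(1)[OF s x] M.section_apply(1)[OF t x]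
            by (auto simp: h_apply x bij_betw_def inj_on_def)
          show "snd s L = snd t L" if L: "Inr L \<in> U" for L
            using arg_cong[OF eq, of "\<lambda>s. snd s L"] gb[OF LU[OF L]] M.section_apply(2)[OF s L] M.section_apply(2)[OF t L]
            by (auto simp: h_apply L bij_betw_def inj_on_def)
        qed
      qed simp
    next
      show "h U s \<in> carrier (N.\<Gamma> U)" if "s \<in> carrier (M.\<Gamma> U)" for s by (rule hC[OF that])
    next
      fix t assume t: "t \<in> carrier (N.\<Gamma> U)"
      let ?f = "\<lambda>x. inv_into (carrier (vmod M x)) (f x) (fst t x)"
      let ?g = "\<lambda>L. inv_into (carrier (emod M L)) (g L) (snd t L)"
      have f': "?f x \<in> carrier (vmod M x)" "f x (?f x) = fst t x" if "Inl x \<in> U" for x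
        using fb[OF xU[OF that]] N.section_apply(1)[OF t that]
        by (auto simp: bij_betw_def inv_into_into f_inv_into_f)
      have g': "?g L \<in> carrier (emod M L)" "g L (?g L) = snd t L" if "Inr L \<in> U" for L
        using gb[OF LU[OF that]] N.section_apply(2)[OF t that]
        by (auto simp: bij_betw_def inv_into_into f_inv_into_f)
      \<comment> \<open>The pointwise preimages form a compatible tuple: after applying the
        injective \<open>g L\<close>, the equation is the compatibility of t.\<close>
      have "rho M x L (?f x) = ?g L" if x: "Inl x \<in> U" and L: "Inr L \<in> U" and xL: "x \<in> ends G L" for x L
      proof -
        have "g L (rho M x L (?f x)) = g L (?g L)"
          using fg[OF LU[OF L] xL f'(1)[OF x]] f'(2)[OF x] g'(2)[OF L] N.section_apply(3)[OF t x L xL] by simp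
        then show ?thesis
          using gb[OF LU[OF L]] M.rho_simps(1)[OF LU[OF L] xL f'(1)[OF x]] g'(1)[OF L]
          by (auto simp: bij_betw_def inj_on_def)
      qed
      then have s: "(\<lambda>x\<in>Inl -` U. ?f x, \<lambda>L\<in>Inr -` U. ?g L) \<in> carrier (M.\<Gamma> U)" (is "?s \<in> _")
        unfolding section_module_simps restrict_sections_iff using f' g' by auto
      moreover have "t = h U ?s"
        by (rule N.section_eqI[OF t hC[OF s]]) (simp_all add: h_apply f' g')
      ultimately show "\<exists>s\<in>carrier (M.\<Gamma> U). t = h U s" by blast
    qed
    ultimately show ?thesis by (simp add: graded_iso_def)
  qed
  moreover have "h W (tuple_restrict W s) = tuple_restrict W (h U s)" if "W \<subseteq> U" for U W s
    using that by (auto simp: h_def tuple_restrict_def restrict_def fun_eq_iff)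
  ultimately show ?thesis
    unfolding module_sheaf_iso_def M.sheaf_of_sections_simps N.sheaf_of_sections_simps
    by (intro exI[of _ h]) blast
qed

text \<open>Sections over a star and over an edge point are copies of the stalks, so h read on these
  open sets gives isomorphisms of stalks. Their compatibility with \<open>rho\<close> is naturality
  of h for the inclusion of an edge point in a star.\<close>

lemma gamma_sheaf_isoI:
  assumes "module_sheaf_iso scale G (sheaf_of_sections G M) (sheaf_of_sections G N)"
  shows "gamma_sheaf_iso scale G M N"
proof -
  obtain h where h_res: "(\<forall>U. openin (graph_top G) U \<longrightarrow>
       graded_iso (M.S U) (M.\<Gamma> U) (M.\<Gamma>d U) (N.\<Gamma> U) (N.\<Gamma>d U) (h U)) \<and>
     (\<forall>U W. openin (graph_top G) U \<longrightarrow> openin (graph_top G) W \<longrightarrow> W \<subseteq> U \<longrightarrow>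
       (\<forall>s\<in>carrier (M.\<Gamma> U). h W (tuple_restrict W s) = tuple_restrict W (h U s)))"
    using assms unfolding module_sheaf_iso_def M.sheaf_of_sections_simps N.sheaf_of_sections_simps
    by (rule exE)
  note h = h_res[THEN conjunct1, rule_format]
    and res = h_res[THEN conjunct2, rule_format]
  have hh: "graded_hom (M.S U) (\<lambda>a. a) (M.\<Gamma> U) (M.\<Gamma>d U) (N.\<Gamma> U) (N.\<Gamma>d U) (h U)"
    and hb: "bij_betw (h U) (carrier (M.\<Gamma> U)) (carrier (N.\<Gamma> U))" if "openin (graph_top G) U" for U
    using h[OF that] by (simp_all add: graded_iso_def)
  define f where "f x m = fst (h (M.star x) (M.vertex_section x m)) x" for x m
  define g where "g L n = snd (h {Inr L} (edge_tuple L n)) L" for L n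
  have f_iso: "graded_iso M.A (vmod M x) (vdeg M x) (vmod N x) (vdeg N x) (f x)" if x: "x \<in> vertices G" for x
  proof -
    note hD = graded_homD[OF hh[OF M.open_star[OF x]]]
    note vC = M.vertex_section_carrier
    have "graded_hom M.A (\<lambda>a. a) (vmod M x) (vdeg M x) (vmod N x) (vdeg N x) (f x)"
      unfolding graded_hom_def
    proof (intro conjI ballI allI)
      show "f x \<in> carrier (vmod M x) \<rightarrow> carrier (vmod N x)"
        unfolding f_def using N.section_apply(1)[OF hD(1)[OF vC]] by auto
      show "f x (m \<oplus>\<^bsub>vmod M x\<^esub> n) = f x m \<oplus>\<^bsub>vmod N x\<^esub> f x n"
        if "m \<in> carrier (vmod M x)" "n \<in> carrier (vmod M x)" for m n
        unfolding f_def M.vertex_section_add[OF x that] hD(2)[OF vC[OF that(1)] vC[OF that(2)]] by simp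
      show "f x (a \<odot>\<^bsub>vmod M x\<^esub> m) = a \<odot>\<^bsub>vmod N x\<^esub> f x m"
        if a: "a \<in> carrier M.A" and m: "m \<in> carrier (vmod M x)" for a m
        unfolding f_def M.vertex_section_smult[OF x that]
          hD(3)[OF M.diag_carrier[OF M.star_points[OF x] a] vC[OF m]] by simp
      show "f x ` vdeg M x d \<subseteq> vdeg N x d" for d
        using hD(4)[OF M.vertex_section_homog] by (auto simp: f_def sections_iff)
    qed
    moreover have "bij_betw (f x) (carrier (vmod M x)) (carrier (vmod N x))"
    proof -
      have 1: "bij_betw (M.vertex_section x) (carrier (vmod M x)) (carrier (M.\<Gamma> (M.star x)))"
        by (rule bij_betw_byWitness[where f' = "\<lambda>s. fst s x"])
           (use M.vertex_section_fst vC M.section_apply(1) in \<open>auto simp del: section_module_simps\<close>)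
      have 2: "bij_betw (\<lambda>s. fst s x) (carrier (N.\<Gamma> (M.star x))) (carrier (vmod N x))"
        by (rule bij_betw_byWitness[where f' = "N.vertex_section x"])
           (use N.vertex_section_fst N.vertex_section_carrier N.section_apply(1) in \<open>auto simp del: section_module_simps\<close>)
      from bij_betw_trans[OF bij_betw_trans[OF 1 hb[OF M.open_star[OF x]]] 2] show ?thesis
        unfolding comp_def f_def[abs_def] .
    qed
    ultimately show ?thesis by (simp add: graded_iso_def)
  qed
  have g_iso: "graded_iso (M.E L) (emod M L) (edeg M L) (emod N L) (edeg N L) (g L)" if L: "L \<in> edges G" for L
  proof -
    note hD = graded_homD[OF hh[OF M.open_edge_point[OF L]]]
    note eC = M.edge_tuple_carrier
    have "graded_hom (M.E L) (\<lambda>a. a) (emod M L) (edeg M L) (emod N L) (edeg N L) (g L)"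
      unfolding graded_hom_def
    proof (intro conjI ballI allI)
      show "g L \<in> carrier (emod M L) \<rightarrow> carrier (emod N L)"
        unfolding g_def using N.section_apply(2)[OF hD(1)[OF eC]] by auto
      show "g L (m \<oplus>\<^bsub>emod M L\<^esub> n) = g L m \<oplus>\<^bsub>emod N L\<^esub> g L n"
        if "m \<in> carrier (emod M L)" "n \<in> carrier (emod M L)" for m n
        unfolding g_def M.edge_tuple_add hD(2)[OF eC[OF that(1)] eC[OF that(2)]] by simp
      show "g L (a \<odot>\<^bsub>emod M L\<^esub> m) = a \<odot>\<^bsub>emod N L\<^esub> g L m"
        if a: "a \<in> carrier (M.E L)" and m: "m \<in> carrier (emod M L)" for a m
      proof -
        have "edge_tuple L a \<in> carrier (M.S {Inr L})" using a by (simp add: edge_tuple_mem_iff)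
        from hD(3)[OF this eC[OF m]] show ?thesis unfolding g_def M.edge_tuple_smult by simp
      qed
      show "g L ` edeg M L d \<subseteq> edeg N L d" for d
      proof (rule image_subsetI)
        fix n assume "n \<in> edeg M L d"
        then have "edge_tuple L n \<in> M.\<Gamma>d {Inr L} d" by (simp add: edge_tuple_mem_iff)
        from hD(4)[OF this] show "g L n \<in> edeg N L d" by (simp add: g_def sections_iff)
      qed
    qed
    moreover have "bij_betw (g L) (carrier (emod M L)) (carrier (emod N L))"
    proof -
      have 1: "bij_betw (edge_tuple L) (carrier (emod M L)) (carrier (M.\<Gamma> {Inr L}))"
        by (rule bij_betw_byWitness[where f' = "\<lambda>s. snd s L"])
           (use M.edge_tuple_snd eC M.section_apply(2) in \<open>auto simp del: section_module_simps\<close>)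
      have 2: "bij_betw (\<lambda>s. snd s L) (carrier (N.\<Gamma> {Inr L})) (carrier (emod N L))"
        by (rule bij_betw_byWitness[where f' = "edge_tuple L"])
           (use N.edge_tuple_snd N.edge_tuple_carrier N.section_apply(2) in \<open>auto simp del: section_module_simps\<close>)
      from bij_betw_trans[OF bij_betw_trans[OF 1 hb[OF M.open_edge_point[OF L]]] 2] show ?thesis
        unfolding comp_def g_def[abs_def] .
    qed
    ultimately show ?thesis by (simp add: graded_iso_def)
  qed
  have "g L (rho M x L m) = rho N x L (f x m)"
    if L: "L \<in> edges G" and xL: "x \<in> ends G L" and m: "m \<in> carrier (vmod M x)" for L x m
  proof -
    have x: "x \<in> vertices G" by (rule M.ends_vertices[OF L xL])
    let ?s = "M.vertex_section x m"
    have LS: "{Inr L} \<subseteq> M.star x" using L xL by simp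
    note sC = M.vertex_section_carrier[OF m]
    \<comment> \<open>In terms of sections, \<open>rho\<close> is restriction from the star to the
      edge point; this identity turns naturality of h into the required square.\<close>
    have "tuple_restrict {Inr L} ?s = edge_tuple L (rho M x L m)"
    proof (rule M.section_eqI[OF _ M.edge_tuple_carrier])
      show "tuple_restrict {Inr L} ?s \<in> carrier (M.\<Gamma> {Inr L})"
        using sC unfolding section_module_simps by (rule tuple_restrict_sections[OF _ LS])
    qed (use M.rho_simps(1)[OF L xL m] L xL in auto)
    then have "g L (rho M x L m) = snd (h (M.star x) ?s) L"
      using res[OF M.open_star[OF x] M.open_edge_point[OF L] LS sC] by (simp add: g_def)
    also have "\<dots> = rho N x L (f x m)"
      using N.section_apply(3)[OF graded_homD(1)[OF hh[OF M.open_star[OF x]] sC], of x L] L xL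
      by (simp add: f_def)
    finally show ?thesis .
  qed
  with f_iso g_iso show ?thesis unfolding gamma_sheaf_iso_def by blast
qed

end

section \<open>Stalks of a module sheaf\<close>

lemma edge_tuple_snd_eq:
  assumes "s \<in> sections G {Inr L} C D \<rho>"
  shows "edge_tuple L (snd s L) = s"
proof (rule tuple_eqI[OF _ assms])
  show "edge_tuple L (snd s L) \<in> sections G {Inr L} C D \<rho>"
    using assms unfolding edge_tuple_mem_iff by (simp add: sections_iff)
qed auto

context moment_graph_on
begin

definition nbhd :: "'v + 'e \<Rightarrow> ('v, 'e) pts" where
  "nbhd p = (case p of Inl x \<Rightarrow> star x | Inr L \<Rightarrow> {Inr L})"

lemma nbhd_simps [simp]: "nbhd (Inl x) = star x" "nbhd (Inr L) = {Inr L}"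
  by (simp_all add: nbhd_def)

lemma nbhd_self: "p \<in> nbhd p"
  by (cases p) auto

lemma open_nbhd: "p \<in> graph_points G \<Longrightarrow> openin (graph_top G) (nbhd p)"
  by (cases p) (auto simp: graph_points_def intro: open_star open_edge_point)

lemma nbhd_subset: "openin (graph_top G) U \<Longrightarrow> p \<in> U \<Longrightarrow> nbhd p \<subseteq> U"
  using star_subset by (cases p) auto

lemma least_nbhd_eq: "p \<in> graph_points G \<Longrightarrow> least_nbhd G p = nbhd p"
  by (cases p) (auto simp: graph_points_def least_nbhd_vertex least_nbhd_edge)

lemma Union_nbhd: "openin (graph_top G) U \<Longrightarrow> \<Union> (nbhd ` U) = U"
  using nbhd_self nbhd_subset by blast

text \<open>A scalar section over a star has its edge values forced by the value at the vertex.
  Modules over this ring are therefore the same as A-modules.\<close>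

lemma diag_fst:
  assumes "a \<in> carrier (S (star x))"
  shows "diag (star x) (fst a x) = a"
proof (rule tuple_eqI)
  show "a \<in> sections G (star x) (\<lambda>_. carrier A) (\<lambda>L. carrier (E L)) (\<lambda>_. pr)" using assms by simp
  show "diag (star x) (fst a x) \<in> sections G (star x) (\<lambda>_. carrier A) (\<lambda>L. carrier (E L)) (\<lambda>_. pr)"
    using assms edge_proj_simps(1) unfolding diag_def restrict_sections_iff by (auto simp: sections_iff)
  show "snd (diag (star x) (fst a x)) L = snd a L" if "Inr L \<in> star x" for L
    using assms that by (auto simp: sections_iff)
qed simp

lemma edge_tuple_snd_scalar: "a \<in> carrier (S {Inr L}) \<Longrightarrow> edge_tuple L (snd a L) = a"
  unfolding struct_simps by (rule edge_tuple_snd_eq)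

lemma struct_restrict: "a \<in> carrier (S U) \<Longrightarrow> W \<subseteq> U \<Longrightarrow> tuple_restrict W a \<in> carrier (S W)"
  unfolding struct_simps by (rule tuple_restrict_sections)

end

text \<open>Both intended collections \<open>\<B>\<close> contain the least neighbourhoods. That
  inclusion yields finitely generated stalks and lets one argument serve both finiteness
  conditions.\<close>

locale module_sheaf_on = moment_graph_on scale G
  for scale :: "complex \<Rightarrow> 't::ab_group_add \<Rightarrow> 't" and G :: "('t, 'v, 'e) moment_graph" +
  fixes \<B> :: "('v, 'e) pts set" and F :: "('t, 'v, 'e, 's) module_sheaf"
  assumes module_sheaf: "is_module_sheaf scale G \<B> F"
    and stalks_fg: "least_nbhd G ` graph_points G \<subseteq> \<B>"
begin

abbreviation "opn \<equiv> openin (graph_top G)"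

lemma sec_graded_module: "opn U \<Longrightarrow> graded_module (S U) (struct_deg scale G U) (sec F U) (sdeg F U)"
  and sec_fg: "U \<in> \<B> \<Longrightarrow> finitely_generated (S U) (sec F U)"
  and res_graded_hom: "opn U \<Longrightarrow> opn W \<Longrightarrow> W \<subseteq> U \<Longrightarrow>
    graded_hom (S U) (tuple_restrict W) (sec F U) (sdeg F U) (sec F W) (sdeg F W) (res F U W)"
  and res_id: "opn U \<Longrightarrow> s \<in> carrier (sec F U) \<Longrightarrow> res F U U s = s"
  and res_res: "opn U \<Longrightarrow> opn V \<Longrightarrow> opn W \<Longrightarrow> W \<subseteq> V \<Longrightarrow> V \<subseteq> U \<Longrightarrow> s \<in> carrier (sec F U) \<Longrightarrow>
    res F V W (res F U V s) = res F U W s"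
  using module_sheaf unfolding is_module_sheaf_def by simp_all

lemma glue:
  assumes "\<And>U. U \<in> \<U> \<Longrightarrow> opn U" "\<And>U. U \<in> \<U> \<Longrightarrow> s U \<in> carrier (sec F U)"
    and "\<And>U W. U \<in> \<U> \<Longrightarrow> W \<in> \<U> \<Longrightarrow> res F U (U \<inter> W) (s U) = res F W (U \<inter> W) (s W)"
  shows "\<exists>!u. u \<in> carrier (sec F (\<Union>\<U>)) \<and> (\<forall>U\<in>\<U>. res F (\<Union>\<U>) U u = s U)"
proof -
  have "\<forall>\<U> s. (\<forall>U\<in>\<U>. opn U \<and> s U \<in> carrier (sec F U)) \<longrightarrow>
        (\<forall>U\<in>\<U>. \<forall>W\<in>\<U>. res F U (U \<inter> W) (s U) = res F W (U \<inter> W) (s W)) \<longrightarrow>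
        (\<exists>!u. u \<in> carrier (sec F (\<Union>\<U>)) \<and> (\<forall>U\<in>\<U>. res F (\<Union>\<U>) U u = s U))"
    using module_sheaf unfolding is_module_sheaf_def by (elim conjE)
  from this[THEN spec, THEN spec, THEN mp, THEN mp] show ?thesis
    by this (use assms in blast)+
qed

lemma sec_graded: "opn U \<Longrightarrow> graded (S U) (sec F U) (struct_deg scale G U) (sdeg F U)"
  by (rule gradedI[OF sec_graded_module])

lemma sec_module: "opn U \<Longrightarrow> Module.module (S U) (sec F U)"
  using sec_graded by (simp add: graded_def)

lemma res_closed: "opn U \<Longrightarrow> opn W \<Longrightarrow> W \<subseteq> U \<Longrightarrow> s \<in> carrier (sec F U) \<Longrightarrow> res F U W s \<in> carrier (sec F W)"
  by (rule graded_homD(1)[OF res_graded_hom])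

lemma open_nbhd_of: "opn U \<Longrightarrow> p \<in> U \<Longrightarrow> opn (nbhd p)"
  using open_nbhd open_points by blast

text \<open>The least neighbourhoods of the points of U cover U, and u and v both glue the family of
  restrictions of u; gluing is unique.\<close>

lemma separated:
  assumes U: "opn U" and u: "u \<in> carrier (sec F U)" and v: "v \<in> carrier (sec F U)"
    and eq: "\<And>p. p \<in> U \<Longrightarrow> res F U (nbhd p) u = res F U (nbhd p) v"
  shows "u = v"
proof -
  have "\<exists>!w. w \<in> carrier (sec F (\<Union>(nbhd ` U))) \<and> (\<forall>W\<in>nbhd ` U. res F (\<Union>(nbhd ` U)) W w = res F U W u)"
  proof (rule glue)
    fix W assume "W \<in> nbhd ` U"
    then obtain p where p: "p \<in> U" "W = nbhd p" by blast
    show W: "opn W" using open_nbhd_of[OF U] p by simp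
    have WU: "W \<subseteq> U" using nbhd_subset[OF U] p by simp
    show "res F U W u \<in> carrier (sec F W)" by (rule res_closed[OF U W WU u])
    fix W' assume "W' \<in> nbhd ` U"
    then obtain q where q: "q \<in> U" "W' = nbhd q" by blast
    have W': "opn W'" "W' \<subseteq> U" using open_nbhd_of[OF U] nbhd_subset[OF U] q by simp_all
    show "res F W (W \<inter> W') (res F U W u) = res F W' (W \<inter> W') (res F U W' u)"
      using res_res[OF U W openin_Int[OF W W'(1)] Int_lower1 WU u]
        res_res[OF U W'(1) openin_Int[OF W W'(1)] Int_lower2 W'(2) u] by simp
  qed
  then have "\<exists>!w. w \<in> carrier (sec F U) \<and> (\<forall>W\<in>nbhd ` U. res F U W w = res F U W u)"
    unfolding Union_nbhd[OF U] .
  then show ?thesis by (rule ex1E) (use u v eq in auto)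
qed

text \<open>With a least neighbourhood at each point, the stalk is the module of sections over it,
  and the map from a vertex to an edge is a restriction. All stalks share the type of sections of
  F.\<close>

definition stalks :: "('t, 'v, 'e, 's, 's) gamma_sheaf" where
  "stalks = \<lparr>vmod = (\<lambda>x. restrict_scalars (diag (star x)) (sec F (star x))), vdeg = (\<lambda>x. sdeg F (star x)),
     emod = (\<lambda>L. restrict_scalars (edge_tuple L) (sec F {Inr L})), edeg = (\<lambda>L. sdeg F {Inr L}),
     rho = (\<lambda>x L. res F (star x) {Inr L})\<rparr>"

lemma stalks_simps [simp]:
  "vmod stalks x = restrict_scalars (diag (star x)) (sec F (star x))" "vdeg stalks x = sdeg F (star x)"
  "emod stalks L = restrict_scalars (edge_tuple L) (sec F {Inr L})" "edeg stalks L = sdeg F {Inr L}"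
  "rho stalks x L = res F (star x) {Inr L}"
  by (simp_all add: stalks_def)

lemma vertex_stalk_module:
  "x \<in> vertices G \<Longrightarrow> Module.module A (restrict_scalars (diag (star x)) (sec F (star x)))"
  by (rule module_restrict_scalars[OF sec_module[OF open_star] A.cring_axioms diag_hom[OF open_points[OF open_star]]])

lemma edge_stalk_module:
  "L \<in> edges G \<Longrightarrow> Module.module (E L) (restrict_scalars (edge_tuple L) (sec F {Inr L}))"
  by (rule module_restrict_scalars[OF sec_module[OF open_edge_point] edge_ring_cring edge_tuple_hom])

lemma is_gamma_sheaf_stalks: "is_gamma_sheaf scale G stalks"
  unfolding is_gamma_sheaf_def stalks_simps
proof (intro conjI ballI)
  fix x assume x: "x \<in> vertices G"
  let ?V = "restrict_scalars (diag (star x)) (sec F (star x))"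
  note st = open_star[OF x]
  show "graded_module A (polydeg scale) ?V (sdeg F (star x))"
    by (rule graded_module_restrict_scalars[OF sec_graded_module[OF st] A.cring_axioms diag_hom[OF open_points[OF st]] diag_deg])
  have "star x \<in> \<B>"
    using stalks_fg x least_nbhd_vertex[OF x] by (force simp: graph_points_def)
  from sec_fg[OF this] show "finitely_generated A ?V"
  proof (rule finitely_generated_image[OF sec_module[OF st] vertex_stalk_module[OF x]])
    \<comment> \<open>A scalar section over the star acts as the constant section of its value at x,
      so generators over the ring of sections generate over A.\<close>
    show "(\<lambda>a. fst a x) \<in> carrier (S (star x)) \<rightarrow> carrier A" by (auto simp: sections_iff)
    show "(\<lambda>s. s) ` carrier (sec F (star x)) = carrier ?V" by simp
  qed (simp_all add: diag_fst del: struct_simps)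
next
  fix L assume L: "L \<in> edges G"
  let ?E = "restrict_scalars (edge_tuple L) (sec F {Inr L})"
  note op = open_edge_point[OF L]
  show "graded_module (E L) (edge_deg scale G L) ?E (sdeg F {Inr L})"
    by (rule graded_module_restrict_scalars[OF sec_graded_module[OF op] edge_ring_cring[OF L] edge_tuple_hom[OF L] edge_tuple_deg])
  have "{Inr L} \<in> \<B>"
    using stalks_fg L least_nbhd_edge[OF L] by (force simp: graph_points_def)
  from sec_fg[OF this] show "finitely_generated (E L) ?E"
  proof (rule finitely_generated_image[OF sec_module[OF op] edge_stalk_module[OF L]])
    show "(\<lambda>a. snd a L) \<in> carrier (S {Inr L}) \<rightarrow> carrier (E L)" by (auto simp: sections_iff)
    show "(\<lambda>s. s) ` carrier (sec F {Inr L}) = carrier ?E" by simp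
  qed (simp_all add: edge_tuple_snd_scalar del: struct_simps)
  fix x assume xL: "x \<in> ends G L"
  have x: "x \<in> vertices G" by (rule ends_vertices[OF L xL])
  note st = open_star[OF x]
  have sub: "{Inr L} \<subseteq> star x" using L xL by simp
  note hom = res_graded_hom[OF st op sub]
  \<comment> \<open>Semilinearity of the restriction along \<open>pr L\<close>: the constant section
    of a restricts on L to its class in the edge ring.\<close>
  have "tuple_restrict {Inr L} (diag (star x) a) = edge_tuple L (pr L a)" if a: "a \<in> carrier A" for a
  proof -
    have "edge_tuple L (snd (tuple_restrict {Inr L} (diag (star x) a)) L) = tuple_restrict {Inr L} (diag (star x) a)"
      by (rule edge_tuple_snd_scalar[OF struct_restrict[OF diag_carrier[OF open_points[OF st] a] sub]])
    then show ?thesis using L xL by simp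
  qed
  then show "graded_hom A (pr L) (restrict_scalars (diag (star x)) (sec F (star x))) (sdeg F (star x))
     ?E (sdeg F {Inr L}) (res F (star x) {Inr L})"
    using hom diag_carrier[OF open_points[OF st]] unfolding graded_hom_def
    by (simp del: struct_simps polyring_simps)
qed

sublocale stalks: gamma_sheaf_on scale G stalks
  by unfold_locales (rule is_gamma_sheaf_stalks)

section \<open>Comparison of a module sheaf with the sections of its stalks\<close>

definition germs :: "('v, 'e) pts \<Rightarrow> 's \<Rightarrow> ('v, 'e, 's, 's) tuple" where
  "germs U u = (\<lambda>x\<in>Inl -` U. res F U (star x) u, \<lambda>L\<in>Inr -` U. res F U {Inr L} u)"

lemma germs_apply:
  "Inl x \<in> U \<Longrightarrow> fst (germs U u) x = res F U (star x) u"
  "Inr L \<in> U \<Longrightarrow> snd (germs U u) L = res F U {Inr L} u"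
  by (simp_all add: germs_def)

context
  fixes U assumes U: "opn U"
begin

lemma U_star: "Inl x \<in> U \<Longrightarrow> opn (star x)" "Inl x \<in> U \<Longrightarrow> star x \<subseteq> U"
  and U_edge: "Inr L \<in> U \<Longrightarrow> opn {Inr L}" "Inr L \<in> U \<Longrightarrow> {Inr L} \<subseteq> U"
  using open_nbhd_of[OF U, of "Inl x"] nbhd_subset[OF U, of "Inl x"]
    open_nbhd_of[OF U, of "Inr L"] nbhd_subset[OF U, of "Inr L"] by simp_all

lemma res_star_edge:
  assumes "u \<in> carrier (sec F U)" "Inl x \<in> U" "Inr L \<in> U" "x \<in> ends G L"
  shows "res F (star x) {Inr L} (res F U (star x) u) = res F U {Inr L} u"
  using assms points_edge[OF open_points[OF U]]
  by (intro res_res[OF U U_star(1) U_edge(1) _ U_star(2)]) auto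

lemma germs_carrier: "u \<in> carrier (sec F U) \<Longrightarrow> germs U u \<in> carrier (stalks.\<Gamma> U)"
  unfolding section_module_simps germs_def restrict_sections_iff stalks_simps restrict_scalars_simps
  using res_closed[OF U U_star] res_closed[OF U U_edge] res_star_edge by blast

lemma germs_homog:
  assumes u: "u \<in> sdeg F U d"
  shows "germs U u \<in> stalks.\<Gamma>d U d"
proof -
  have "u \<in> carrier (sec F U)" by (rule graded.homog_carrier[OF sec_graded[OF U] u])
  then show ?thesis
    unfolding germs_def restrict_sections_iff stalks_simps
    using graded_homD(4)[OF res_graded_hom[OF U U_star] u] graded_homD(4)[OF res_graded_hom[OF U U_edge] u]
      res_star_edge by blast
qed

text \<open>Restriction makes a scalar section over U act on a stalk at x through its value at x
  alone. This matches the action on F with the pointwise action on tuples of germs.\<close>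

lemma restrict_star: "a \<in> carrier (S U) \<Longrightarrow> Inl x \<in> U \<Longrightarrow> tuple_restrict (star x) a = diag (star x) (fst a x)"
  using diag_fst[OF struct_restrict[OF _ U_star(2)], of a x] by simp

lemma restrict_edge: "a \<in> carrier (S U) \<Longrightarrow> Inr L \<in> U \<Longrightarrow> tuple_restrict {Inr L} a = edge_tuple L (snd a L)"
  using edge_tuple_snd_scalar[OF struct_restrict[OF _ U_edge(2)], of a L] by simp

lemma germs_graded_hom: "graded_hom (S U) (\<lambda>a. a) (sec F U) (sdeg F U) (stalks.\<Gamma> U) (stalks.\<Gamma>d U) (germs U)"
  unfolding graded_hom_def
proof (intro conjI ballI allI)
  interpret F: Module.module "S U" "sec F U" by (rule sec_module[OF U])
  interpret \<Gamma>: Module.module "S U" "stalks.\<Gamma> U" by (rule stalks.section_module_module[OF open_points[OF U]])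
  note sD = graded_homD[OF res_graded_hom[OF U U_star]] and eD = graded_homD[OF res_graded_hom[OF U U_edge]]
  show "germs U \<in> carrier (sec F U) \<rightarrow> carrier (stalks.\<Gamma> U)" using germs_carrier by blast
  fix u v assume u: "u \<in> carrier (sec F U)" and v: "v \<in> carrier (sec F U)"
  show "germs U (u \<oplus>\<^bsub>sec F U\<^esub> v) = germs U u \<oplus>\<^bsub>stalks.\<Gamma> U\<^esub> germs U v"
    by (rule stalks.section_eqI[OF germs_carrier[OF F.a_closed[OF u v]] \<Gamma>.a_closed[OF germs_carrier[OF u] germs_carrier[OF v]]])
       (simp_all add: germs_apply sD eD u v)
next
  interpret F: Module.module "S U" "sec F U" by (rule sec_module[OF U])
  interpret \<Gamma>: Module.module "S U" "stalks.\<Gamma> U" by (rule stalks.section_module_module[OF open_points[OF U]])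
  note sD = graded_homD(3)[OF res_graded_hom[OF U U_star]] and eD = graded_homD(3)[OF res_graded_hom[OF U U_edge]]
  fix a u assume a: "a \<in> carrier (S U)" and u: "u \<in> carrier (sec F U)"
  show "germs U (a \<odot>\<^bsub>sec F U\<^esub> u) = a \<odot>\<^bsub>stalks.\<Gamma> U\<^esub> germs U u"
    by (rule stalks.section_eqI[OF germs_carrier[OF F.smult_closed[OF a u]] \<Gamma>.smult_closed[OF a germs_carrier[OF u]]])
       (simp_all add: germs_apply sD[OF _ _ a u] eD[OF _ _ a u] restrict_star[OF a] restrict_edge[OF a] del: struct_simps)
qed (use germs_homog in blast)

lemma germs_inj:
  assumes "u \<in> carrier (sec F U)" "v \<in> carrier (sec F U)" "germs U u = germs U v"
  shows "u = v"
proof (rule separated[OF U assms(1,2)])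
  fix p assume "p \<in> U"
  then show "res F U (nbhd p) u = res F U (nbhd p) v"
    using germs_apply(1)[of _ U u] germs_apply(1)[of _ U v] germs_apply(2)[of _ U u] germs_apply(2)[of _ U v]
    unfolding assms(3) by (cases p) auto
qed

text \<open>The entries of t are sections of F over least neighbourhoods, to be glued. Over the
  intersection of two distinct neighbourhoods it suffices to compare at edge points, by
  \<open>separated\<close>, and there both sides restrict to the entry of t at that edge.\<close>

lemma germs_surj:
  assumes t: "t \<in> carrier (stalks.\<Gamma> U)"
  shows "\<exists>u\<in>carrier (sec F U). t = germs U u"
proof -
  define val where "val p = (case p of Inl x \<Rightarrow> fst t x | Inr L \<Rightarrow> snd t L)" for p
  have nb: "opn (nbhd p)" "nbhd p \<subseteq> U" if "p \<in> U" for p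
    using open_nbhd_of[OF U that] nbhd_subset[OF U that] by simp_all
  have val: "val p \<in> carrier (sec F (nbhd p))" if "p \<in> U" for p
    using that stalks.section_apply(1,2)[OF t] by (cases p) (simp_all add: val_def)
  have at_edge: "res F (nbhd p) {Inr L} (val p) = snd t L" if p: "p \<in> U" and L: "Inr L \<in> nbhd p" for p L
  proof (cases p)
    case (Inl x)
    moreover have "Inr L \<in> U" using nb(2)[OF p] L by blast
    ultimately show ?thesis
      using stalks.section_apply(3)[OF t, of x L] p L by (simp add: val_def)
  next
    case (Inr L')
    then show ?thesis using L res_id[OF nb(1)[OF p] val[OF p]] by (simp add: val_def)
  qed
  have compat: "res F (nbhd p) (nbhd p \<inter> nbhd q) (val p) = res F (nbhd q) (nbhd p \<inter> nbhd q) (val q)"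
    if p: "p \<in> U" and q: "q \<in> U" for p q
  proof (cases "p = q")
    case False
    let ?V = "nbhd p \<inter> nbhd q"
    have V: "opn ?V" by (rule openin_Int[OF nb(1)[OF p] nb(1)[OF q]])
    show ?thesis
    proof (rule separated[OF V res_closed[OF nb(1)[OF p] V Int_lower1 val[OF p]] res_closed[OF nb(1)[OF q] V Int_lower2 val[OF q]]])
      fix r assume r: "r \<in> ?V"
      \<comment> \<open>The only vertex that a least neighbourhood can contain is the point it
        belongs to, so distinct ones share no vertex.\<close>
      obtain L where L: "r = Inr L"
        using r False by (cases p; cases q; cases r) auto
      have op: "opn {Inr L}" and sub: "{Inr L} \<subseteq> ?V" using open_nbhd_of[OF V r] r L by auto
      show "res F ?V (nbhd r) (res F (nbhd p) ?V (val p)) = res F ?V (nbhd r) (res F (nbhd q) ?V (val q))"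
        using res_res[OF nb(1)[OF p] V op sub Int_lower1 val[OF p]] res_res[OF nb(1)[OF q] V op sub Int_lower2 val[OF q]]
          at_edge[OF p, of L] at_edge[OF q, of L] sub L by simp
    qed
  qed simp
  have nbhd_inj: "p = q" if "nbhd p = nbhd q" for p q
  proof -
    have "p \<in> nbhd q" "q \<in> nbhd p" using that nbhd_self by auto
    then show ?thesis by (cases p; cases q) auto
  qed
  \<comment> \<open>The gluing axiom takes families indexed by open sets, while \<open>val\<close>
    is indexed by points; injectivity of \<open>nbhd\<close> lets the point be recovered from its
    neighbourhood.\<close>
  then have inv: "val (inv_into U nbhd (nbhd p)) = val p" if "p \<in> U" for p
    using inv_into_f_f[of nbhd U p] that by (simp add: inj_on_def)
  have "\<exists>!u. u \<in> carrier (sec F (\<Union>(nbhd ` U))) \<and>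
      (\<forall>W\<in>nbhd ` U. res F (\<Union>(nbhd ` U)) W u = val (inv_into U nbhd W))"
  proof (rule glue)
    show "opn W" if "W \<in> nbhd ` U" for W using that nb(1) by blast
    show "val (inv_into U nbhd W) \<in> carrier (sec F W)" if "W \<in> nbhd ` U" for W
      using that val inv by auto
    show "res F W (W \<inter> W') (val (inv_into U nbhd W)) = res F W' (W \<inter> W') (val (inv_into U nbhd W'))"
      if "W \<in> nbhd ` U" "W' \<in> nbhd ` U" for W W'
      using that compat inv by auto
  qed
  then obtain u where u: "u \<in> carrier (sec F U)"
    and u_res: "\<forall>W\<in>nbhd ` U. res F U W u = val (inv_into U nbhd W)"
    unfolding Union_nbhd[OF U] by (elim ex1E conjE)
  have u_at: "res F U (nbhd p) u = val p" if "p \<in> U" for p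
    using bspec[OF u_res imageI[OF that]] inv[OF that] by simp
  have "t = germs U u"
    using u_at[of "Inl x" for x] u_at[of "Inr L" for L]
    by (intro stalks.section_eqI[OF t germs_carrier[OF u]]) (simp_all add: germs_apply val_def)
  with u show ?thesis by blast
qed

lemma germs_graded_iso: "graded_iso (S U) (sec F U) (sdeg F U) (stalks.\<Gamma> U) (stalks.\<Gamma>d U) (germs U)"
proof -
  have "bij_betw (germs U) (carrier (sec F U)) (carrier (stalks.\<Gamma> U))"
    by (rule bij_betwI') (use germs_inj germs_surj germs_carrier in blast)+
  then show ?thesis using germs_graded_hom by (simp add: graded_iso_def)
qed

end

lemma germs_res:
  assumes U: "opn U" and W: "opn W" and WU: "W \<subseteq> U" and u: "u \<in> carrier (sec F U)"
  shows "germs W (res F U W u) = tuple_restrict W (germs U u)"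
proof (rule stalks.section_eqI[OF germs_carrier[OF W res_closed[OF U W WU u]]])
  show "tuple_restrict W (germs U u) \<in> carrier (stalks.\<Gamma> W)"
    using germs_carrier[OF U u] unfolding section_module_simps by (rule tuple_restrict_sections[OF _ WU])
  show "fst (germs W (res F U W u)) x = fst (tuple_restrict W (germs U u)) x" if "Inl x \<in> W" for x
    using that subsetD[OF WU that] res_res[OF U W U_star(1)[OF W that] U_star(2)[OF W that] WU u]
    by (simp add: germs_apply)
  show "snd (germs W (res F U W u)) L = snd (tuple_restrict W (germs U u)) L" if "Inr L \<in> W" for L
    using that subsetD[OF WU that] res_res[OF U W U_edge(1)[OF W that] U_edge(2)[OF W that] WU u]
    by (simp add: germs_apply)
qed

text \<open>The isomorphism is the inverse of \<open>germs\<close>, whose preservation of degrees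
  comes from \<open>graded_iso_sym\<close>. Naturality is checked after applying the injective
  \<open>germs\<close> on the smaller open set.\<close>

theorem module_sheaf_iso_stalks: "module_sheaf_iso scale G (sheaf_of_sections G stalks) F"
proof -
  define h where "h U = inv_into (carrier (sec F U)) (germs U)" for U
  have iso: "graded_iso (S U) (stalks.\<Gamma> U) (stalks.\<Gamma>d U) (sec F U) (sdeg F U) (h U)" if U: "opn U" for U
    unfolding h_def
    by (rule graded_iso_sym[OF sec_graded[OF U] gradedI[OF stalks.section_graded_module[OF open_points[OF U]]]
          germs_graded_iso[OF U]])
  have h: "h U s \<in> carrier (sec F U)" "germs U (h U s) = s" if U: "opn U" and s: "s \<in> carrier (stalks.\<Gamma> U)" for U s
  proof -
    have "s \<in> germs U ` carrier (sec F U)" using germs_surj[OF U s] by blast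
    then show "h U s \<in> carrier (sec F U)" "germs U (h U s) = s"
      unfolding h_def by (rule inv_into_into, rule f_inv_into_f)
  qed
  have "h W (tuple_restrict W s) = res F U W (h U s)"
    if U: "opn U" and W: "opn W" and WU: "W \<subseteq> U" and s: "s \<in> carrier (stalks.\<Gamma> U)" for U W s
  proof (rule germs_inj[OF W])
    have sW: "tuple_restrict W s \<in> carrier (stalks.\<Gamma> W)"
      using s unfolding section_module_simps by (rule tuple_restrict_sections[OF _ WU])
    show "h W (tuple_restrict W s) \<in> carrier (sec F W)" by (rule h(1)[OF W sW])
    show "res F U W (h U s) \<in> carrier (sec F W)" by (rule res_closed[OF U W WU h(1)[OF U s]])
    show "germs W (h W (tuple_restrict W s)) = germs W (res F U W (h U s))"
      using h(2)[OF W sW] germs_res[OF U W WU h(1)[OF U s]] h(2)[OF U s] by simp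
  qed
  with iso show ?thesis
    unfolding module_sheaf_iso_def stalks.sheaf_of_sections_simps by (intro exI[of _ h]) simp
qed

end

lemma (in gamma_sheaf_on) finitely_generated_least_nbhd:
  assumes "p \<in> graph_points G"
  shows "finitely_generated (S (least_nbhd G p)) (\<Gamma> (least_nbhd G p))"
proof (cases p)
  case (Inl x)
  then have "x \<in> vertices G" using assms by (auto simp: graph_points_def)
  then show ?thesis unfolding Inl least_nbhd_vertex[OF \<open>x \<in> vertices G\<close>] by (rule finitely_generated_star)
next
  case (Inr L)
  then have "L \<in> edges G" using assms by (auto simp: graph_points_def)
  then show ?thesis unfolding Inr least_nbhd_edge[OF \<open>L \<in> edges G\<close>] by (rule finitely_generated_edge)
qed

text \<open>The bijection is one of isomorphism classes: the equivalence gives well-definedness and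
  injectivity, and the last conjunct surjectivity. The Gamma-sheaf produced there is the one of
  stalks, which explains its type of elements.\<close>

theorem proposition1p1:
  fixes scale :: "complex \<Rightarrow> 't::ab_group_add \<Rightarrow> 't"
    and G :: "('t, 'v, 'e) moment_graph"
    and \<B> :: "('v, 'e) pts set"
  assumes "vector_space scale"
    and "is_moment_graph scale G"
    and "\<B> = {U. openin (graph_top G) U} \<and> (\<exists>B. finite_dimensional_vector_space scale B) \<or>
         \<B> = least_nbhd G ` graph_points G"
  shows "(\<forall>M :: ('t, 'v, 'e, 'm, 'n) gamma_sheaf.
            is_gamma_sheaf scale G M \<longrightarrow> is_module_sheaf scale G \<B> (sheaf_of_sections G M)) \<and>
         (\<forall>(M :: ('t, 'v, 'e, 'm, 'n) gamma_sheaf) (N :: ('t, 'v, 'e, 'p, 'q) gamma_sheaf).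
            is_gamma_sheaf scale G M \<longrightarrow> is_gamma_sheaf scale G N \<longrightarrow>
            (gamma_sheaf_iso scale G M N \<longleftrightarrow>
             module_sheaf_iso scale G (sheaf_of_sections G M) (sheaf_of_sections G N))) \<and>
         (\<forall>F :: ('t, 'v, 'e, 's) module_sheaf.
            is_module_sheaf scale G \<B> F \<longrightarrow>
            (\<exists>M :: ('t, 'v, 'e, 's, 's) gamma_sheaf.
               is_gamma_sheaf scale G M \<and> module_sheaf_iso scale G (sheaf_of_sections G M) F))"
proof (intro conjI allI impI)
  note mg = moment_graph_on.intro[OF assms(2)]
  note gs = gamma_sheaf_on.intro[OF mg gamma_sheaf_on_axioms.intro]
  {
    fix M :: "('t, 'v, 'e, 'm, 'n) gamma_sheaf"
    assume "is_gamma_sheaf scale G M"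
    then interpret gamma_sheaf_on scale G M by (rule gs)
    show "is_module_sheaf scale G \<B> (sheaf_of_sections G M)"
      using assms(3)
    proof
      assume *: "\<B> = {U. openin (graph_top G) U} \<and> (\<exists>B. finite_dimensional_vector_space scale B)"
      then obtain B where "finite_dimensional_vector_space scale B" by blast
      from finitely_generated_sections[OF noetherian_polyring[OF this] open_points] * show ?thesis
        by (intro is_module_sheaf_sections) blast
    next
      assume *: "\<B> = least_nbhd G ` graph_points G"
      show ?thesis
        by (rule is_module_sheaf_sections) (use finitely_generated_least_nbhd * in blast)
    qed
  next
    fix M :: "('t, 'v, 'e, 'm, 'n) gamma_sheaf" and N :: "('t, 'v, 'e, 'p, 'q) gamma_sheaf"
    assume M: "is_gamma_sheaf scale G M" and N: "is_gamma_sheaf scale G N"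
    note pair = gamma_sheaf_pair.intro[OF gs[OF M] gs[OF N]]
    show "gamma_sheaf_iso scale G M N \<longleftrightarrow>
        module_sheaf_iso scale G (sheaf_of_sections G M) (sheaf_of_sections G N)"
      using gamma_sheaf_pair.module_sheaf_isoI[OF pair] gamma_sheaf_pair.gamma_sheaf_isoI[OF pair] by (rule iffI)
  next
    fix F :: "('t, 'v, 'e, 's) module_sheaf"
    assume F: "is_module_sheaf scale G \<B> F"
    \<comment> \<open>If \<open>\<B>\<close> consists of all open sets, this holds because least
      neighbourhoods are themselves open.\<close>
    have "least_nbhd G ` graph_points G \<subseteq> \<B>"
      using assms(3) moment_graph_on.least_nbhd_eq[OF mg] moment_graph_on.open_nbhd[OF mg] by auto
    note sh = module_sheaf_on.intro[OF mg module_sheaf_on_axioms.intro[OF F this]]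
    show "\<exists>M :: ('t, 'v, 'e, 's, 's) gamma_sheaf.
        is_gamma_sheaf scale G M \<and> module_sheaf_iso scale G (sheaf_of_sections G M) F"
      using module_sheaf_on.is_gamma_sheaf_stalks[OF sh] module_sheaf_on.module_sheaf_iso_stalks[OF sh]
      by (intro exI conjI)
  }
qed

end
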